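(* Let $K$ be an algebraically closed field, $Q$ a finite quiver without oriented cycles, $\Lambda=KQ$, $L$ the maximum of the lengths of paths in $Q$, and $\mathbf B$ the adjacency matrix of $Q$. Let $\mathbf d$ be a dimension vector. The generic radical layering $\mathbb S=(\mathbb S_0,\dots,\mathbb S_L)$ of the $\Lambda$-modules with dimension vector $\mathbf d$ is determined by the dimension vectors $\mathbf t^{(l)}=\underline{\dim}\,\mathbb S_l$ for $0\le l\le L$, where $$\mathbf t^{(0)}=\sup\{\mathbf 0,\ \mathbf d-\mathbf d\cdot\mathbf B\}$$ and $$\mathbf t^{(l+1)}=\sup\Bigl\{\mathbf 0,\ \Bigl(\mathbf d-\sum_{i\le l}\mathbf t^{(i)}\Bigr)-\Bigl(\mathbf d-\sum_{i\le l}\mathbf t^{(i)}\Bigr)\cdot\mathbf B\Bigr\}.$$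
   Context: $\mathbf B_{ij}$ is the number of arrows from $e_i$ to $e_j$; dimension vectors are row vectors in $\mathbb N_0^{|Q_0|}$ and suprema are taken with respect to the componentwise partial order on $\mathbb Z^{|Q_0|}$. With $J$ the Jacobson radical of $\Lambda$ (so $J^{L+1}=0$), the radical layering of a module $M$ is $\mathbb S(M)=(J^lM/J^{l+1}M)_{0\le l\le L}$, with isomorphic semisimple modules identified. $\mathbf{Rep}_{\mathbf d}(\Lambda)$ is the affine space of all families of matrices $(x_\alpha)_{\alpha\in Q_1}$, $x_\alpha\in\mathrm{Hom}_K(K^{d_i},K^{d_j})$ for $\alpha:e_i\to e_j$, parametrizing the $\Lambda$-modules with dimension vector $\mathbf d$. The generic radical layering is the value of $\mathbb S(M_x)$, where $M_x$ is the module encoded by $x$, which is attained for all $x$ in a dense open subset of $\mathbf{Rep}_{\mathbf d}(\Lambda)$. *)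

theory Defs
  imports
    "HOL-Analysis.Abstract_Topology"
    "HOL-Algebra.Ideal_Product"
    "HOL-Computational_Algebra.Polynomial"
    "HOL-Library.Function_Algebras"
    "Jordan_Normal_Form.VS_Connect"
    "Graph_Theory.Arc_Walk"
begin

section \<open>Left modules over a not necessarily commutative ring\<close>

text \<open>
  The locale \<^locale>\<open>module\<close> requires a commutative ring of scalars; the following has the
  same module axioms over an arbitrary ring.
\<close>

locale left_module = R?: ring R + M?: abelian_group M
  for R :: "('a, 'r) ring_scheme" (structure) and M :: "('a, 'm, 's) module_scheme" (structure) +
  assumes smult_closed:
      "\<lbrakk>a \<in> carrier R; x \<in> carrier M\<rbrakk> \<Longrightarrow> a \<odot>\<^bsub>M\<^esub> x \<in> carrier M"
    and smult_l_distr: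
      "\<lbrakk>a \<in> carrier R; b \<in> carrier R; x \<in> carrier M\<rbrakk> \<Longrightarrow>
        (a \<oplus> b) \<odot>\<^bsub>M\<^esub> x = a \<odot>\<^bsub>M\<^esub> x \<oplus>\<^bsub>M\<^esub> b \<odot>\<^bsub>M\<^esub> x"
    and smult_r_distr:
      "\<lbrakk>a \<in> carrier R; x \<in> carrier M; y \<in> carrier M\<rbrakk> \<Longrightarrow>
        a \<odot>\<^bsub>M\<^esub> (x \<oplus>\<^bsub>M\<^esub> y) = a \<odot>\<^bsub>M\<^esub> x \<oplus>\<^bsub>M\<^esub> a \<odot>\<^bsub>M\<^esub> y"
    and smult_assoc1:
      "\<lbrakk>a \<in> carrier R; b \<in> carrier R; x \<in> carrier M\<rbrakk> \<Longrightarrow>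
        (a \<otimes> b) \<odot>\<^bsub>M\<^esub> x = a \<odot>\<^bsub>M\<^esub> (b \<odot>\<^bsub>M\<^esub> x)"
    and smult_one:
      "x \<in> carrier M \<Longrightarrow> \<one> \<odot>\<^bsub>M\<^esub> x = x"

definition module_iso ::
    "('a, 'r) ring_scheme \<Rightarrow> ('a, 'm, 's) module_scheme \<Rightarrow> ('a, 'n, 't) module_scheme \<Rightarrow> bool" where
  "module_iso R M N \<longleftrightarrow>
     (\<exists>f \<in> LinearCombinations.module_hom R M N. bij_betw f (carrier M) (carrier N))"

definition semisimple_module ::
    "('a, 'r) ring_scheme \<Rightarrow> ('a, 'm, 's) module_scheme \<Rightarrow> bool" where
  "semisimple_module R M \<longleftrightarrow> left_module R M \<and>
     (\<forall>N. Module.submodule N R M \<longrightarrow>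
        (\<exists>N'. Module.submodule N' R M \<and> N \<inter> N' = {\<zero>\<^bsub>M\<^esub>} \<and> N <+>\<^bsub>M\<^esub> N' = carrier M))"

text \<open>The elements of the quotient are the cosets of the submodule \<open>H\<close>.\<close>

definition quotient_module :: "('a, 'm, 's) module_scheme \<Rightarrow> 'm set \<Rightarrow> ('a, 'm set) module" where
  "quotient_module M H =
     \<lparr>carrier = a_rcosets\<^bsub>M\<^esub> H, mult = undefined, one = undefined,
      zero = H, add = set_add M,
      smult = (\<lambda>a X. \<Union>x\<in>X. H +>\<^bsub>M\<^esub> (a \<odot>\<^bsub>M\<^esub> x))\<rparr>"


section \<open>Jacobson radical and radical layering\<close>

definition left_ideal :: "'a set \<Rightarrow> ('a, 'r) ring_scheme \<Rightarrow> bool" where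
  "left_ideal I R \<longleftrightarrow> additive_subgroup I R \<and> (\<forall>a\<in>carrier R. \<forall>x\<in>I. a \<otimes>\<^bsub>R\<^esub> x \<in> I)"

definition maximal_left_ideal :: "'a set \<Rightarrow> ('a, 'r) ring_scheme \<Rightarrow> bool" where
  "maximal_left_ideal I R \<longleftrightarrow> left_ideal I R \<and> I \<noteq> carrier R \<and>
     (\<forall>I'. left_ideal I' R \<and> I \<subseteq> I' \<longrightarrow> I' = I \<or> I' = carrier R)"

definition jacobson_radical :: "('a, 'r) ring_scheme \<Rightarrow> 'a set" where
  "jacobson_radical R = carrier R \<inter> \<Inter>{I. maximal_left_ideal I R}"

primrec ideal_power :: "('a, 'r) ring_scheme \<Rightarrow> 'a set \<Rightarrow> nat \<Rightarrow> 'a set" where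
  "ideal_power R I 0 = carrier R"
| "ideal_power R I (Suc n) = ideal_prod R I (ideal_power R I n)"

text \<open>The submodule \<open>I M\<close>: all finite sums of products of elements of \<open>I\<close> and \<open>M\<close>.\<close>

inductive_set ideal_smult :: "'a set \<Rightarrow> ('a, 'm, 's) module_scheme \<Rightarrow> 'm set" for I and M where
  prod: "\<lbrakk>a \<in> I; x \<in> carrier M\<rbrakk> \<Longrightarrow> a \<odot>\<^bsub>M\<^esub> x \<in> ideal_smult I M"
| sum: "\<lbrakk>x \<in> ideal_smult I M; y \<in> ideal_smult I M\<rbrakk> \<Longrightarrow> x \<oplus>\<^bsub>M\<^esub> y \<in> ideal_smult I M"

definition radical_power ::
    "('a, 'r) ring_scheme \<Rightarrow> ('a, 'm, 's) module_scheme \<Rightarrow> nat \<Rightarrow> 'm set" where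
  "radical_power R M l = ideal_smult (ideal_power R (jacobson_radical R) l) M"

definition radical_layering ::
    "('a, 'r) ring_scheme \<Rightarrow> ('a, 'm, 's) module_scheme \<Rightarrow> nat \<Rightarrow> ('a, 'm set) module" where
  "radical_layering R M l =
     quotient_module (M\<lparr>carrier := radical_power R M l\<rparr>) (radical_power R M (Suc l))"


section \<open>Quivers and path algebras\<close>

text \<open>
  A quiver is a multi-digraph. A path is given by its starting vertex and its list of arrows in
  the order of traversal, so that \<open>(i, [])\<close> is the path of length zero at \<open>i\<close>.
\<close>

type_synonym ('v, 'e) path = "'v \<times> 'e list"

definition paths :: "('v, 'e) pre_digraph \<Rightarrow> ('v, 'e) path set" where
  "paths Q = {(u, p). \<exists>v. pre_digraph.awalk Q u p v}"

definition path_target :: "('v, 'e) pre_digraph \<Rightarrow> ('v, 'e) path \<Rightarrow> 'v" where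
  "path_target Q = (\<lambda>(u, p). last (pre_digraph.awalk_verts Q u p))"

definition max_path_length :: "('v, 'e) pre_digraph \<Rightarrow> nat" where
  "max_path_length Q = Max {length p | u p. (u, p) \<in> paths Q}"

definition adjacency :: "('v, 'e) pre_digraph \<Rightarrow> 'v \<Rightarrow> 'v \<Rightarrow> int" where
  "adjacency Q i j = int (card {e \<in> arcs Q. tail Q e = i \<and> head Q e = j})"

text \<open>The product of a row vector with the adjacency matrix.\<close>

definition times_adjacency :: "('v, 'e) pre_digraph \<Rightarrow> ('v \<Rightarrow> int) \<Rightarrow> 'v \<Rightarrow> int" where
  "times_adjacency Q v = (\<lambda>j. \<Sum>i\<in>verts Q. v i * adjacency Q i j)"

text \<open>
  Paths are composed like functions: for paths \<open>p\<close> and \<open>q\<close> the product \<open>q p\<close> is \<open>p\<close> followed by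
  \<open>q\<close> if \<open>q\<close> starts where \<open>p\<close> ends, and zero otherwise. This is the convention under which left
  modules are representations with maps from the tail to the head of each arrow. The coefficient
  of a path in a product is therefore a sum over all ways to cut that path into two.
\<close>

definition path_algebra :: "('v, 'e) pre_digraph \<Rightarrow> (('v, 'e) path \<Rightarrow> 'k::field) ring" where
  "path_algebra Q =
     \<lparr>carrier = {a. finite {r. a r \<noteq> 0} \<and> (\<forall>r. r \<notin> paths Q \<longrightarrow> a r = 0)},
      mult = (\<lambda>a b (u, p). \<Sum>k\<le>length p.
                a (path_target Q (u, take k p), drop k p) * b (u, take k p)),
      one = (\<lambda>(u, p). if u \<in> verts Q \<and> p = [] then 1 else 0),
      zero = (\<lambda>_. 0),
      add = (\<lambda>a b r. a r + b r)\<rparr>"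

definition vertex_idempotent :: "'v \<Rightarrow> ('v, 'e) path \<Rightarrow> 'k::field" where
  "vertex_idempotent i = (\<lambda>r. if r = (i, []) then 1 else 0)"

text \<open>
  The \<open>K\<close>-vector space underlying a module over the path algebra; a scalar \<open>c\<close> acts as
  \<open>c\<close> times the identity of the path algebra.
\<close>

definition underlying_space ::
    "('v, 'e) pre_digraph \<Rightarrow> (('v, 'e) path \<Rightarrow> 'k::field, 'm) module \<Rightarrow> ('k, 'm) module" where
  "underlying_space Q N =
     \<lparr>carrier = carrier N, mult = mult N, one = one N, zero = zero N, add = add N,
      smult = (\<lambda>c x. (\<lambda>r. c * \<one>\<^bsub>path_algebra Q\<^esub> r) \<odot>\<^bsub>N\<^esub> x)\<rparr>"

definition finite_dimensional ::
    "('v, 'e) pre_digraph \<Rightarrow> (('v, 'e) path \<Rightarrow> 'k::field, 'm) module \<Rightarrow> bool" where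
  "finite_dimensional Q N \<longleftrightarrow> vectorspace.fin_dim class_ring (underlying_space Q N)"

text \<open>
  The entry at \<open>i\<close> is the dimension of \<open>e\<^sub>i N\<close>. It is meaningful for finite dimensional
  \<open>N\<close> only, because \<^const>\<open>vectorspace.dim\<close> is unspecified for infinite dimensional spaces.
\<close>

definition dimension_vector ::
    "('v, 'e) pre_digraph \<Rightarrow> (('v, 'e) path \<Rightarrow> 'k::field, 'm) module \<Rightarrow> 'v \<Rightarrow> nat" where
  "dimension_vector Q N i = vectorspace.dim class_ring
     ((underlying_space Q N)\<lparr>carrier := (\<lambda>x. vertex_idempotent i \<odot>\<^bsub>N\<^esub> x) ` carrier N\<rparr>)"


section \<open>The representation variety\<close>

definition Rep :: "('v, 'e) pre_digraph \<Rightarrow> ('v \<Rightarrow> nat) \<Rightarrow> ('e \<Rightarrow> 'k::field mat) set" where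
  "Rep Q d = (\<Pi>\<^sub>E e\<in>arcs Q. carrier_mat (d (head Q e)) (d (tail Q e)))"

text \<open>The linear map by which a path acts; the first arrow of the path is applied first.\<close>

definition path_action :: "('e \<Rightarrow> 'k::field mat) \<Rightarrow> 'e list \<Rightarrow> 'k vec \<Rightarrow> 'k vec" where
  "path_action x p v = fold (\<lambda>e w. x e *\<^sub>v w) p v"

definition rep_module ::
    "('v, 'e) pre_digraph \<Rightarrow> ('v \<Rightarrow> nat) \<Rightarrow> ('e \<Rightarrow> 'k::field mat) \<Rightarrow>
      (('v, 'e) path \<Rightarrow> 'k, 'v \<Rightarrow> 'k vec) module" where
  "rep_module Q d x =
     \<lparr>carrier = (\<Pi>\<^sub>E i\<in>verts Q. carrier_vec (d i)), mult = undefined, one = undefined,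
      zero = (\<lambda>i\<in>verts Q. 0\<^sub>v (d i)),
      add = (\<lambda>m n. \<lambda>i\<in>verts Q. m i + n i),
      smult = (\<lambda>a m. \<lambda>j\<in>verts Q. vec (d j) (\<lambda>k.
                 \<Sum>(u, p) \<in> {r. a r \<noteq> 0 \<and> path_target Q r = j}.
                   a (u, p) * path_action x p (m u) $ k))\<rparr>"

text \<open>Polynomials in the matrix entries, as functions.\<close>

inductive_set polynomial_functions ::
    "('v, 'e) pre_digraph \<Rightarrow> ('v \<Rightarrow> nat) \<Rightarrow> (('e \<Rightarrow> 'k::field mat) \<Rightarrow> 'k) set" for Q d where
  const: "(\<lambda>x. c) \<in> polynomial_functions Q d"
| coord: "\<lbrakk>e \<in> arcs Q; r < d (head Q e); s < d (tail Q e)\<rbrakk> \<Longrightarrow>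
            (\<lambda>x. x e $$ (r, s)) \<in> polynomial_functions Q d"
| add: "\<lbrakk>f \<in> polynomial_functions Q d; g \<in> polynomial_functions Q d\<rbrakk> \<Longrightarrow>
          (\<lambda>x. f x + g x) \<in> polynomial_functions Q d"
| mult: "\<lbrakk>f \<in> polynomial_functions Q d; g \<in> polynomial_functions Q d\<rbrakk> \<Longrightarrow>
          (\<lambda>x. f x * g x) \<in> polynomial_functions Q d"

definition zariski_open ::
    "('v, 'e) pre_digraph \<Rightarrow> ('v \<Rightarrow> nat) \<Rightarrow> ('e \<Rightarrow> 'k::field mat) set \<Rightarrow> bool" where
  "zariski_open Q d U \<longleftrightarrow>
     (\<exists>F \<subseteq> polynomial_functions Q d. U = Rep Q d - {x \<in> Rep Q d. \<forall>f\<in>F. f x = 0})"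

lemma istopology_zariski_open: "istopology (zariski_open Q d)"
  unfolding istopology_def
proof (intro conjI allI impI)
  fix S T :: "('a \<Rightarrow> 'b mat) set"
  assume "zariski_open Q d S" "zariski_open Q d T"
  then obtain F G where F: "F \<subseteq> polynomial_functions Q d"
      and S: "S = Rep Q d - {x \<in> Rep Q d. \<forall>f\<in>F. f x = 0}"
      and G: "G \<subseteq> polynomial_functions Q d"
      and T: "T = Rep Q d - {x \<in> Rep Q d. \<forall>f\<in>G. f x = 0}"
    unfolding zariski_open_def by blast
  let ?H = "(\<lambda>(f, g) x. f x * g x) ` (F \<times> G)"
  have "?H \<subseteq> polynomial_functions Q d"
    using F G by (auto intro!: polynomial_functions.mult)
  moreover have "S \<inter> T = Rep Q d - {x \<in> Rep Q d. \<forall>f\<in>?H. f x = 0}"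
    unfolding S T by (auto simp: image_iff)
  ultimately show "zariski_open Q d (S \<inter> T)"
    unfolding zariski_open_def by blast
next
  fix \<K> :: "('a \<Rightarrow> 'b mat) set set"
  assume "\<forall>K\<in>\<K>. zariski_open Q d K"
  then have open_K: "\<And>K. K \<in> \<K> \<Longrightarrow> zariski_open Q d K"
    by blast
  define F where "F = {f \<in> polynomial_functions Q d. \<forall>x\<in>Rep Q d. f x \<noteq> 0 \<longrightarrow> x \<in> \<Union>\<K>}"
  have "\<Union>\<K> = Rep Q d - {x \<in> Rep Q d. \<forall>f\<in>F. f x = 0}"
  proof (intro equalityI subsetI)
    fix x assume "x \<in> \<Union>\<K>"
    then obtain K where K: "K \<in> \<K>" and x: "x \<in> K"
      by (rule UnionE)
    obtain G where G: "G \<subseteq> polynomial_functions Q d"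
        and KG: "K = Rep Q d - {x \<in> Rep Q d. \<forall>f\<in>G. f x = 0}"
      using open_K[OF K] unfolding zariski_open_def by (elim exE conjE)
    have mem: "y \<in> K" if "y \<in> Rep Q d" "f \<in> G" "f y \<noteq> 0" for f y
      unfolding KG using that by simp blast
    obtain f where f: "f \<in> G" "f x \<noteq> 0" and xR: "x \<in> Rep Q d"
      using x unfolding KG by simp blast
    have "f \<in> F"
      unfolding F_def using f(1) G mem K by (simp add: subset_iff) blast
    then show "x \<in> Rep Q d - {x \<in> Rep Q d. \<forall>f\<in>F. f x = 0}"
      using f(2) xR by simp blast
  next
    fix x assume "x \<in> Rep Q d - {x \<in> Rep Q d. \<forall>f\<in>F. f x = 0}"
    then obtain f where "f \<in> F" "f x \<noteq> 0" "x \<in> Rep Q d"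
      by simp blast
    then show "x \<in> \<Union>\<K>"
      unfolding F_def by simp
  qed
  moreover have "F \<subseteq> polynomial_functions Q d"
    unfolding F_def by (rule Collect_restrict)
  ultimately show "zariski_open Q d (\<Union>\<K>)"
    unfolding zariski_open_def by (intro exI conjI)
qed

definition zariski ::
    "('v, 'e) pre_digraph \<Rightarrow> ('v \<Rightarrow> nat) \<Rightarrow> ('e \<Rightarrow> 'k::field mat) topology" where
  "zariski Q d = topology (zariski_open Q d)"

lemma openin_zariski: "openin (zariski Q d) U \<longleftrightarrow> zariski_open Q d U"
  by (simp add: zariski_def istopology_zariski_open)

lemma topspace_zariski: "topspace (zariski Q d) = Rep Q d"
proof
  show "topspace (zariski Q d) \<subseteq> Rep Q d"
    unfolding topspace_def openin_zariski zariski_open_def by blast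
  have "{\<lambda>x. 1} \<subseteq> polynomial_functions Q d"
    using polynomial_functions.const by blast
  then have "zariski_open Q d (Rep Q d)"
    unfolding zariski_open_def by (intro exI[of _ "{\<lambda>x. 1}"]) auto
  then show "Rep Q d \<subseteq> topspace (zariski Q d)"
    unfolding openin_zariski[symmetric] by (rule openin_subset)
qed

text \<open>
  A sequence \<open>S\<close> of modules, considered up to isomorphism and only at the indices \<open>0, \<dots>, L\<close>, is
  the generic radical layering if it is the radical layering at all points of a dense open set.
\<close>

definition generic_radical_layering ::
    "('v, 'e) pre_digraph \<Rightarrow> ('v \<Rightarrow> nat) \<Rightarrow>
      (nat \<Rightarrow> (('v, 'e) path \<Rightarrow> 'k::field, 'm) module) \<Rightarrow> bool" where
  "generic_radical_layering Q d S \<longleftrightarrow>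
     (\<exists>U. openin (zariski Q d) U \<and> zariski Q d closure_of U = topspace (zariski Q d) \<and>
        (\<forall>x\<in>U. \<forall>l\<le>max_path_length Q.
           module_iso (path_algebra Q) (radical_layering (path_algebra Q) (rep_module Q d x) l) (S l)))"

end

theory Submission
  imports Defs
begin

text \<open>
  Write \<open>M\<^sub>x\<close> for the module encoded by \<open>x\<close>. As the quiver is acyclic, the Jacobson radical \<open>J\<close> of
  the path algebra is the ideal of the paths of positive length
  (\<open>jacobson_radical_path_algebra\<close>), and the component of \<open>J\<^sup>l M\<^sub>x\<close> at a vertex \<open>j\<close> is the sum of the
  images of the maps \<open>x\<^sub>p\<close> for the paths \<open>p\<close> of length at least \<open>l\<close> that end at \<open>j\<close>. This component
  is contained in the one of \<open>J\<^sup>l\<^sup>-\<^sup>1 M\<^sub>x\<close> and is spanned by the images of the components of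
  \<open>J\<^sup>l\<^sup>-\<^sup>1 M\<^sub>x\<close> under the arrows into \<open>j\<close>. Its dimension is therefore bounded by \<open>w\<^sub>l(j)\<close>, where
  \<open>w\<^sub>0 = d\<close> and \<open>w\<^sub>l\<^sub>+\<^sub>1 = min(w\<^sub>l, w\<^sub>l B)\<close>. This is \<open>generic_dim\<close>, and the recursion of the theorem says
  that \<open>t\<^sup>(\<^sup>l\<^sup>) = w\<^sub>l - w\<^sub>l\<^sub>+\<^sub>1\<close> (\<open>recursion_eq_generic_dim_diff\<close>).

  The bounds are attained simultaneously. Since \<open>w\<^sub>l B\<close> decreases with \<open>l\<close>, one has
  \<open>w\<^sub>l\<^sub>+\<^sub>1 = min(d, w\<^sub>l B)\<close>, so the unit vectors at the tails of the arrows into \<open>j\<close> can be sent one by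
  one to the unit vectors at \<open>j\<close>, the deepest ones first, until either run out. In the resulting
  representation \<open>x\<^sub>0\<close>, each of the first \<open>w\<^sub>l(j)\<close> unit vectors at \<open>j\<close> is the image of a unit vector
  under a path of length \<open>l\<close> (\<open>unit_vectors_by_paths\<close>). Choose such a path for every unit vector,
  as long as possible. The images under the chosen paths in another representation \<open>x\<close> are the
  columns of square matrices \<open>G\<^sub>j(x)\<close> that are polynomial in \<open>x\<close> and are identity matrices for
  \<open>x = x\<^sub>0\<close>. Where no \<open>det G\<^sub>j(x)\<close> vanishes, the first \<open>w\<^sub>l(j)\<close> columns of \<open>G\<^sub>j(x)\<close> are linearly
  independent elements of \<open>J\<^sup>l M\<^sub>x\<close>, so by the upper bound they form a basis of its component
  (locale \<open>adapted_rep\<close>, lemma \<open>radical_power_eq_F\<close>). This locus is open and nonempty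
  (\<open>generic_adapted_rep\<close>), hence dense, because two points of the affine space can be joined by a
  line and a nonzero polynomial in one variable over an infinite field has nonzero values
  (\<open>zariski_open_Int_nonempty\<close>).

  For all \<open>x\<close> in this locus the layer \<open>J\<^sup>l M\<^sub>x / J\<^sup>l\<^sup>+\<^sup>1 M\<^sub>x\<close> is thus isomorphic to \<open>vertex_module\<close>, the
  sum of \<open>w\<^sub>l(i) - w\<^sub>l\<^sub>+\<^sub>1(i)\<close> copies of the simple modules at the vertices \<open>i\<close>
  (\<open>module_iso_radical_layering\<close>). An abstract module is isomorphic to this one if and only if it is
  semisimple and finite dimensional with this dimension vector (\<open>module_iso_vertex_module_iff\<close>).
  Any dense open set that witnesses another generic layering meets the locus, so that the layering
  is unique up to isomorphism.
\<close>

section \<open>The path algebra and its Jacobson radical\<close>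

lemma path_target_Nil [simp]: "path_target Q (u, []) = u"
  by (simp add: path_target_def pre_digraph.awalk_verts_conv)

lemma path_target_Cons [simp]: "path_target Q (u, e # p) = path_target Q (head Q e, p)"
  by (simp add: path_target_def pre_digraph.awalk_verts_conv)

lemma path_target_append: "path_target Q (u, p @ q) = path_target Q (path_target Q (u, p), q)"
  by (induction p arbitrary: u) simp_all

lemma path_target_snoc [simp]: "path_target Q (u, p @ [e]) = head Q e"
  by (simp add: path_target_append)

definition path_monomial :: "'k::zero \<Rightarrow> ('v, 'e) path \<Rightarrow> ('v, 'e) path \<Rightarrow> 'k" where
  "path_monomial c r = (\<lambda>r'. if r' = r then c else 0)"

lemma path_monomial_apply [simp]: "path_monomial c r r' = (if r' = r then c else 0)"
  by (simp add: path_monomial_def)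

lemma vertex_idempotent_eq: "vertex_idempotent i = path_monomial 1 (i, [])"
  by (simp add: vertex_idempotent_def path_monomial_def)

text \<open>
  The path algebra is spanned by the multiples of paths; in the form of an induction principle
  for sets that are closed under addition.
\<close>

lemma finite_support_induct:
  fixes a :: "('v, 'e) path \<Rightarrow> 'k::comm_monoid_add"
  assumes fin: "finite {r. a r \<noteq> 0}"
    and zero: "(\<lambda>_. 0) \<in> X"
    and mono: "\<And>r. a r \<noteq> 0 \<Longrightarrow> path_monomial (a r) r \<in> X"
    and add: "\<And>b c. b \<in> X \<Longrightarrow> c \<in> X \<Longrightarrow> (\<lambda>r. b r + c r) \<in> X"
  shows "a \<in> X"
proof -
  have *: "(\<lambda>r. if r \<in> S then a r else 0) \<in> X" if "finite S" "S \<subseteq> {r. a r \<noteq> 0}" for S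
    using that
  proof (induction S rule: finite_induct)
    case empty
    then show ?case using zero by simp
  next
    case (insert s S)
    have "(\<lambda>r. path_monomial (a s) s r + (if r \<in> S then a r else 0)) \<in> X"
      using insert by (intro add mono) auto
    also have "(\<lambda>r. path_monomial (a s) s r + (if r \<in> S then a r else 0))
        = (\<lambda>r. if r \<in> insert s S then a r else 0)"
      using insert.hyps by auto
    finally show ?case .
  qed
  have "a = (\<lambda>r. if r \<in> {r. a r \<noteq> 0} then a r else 0)" by auto
  then show ?thesis using *[OF fin] by simp
qed

locale acyclic_quiver = fin_digraph Q for Q :: "('v, 'e) pre_digraph" +
  assumes no_cycle: "\<nexists>p. pre_digraph.cycle Q p"
begin

lemma paths_iff: "(u, p) \<in> paths Q \<longleftrightarrow> awalk u p (path_target Q (u, p))"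
  by (auto simp: paths_def path_target_def)

lemma paths_append_iff:
  "(u, p @ q) \<in> paths Q \<longleftrightarrow> (u, p) \<in> paths Q \<and> (path_target Q (u, p), q) \<in> paths Q"
proof -
  have "path_target Q (u, p) = awlast u p"
    by (simp add: path_target_def)
  then show ?thesis
    by (simp add: paths_iff path_target_append)
qed

lemma paths_Nil_iff [simp]: "(u, []) \<in> paths Q \<longleftrightarrow> u \<in> verts Q"
  by (simp add: paths_iff awalk_Nil_iff)

lemma paths_single_iff [simp]: "(u, [e]) \<in> paths Q \<longleftrightarrow> e \<in> arcs Q \<and> u = tail Q e"
  by (auto simp: paths_iff awalk_Cons_iff awalk_Nil_iff)

lemma path_target_in_verts: "r \<in> paths Q \<Longrightarrow> path_target Q r \<in> verts Q"
  by (cases r) (auto simp: paths_iff)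

lemma path_source_in_verts: "(u, p) \<in> paths Q \<Longrightarrow> u \<in> verts Q"
  by (auto simp: paths_iff)

text \<open>By acyclicity a path visits no vertex twice.\<close>

lemma path_length_less: "(u, p) \<in> paths Q \<Longrightarrow> length p < card (verts Q)"
proof -
  assume "(u, p) \<in> paths Q"
  then have p: "awalk u p (path_target Q (u, p))"
    by (simp add: paths_iff)
  have "distinct (awalk_verts u p)"
  proof (rule ccontr)
    assume "\<not> distinct (awalk_verts u p)"
    from awalk_not_distinct_decomp[OF p this] obtain r w where "awalk w r w" "0 < length r"
      by blast
    then have "closed_w r"
      unfolding closed_w_def by blast
    then show False
      using closed_w_imp_cycle no_cycle by metis
  qed
  with p show ?thesis
    using length_apath_less by (simp add: apath_def)
qed

abbreviation \<Lambda> :: "(('v, 'e) path \<Rightarrow> 'k::field) ring" where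
  "\<Lambda> \<equiv> path_algebra Q"

lemma path_algebra_carrier_iff:
  "a \<in> carrier \<Lambda> \<longleftrightarrow> finite {r. a r \<noteq> 0} \<and> (\<forall>r. r \<notin> paths Q \<longrightarrow> a r = 0)"
  by (simp add: path_algebra_def)

lemma path_algebra_simps [simp]:
  "\<zero>\<^bsub>\<Lambda>\<^esub> = (\<lambda>_. 0)"
  "\<one>\<^bsub>\<Lambda>\<^esub> = (\<lambda>(u, p). if u \<in> verts Q \<and> p = [] then 1 else 0)"
  "a \<oplus>\<^bsub>\<Lambda>\<^esub> b = (\<lambda>r. a r + b r)"
  by (simp_all add: path_algebra_def)

lemma path_algebra_mult:
  "(a \<otimes>\<^bsub>\<Lambda>\<^esub> b) (u, p)
     = (\<Sum>k\<le>length p. a (path_target Q (u, take k p), drop k p) * b (u, take k p))"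
  by (simp add: path_algebra_def)

lemma path_monomial_in_carrier [simp]: "r \<in> paths Q \<Longrightarrow> path_monomial c r \<in> carrier \<Lambda>"
  by (auto simp: path_algebra_carrier_iff intro: finite_subset[of _ "{r}"])

lemma path_algebra_mult_closed:
  fixes a b :: "('v, 'e) path \<Rightarrow> 'k::field"
  assumes a: "a \<in> carrier \<Lambda>" and b: "b \<in> carrier \<Lambda>"
  shows "a \<otimes>\<^bsub>\<Lambda>\<^esub> b \<in> carrier \<Lambda>"
proof -
  have factors: "\<exists>k\<le>length p. a (path_target Q (u, take k p), drop k p) \<noteq> 0 \<and> b (u, take k p) \<noteq> 0"
    if "(a \<otimes>\<^bsub>\<Lambda>\<^esub> b) (u, p) \<noteq> 0" for u p
    using sum.not_neutral_contains_not_neutral[OF that[unfolded path_algebra_mult]] by auto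
  let ?S = "(\<lambda>((v, q), (u, p)). (u, p @ q)) ` ({r. a r \<noteq> 0} \<times> {r. b r \<noteq> 0})"
  have "{r. (a \<otimes>\<^bsub>\<Lambda>\<^esub> b) r \<noteq> 0} \<subseteq> ?S"
  proof
    fix r assume "r \<in> {r. (a \<otimes>\<^bsub>\<Lambda>\<^esub> b) r \<noteq> 0}"
    then obtain u p k where r: "r = (u, p)" and
      "a (path_target Q (u, take k p), drop k p) \<noteq> 0" "b (u, take k p) \<noteq> 0"
      using factors by (cases r) blast
    then show "r \<in> ?S"
      by (intro image_eqI[of _ _ "((path_target Q (u, take k p), drop k p), (u, take k p))"]) auto
  qed
  moreover have "finite ?S"
    using a b by (simp add: path_algebra_carrier_iff)
  ultimately have "finite {r. (a \<otimes>\<^bsub>\<Lambda>\<^esub> b) r \<noteq> 0}"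
    by (rule finite_subset)
  moreover have "(u, p) \<in> paths Q" if nz: "(a \<otimes>\<^bsub>\<Lambda>\<^esub> b) (u, p) \<noteq> 0" for u p
  proof -
    obtain k where "a (path_target Q (u, take k p), drop k p) \<noteq> 0" "b (u, take k p) \<noteq> 0"
      using factors[OF nz] by blast
    then have "(path_target Q (u, take k p), drop k p) \<in> paths Q" "(u, take k p) \<in> paths Q"
      using a b unfolding path_algebra_carrier_iff by metis+
    then show ?thesis
      using paths_append_iff[of u "take k p" "drop k p"] by simp
  qed
  ultimately show ?thesis
    unfolding path_algebra_carrier_iff by (metis surj_pair)
qed

text \<open>Both sides are sums over all ways to cut a path into three.\<close>

lemma path_algebra_mult_assoc:
  fixes a b c :: "('v, 'e) path \<Rightarrow> 'k::field"
  shows "(a \<otimes>\<^bsub>\<Lambda>\<^esub> b) \<otimes>\<^bsub>\<Lambda>\<^esub> c = a \<otimes>\<^bsub>\<Lambda>\<^esub> (b \<otimes>\<^bsub>\<Lambda>\<^esub> c)"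
proof (rule ext, clarify)
  fix u :: 'v and p :: "'e list"
  let ?n = "length p" and ?T = "\<lambda>k. path_target Q (u, take k p)"
  define F where "F j k = a (?T j, drop j p) * b (?T k, drop k (take j p)) * c (u, take k p)" for j k
  have target: "path_target Q (?T k, take m (drop k p)) = ?T (k + m)" for k m
    by (simp add: path_target_append[symmetric] take_add)
  have "((a \<otimes>\<^bsub>\<Lambda>\<^esub> b) \<otimes>\<^bsub>\<Lambda>\<^esub> c) (u, p) = (\<Sum>k\<le>?n. \<Sum>m\<le>?n - k. F (k + m) k)"
    by (auto simp: path_algebra_mult sum_distrib_right F_def target drop_take add.commute
        intro!: sum.cong)
  also have "\<dots> = (\<Sum>(k, m)\<in>{(k, m). k + m \<le> ?n}. F (k + m) k)"
    by (subst sum.Sigma) (auto intro!: sum.cong)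
  also have "\<dots> = (\<Sum>j\<le>?n. \<Sum>k\<le>j. F j k)"
    by (subst sum.triangle_reindex_eq) auto
  also have "\<dots> = (a \<otimes>\<^bsub>\<Lambda>\<^esub> (b \<otimes>\<^bsub>\<Lambda>\<^esub> c)) (u, p)"
    by (auto simp: path_algebra_mult sum_distrib_left F_def mult.assoc min.absorb1 min.absorb2 intro!: sum.cong)
  finally show "((a \<otimes>\<^bsub>\<Lambda>\<^esub> b) \<otimes>\<^bsub>\<Lambda>\<^esub> c) (u, p) = (a \<otimes>\<^bsub>\<Lambda>\<^esub> (b \<otimes>\<^bsub>\<Lambda>\<^esub> c)) (u, p)" .
qed

lemma ring_path_algebra: "ring (\<Lambda> :: (('v, 'e) path \<Rightarrow> 'k::field) ring)"
proof (rule ringI)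
  let ?R = "\<Lambda> :: (('v, 'e) path \<Rightarrow> 'k) ring"
  have add_closed: "(\<lambda>r. a r + b r) \<in> carrier ?R" if "a \<in> carrier ?R" "b \<in> carrier ?R" for a b
  proof -
    have "{r. a r + b r \<noteq> 0} \<subseteq> {r. a r \<noteq> 0} \<union> {r. b r \<noteq> 0}"
      by auto
    then show ?thesis
      using that by (simp add: path_algebra_carrier_iff finite_subset)
  qed
  show "abelian_group ?R"
  proof (rule abelian_groupI)
    show "x \<oplus>\<^bsub>?R\<^esub> y \<in> carrier ?R" if "x \<in> carrier ?R" "y \<in> carrier ?R" for x y
      using add_closed[OF that] by simp
  next
    fix a :: "('v, 'e) path \<Rightarrow> 'k"
    assume "a \<in> carrier ?R"
    then show "\<exists>b\<in>carrier ?R. b \<oplus>\<^bsub>?R\<^esub> a = \<zero>\<^bsub>?R\<^esub>"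
      by (intro bexI[of _ "\<lambda>r. - a r"]) (auto simp: path_algebra_carrier_iff)
  qed (auto simp: path_algebra_carrier_iff add_ac)
next
  let ?R = "\<Lambda> :: (('v, 'e) path \<Rightarrow> 'k) ring"
  show "monoid ?R"
  proof (rule monoidI)
    have "{r. \<one>\<^bsub>?R\<^esub> r \<noteq> 0} \<subseteq> (\<lambda>u. (u, [])) ` verts Q"
      by (auto split: if_splits)
    then show "\<one>\<^bsub>?R\<^esub> \<in> carrier ?R"
      by (auto simp: path_algebra_carrier_iff intro: finite_subset)
  next
    fix a :: "('v, 'e) path \<Rightarrow> 'k"
    assume a: "a \<in> carrier ?R"
    have "(\<one>\<^bsub>?R\<^esub> \<otimes>\<^bsub>?R\<^esub> a) (u, p) = a (u, p)" for u p
    proof -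
      have "(\<one>\<^bsub>?R\<^esub> \<otimes>\<^bsub>?R\<^esub> a) (u, p) = (\<Sum>k\<le>length p. if k = length p then a (u, p) else 0)"
        unfolding path_algebra_mult
      proof (intro sum.cong refl)
        fix k assume "k \<in> {..length p}"
        moreover have "path_target Q (u, p) \<in> verts Q" if "a (u, p) \<noteq> 0"
          using a that path_target_in_verts unfolding path_algebra_carrier_iff by metis
        ultimately show "\<one>\<^bsub>?R\<^esub> (path_target Q (u, take k p), drop k p) * a (u, take k p)
            = (if k = length p then a (u, p) else 0)"
          by auto
      qed
      then show ?thesis by simp
    qed
    then show "\<one>\<^bsub>?R\<^esub> \<otimes>\<^bsub>?R\<^esub> a = a"
      by (intro ext) (metis surj_pair)
    have "(a \<otimes>\<^bsub>?R\<^esub> \<one>\<^bsub>?R\<^esub>) (u, p) = a (u, p)" for u p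
    proof -
      have "(a \<otimes>\<^bsub>?R\<^esub> \<one>\<^bsub>?R\<^esub>) (u, p) = (\<Sum>k\<le>length p. if k = 0 then a (u, p) else 0)"
        unfolding path_algebra_mult
      proof (intro sum.cong refl)
        fix k assume "k \<in> {..length p}"
        moreover have "u \<in> verts Q" if "a (u, p) \<noteq> 0"
          using a that path_source_in_verts unfolding path_algebra_carrier_iff by metis
        ultimately show "a (path_target Q (u, take k p), drop k p) * \<one>\<^bsub>?R\<^esub> (u, take k p)
            = (if k = 0 then a (u, p) else 0)"
          by auto
      qed
      then show ?thesis by simp
    qed
    then show "a \<otimes>\<^bsub>?R\<^esub> \<one>\<^bsub>?R\<^esub> = a"
      by (intro ext) (metis surj_pair)
  qed (simp_all only: path_algebra_mult_closed path_algebra_mult_assoc)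
next
  let ?R = "\<Lambda> :: (('v, 'e) path \<Rightarrow> 'k) ring"
  fix a b c :: "('v, 'e) path \<Rightarrow> 'k"
  show "(a \<oplus>\<^bsub>?R\<^esub> b) \<otimes>\<^bsub>?R\<^esub> c = a \<otimes>\<^bsub>?R\<^esub> c \<oplus>\<^bsub>?R\<^esub> b \<otimes>\<^bsub>?R\<^esub> c"
    "c \<otimes>\<^bsub>?R\<^esub> (a \<oplus>\<^bsub>?R\<^esub> b) = c \<otimes>\<^bsub>?R\<^esub> a \<oplus>\<^bsub>?R\<^esub> c \<otimes>\<^bsub>?R\<^esub> b"
    by (auto simp: path_algebra_mult algebra_simps sum.distrib)
qed

end

text \<open>Negatives are products with \<open>-1\<close>.\<close>

lemma (in ring) left_idealI:
  assumes sub: "I \<subseteq> carrier R" and zero: "\<zero> \<in> I"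
    and add: "\<And>x y. x \<in> I \<Longrightarrow> y \<in> I \<Longrightarrow> x \<oplus> y \<in> I"
    and mult: "\<And>a x. a \<in> carrier R \<Longrightarrow> x \<in> I \<Longrightarrow> a \<otimes> x \<in> I"
  shows "left_ideal I R"
proof -
  have neg: "\<ominus> x \<in> I" if "x \<in> I" for x
  proof -
    have "\<ominus> x = (\<ominus> \<one>) \<otimes> x"
      using that sub l_minus[of \<one> x] by auto
    then show ?thesis using mult[of "\<ominus> \<one>" x] that by simp
  qed
  show ?thesis
    unfolding left_ideal_def additive_subgroup_def
    using assms neg by (auto intro!: add.subgroupI)
qed

context acyclic_quiver
begin

text \<open>The powers of the Jacobson radical will turn out to be of this form.\<close>

definition path_filtration :: "nat \<Rightarrow> (('v, 'e) path \<Rightarrow> 'k::field) set" where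
  "path_filtration n = {a \<in> carrier \<Lambda>. \<forall>u p. length p < n \<longrightarrow> a (u, p) = 0}"

lemma path_filtration_0: "path_filtration 0 = carrier \<Lambda>"
  by (simp add: path_filtration_def)

lemma path_filtration_subset: "path_filtration n \<subseteq> carrier \<Lambda>"
  by (auto simp: path_filtration_def)

lemma path_filtration_trivial:
  "path_filtration (card (verts Q)) = {\<lambda>_. 0 :: 'k::field}"
proof
  show "path_filtration (card (verts Q)) \<subseteq> {\<lambda>_. 0 :: 'k}"
  proof
    fix a :: "('v, 'e) path \<Rightarrow> 'k" assume a: "a \<in> path_filtration (card (verts Q))"
    have "a (u, p) = 0" for u p
      using a path_length_less[of u p] by (auto simp: path_filtration_def path_algebra_carrier_iff)
    then show "a \<in> {\<lambda>_. 0}" by auto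
  qed
qed (auto simp: path_filtration_def path_algebra_carrier_iff)

lemma path_filtration_mult:
  assumes a: "a \<in> path_filtration m" and b: "b \<in> path_filtration n"
  shows "a \<otimes>\<^bsub>\<Lambda>\<^esub> b \<in> path_filtration (m + n)"
proof -
  have "(a \<otimes>\<^bsub>\<Lambda>\<^esub> b) (u, p) = 0" if "length p < m + n" for u p
    unfolding path_algebra_mult
  proof (intro sum.neutral ballI)
    fix k assume "k \<in> {..length p}"
    then have "length (drop k p) < m \<or> length (take k p) < n"
      using that by auto
    then show "a (path_target Q (u, take k p), drop k p) * b (u, take k p) = 0"
      using a b by (auto simp: path_filtration_def)
  qed
  then show ?thesis
    using a b path_algebra_mult_closed by (auto simp: path_filtration_def)
qed

lemma path_filtration_add:
  assumes "a \<in> path_filtration n" "b \<in> path_filtration n"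
  shows "(\<lambda>r. a r + b r) \<in> path_filtration n"
proof -
  interpret R: ring "\<Lambda> :: (('v, 'e) path \<Rightarrow> 'a) ring" by (rule ring_path_algebra)
  show ?thesis
    using R.a_closed[of a b] assms by (auto simp: path_filtration_def)
qed

lemma path_monomial_in_filtration:
  "(u, p) \<in> paths Q \<Longrightarrow> n \<le> length p \<Longrightarrow> path_monomial c (u, p) \<in> path_filtration n"
  by (auto simp: path_filtration_def)

text \<open>
  Since paths compose like functions, the final part of a path is the left factor.
\<close>

lemma path_monomial_append:
  "path_monomial c (u, p @ q)
     = path_monomial c (path_target Q (u, p), q) \<otimes>\<^bsub>\<Lambda>\<^esub> path_monomial (1 :: 'k::field) (u, p)"
proof (rule ext, clarify)
  fix u' :: 'v and r :: "'e list"
  have "(path_monomial c (path_target Q (u, p), q) \<otimes>\<^bsub>\<Lambda>\<^esub> path_monomial 1 (u, p)) (u', r)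
      = (\<Sum>k\<le>length r. if k = length p then (if u' = u \<and> r = p @ q then c else 0) else 0)"
    unfolding path_algebra_mult
  proof (intro sum.cong refl)
    fix k assume k: "k \<in> {..length r}"
    show "path_monomial c (path_target Q (u, p), q)
          (path_target Q (u', take k r), drop k r) * path_monomial 1 (u, p) (u', take k r)
        = (if k = length p then (if u' = u \<and> r = p @ q then c else 0) else 0)"
    proof (cases "k = length p")
      case True
      have "r = p @ q \<longleftrightarrow> take k r = p \<and> drop k r = q"
        unfolding True by (metis append_eq_conv_conj)
      then show ?thesis
        using True by (cases "take k r = p") simp_all
    next
      case False
      then have "take k r \<noteq> p"
        using k by auto
      then show ?thesis using False by simp
    qed
  qed
  also have "\<dots> = path_monomial c (u, p @ q) (u', r)"
    by (cases "u' = u \<and> r = p @ q") (simp_all split: if_splits)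
  finally show "path_monomial c (u, p @ q) (u', r)
      = (path_monomial c (path_target Q (u, p), q) \<otimes>\<^bsub>\<Lambda>\<^esub> path_monomial 1 (u, p)) (u', r)"
    by (rule sym)
qed

text \<open>
  A path of length at least \<open>n + 1\<close> is the product of its last arrow with a path of
  length at least \<open>n\<close>.
\<close>

lemma ideal_prod_path_filtration:
  "ideal_prod \<Lambda> (path_filtration 1) (path_filtration n)
     = (path_filtration (Suc n) :: (('v, 'e) path \<Rightarrow> 'k::field) set)" (is "?P = _")
proof
  show "?P \<subseteq> path_filtration (Suc n)"
  proof
    fix a assume "a \<in> ?P"
    then show "a \<in> path_filtration (Suc n)"
    proof induction
      case (prod i j)
      then show ?case using path_filtration_mult[of i 1 j n] by simp
    next
      case (sum s1 s2)
      then show ?case using path_filtration_add[of s1 _ s2] by simp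
    qed
  qed
  show "path_filtration (Suc n) \<subseteq> ?P"
  proof
    fix a :: "('v, 'e) path \<Rightarrow> 'k"
    assume a: "a \<in> path_filtration (Suc n)"
    have zero: "(\<lambda>_. 0 :: 'k) \<in> path_filtration k" for k
      by (simp add: path_filtration_def path_algebra_carrier_iff)
    show "a \<in> ?P"
    proof (rule finite_support_induct)
      show "finite {r. a r \<noteq> 0}"
        using a by (simp add: path_filtration_def path_algebra_carrier_iff)
      show "(\<lambda>_. 0) \<in> ?P"
      proof -
        have "(\<lambda>_. 0) \<otimes>\<^bsub>\<Lambda>\<^esub> (\<lambda>_. 0) = (\<lambda>_. 0 :: 'k)"
          by (rule ext, clarify) (simp add: path_algebra_mult)
        then show ?thesis
          using ideal_prod.prod[OF zero zero, of \<Lambda> 1 n] by simp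
      qed
      show "(\<lambda>r. b r + c r) \<in> ?P" if "b \<in> ?P" "c \<in> ?P" for b c
        using ideal_prod.sum[OF that] by simp
    next
      fix r :: "('v, 'e) path" assume ar: "a r \<noteq> 0"
      obtain u p where r: "r = (u, p)" by fastforce
      have "Suc n \<le> length p"
        using a ar not_less unfolding r path_filtration_def by blast
      then obtain p' e where p: "p = p' @ [e]" and len: "n \<le> length p'"
        by (cases p rule: rev_exhaust) auto
      have path: "(u, p' @ [e]) \<in> paths Q"
        using a ar by (auto simp: path_filtration_def path_algebra_carrier_iff r p)
      have "path_monomial (a r) (path_target Q (u, p'), [e]) \<otimes>\<^bsub>\<Lambda>\<^esub> path_monomial 1 (u, p') \<in> ?P"
        using path len unfolding paths_append_iff
        by (intro ideal_prod.prod path_monomial_in_filtration) auto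
      then show "path_monomial (a r) r \<in> ?P"
        unfolding r p path_monomial_append .
    qed
  qed
qed

text \<open>
  These ideals bound the Jacobson radical from above: an element that lies in all of them has no
  coefficients at trivial paths.
\<close>

lemma maximal_left_ideal_at_vertex:
  assumes i: "i \<in> verts Q"
  shows "maximal_left_ideal {a \<in> carrier \<Lambda>. a (i, []) = (0 :: 'k::field)} \<Lambda>"
    (is "maximal_left_ideal ?I _")
proof -
  interpret R: ring "\<Lambda> :: (('v, 'e) path \<Rightarrow> 'k) ring" by (rule ring_path_algebra)
  have mult: "(a \<otimes>\<^bsub>\<Lambda>\<^esub> b) (i, []) = a (i, []) * b (i, [])" for a b :: "('v, 'e) path \<Rightarrow> 'k"
    by (simp add: path_algebra_mult)
  have e: "path_monomial c (i, []) \<in> carrier \<Lambda>" for c :: 'k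
    using i by simp
  have "left_ideal ?I \<Lambda>"
    using R.a_closed R.zero_closed by (intro R.left_idealI) (auto simp: mult)
  moreover have "?I \<noteq> carrier \<Lambda>"
  proof
    assume "?I = carrier \<Lambda>"
    then have "path_monomial 1 (i, []) \<in> ?I"
      using e[of 1] by (simp only:)
    then show False by simp
  qed
  moreover have "I' = carrier \<Lambda>" if I': "left_ideal I' \<Lambda>" and sub: "?I \<subseteq> I'" and ne: "I' \<noteq> ?I"
    for I' :: "(('v, 'e) path \<Rightarrow> 'k) set"
  proof -
    interpret I': additive_subgroup I' "\<Lambda> :: (('v, 'e) path \<Rightarrow> 'k) ring"
      using I' by (simp add: left_ideal_def)
    obtain x where x: "x \<in> I'" "x (i, []) \<noteq> 0"
      using sub ne I'.a_subset by auto
    have xc: "x \<in> carrier \<Lambda>" using x I'.a_subset by blast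
    have "y \<in> I'" if y: "y \<in> carrier \<Lambda>" for y
    proof -
      \<comment> \<open>Modulo \<open>I'\<close>, a multiple of \<open>x\<close> removes the coefficient of \<open>y\<close> at the trivial path.\<close>
      define z where "z = path_monomial (y (i, []) / x (i, [])) (i, []) \<otimes>\<^bsub>\<Lambda>\<^esub> x"
      have z: "z \<in> I'"
        using I' x(1) e unfolding z_def left_ideal_def by blast
      have zc: "z \<in> carrier \<Lambda>" using z I'.a_subset by blast
      have "z (i, []) = y (i, [])"
        using x(2) by (simp add: z_def mult)
      moreover have "(y \<ominus>\<^bsub>\<Lambda>\<^esub> z) \<oplus>\<^bsub>\<Lambda>\<^esub> z = y"
        using y zc by (simp only: R.minus_eq R.a_assoc R.a_inv_closed R.l_neg R.r_zero)
      then have "(y \<ominus>\<^bsub>\<Lambda>\<^esub> z) (i, []) + z (i, []) = y (i, [])"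
        by (simp only: path_algebra_simps fun_eq_iff)
      ultimately have "y \<ominus>\<^bsub>\<Lambda>\<^esub> z \<in> ?I"
        using y zc by simp
      then have "(y \<ominus>\<^bsub>\<Lambda>\<^esub> z) \<oplus>\<^bsub>\<Lambda>\<^esub> z \<in> I'"
        using sub z I'.a_closed by blast
      then show ?thesis
        using \<open>(y \<ominus>\<^bsub>\<Lambda>\<^esub> z) \<oplus>\<^bsub>\<Lambda>\<^esub> z = y\<close> by (simp only:)
    qed
    then show ?thesis using I'.a_subset by blast
  qed
  ultimately show ?thesis
    unfolding maximal_left_ideal_def by blast
qed

lemma path_filtration_left_ideal: "left_ideal (path_filtration n :: (_ \<Rightarrow> 'k::field) set) \<Lambda>"
proof -
  interpret R: ring "\<Lambda> :: (('v, 'e) path \<Rightarrow> 'k) ring" by (rule ring_path_algebra)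
  show ?thesis
  proof (rule R.left_idealI)
    show "a \<otimes>\<^bsub>\<Lambda>\<^esub> x \<in> path_filtration n" if "a \<in> carrier \<Lambda>" "x \<in> path_filtration n"
      for a x :: "('v, 'e) path \<Rightarrow> 'k"
      using path_filtration_mult[of a 0 x n] that by (simp add: path_filtration_0)
  qed (use path_filtration_add R.zero_closed in \<open>auto simp: path_filtration_def\<close>)
qed

text \<open>
  Let \<open>A\<close> be the ideal of the paths of positive length. If \<open>A\<close> is not
  contained in the maximal left ideal \<open>I\<close>, then \<open>1 = x + a\<close> with
  \<open>x\<close> in \<open>I\<close> and \<open>a\<close> in \<open>A\<close>. Multiplying
  elements of \<open>A\<^sup>n\<close> by this equation shows that \<open>A\<^sup>n \<subseteq>
  I\<close> as soon as \<open>A\<^sup>n\<^sup>+\<^sup>1 \<subseteq> I\<close>. As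
  \<open>A\<close> is nilpotent, descending induction gives \<open>A\<^sup>0 \<subseteq>
  I\<close>.
\<close>

lemma arrow_ideal_in_maximal_left_ideal:
  assumes I: "maximal_left_ideal I (\<Lambda> :: (('v, 'e) path \<Rightarrow> 'k::field) ring)"
  shows "path_filtration 1 \<subseteq> I"
proof (rule ccontr)
  let ?R = "\<Lambda> :: (('v, 'e) path \<Rightarrow> 'k) ring" and ?A = "path_filtration 1 :: (_ \<Rightarrow> 'k) set"
  assume not: "\<not> ?A \<subseteq> I"
  interpret R: ring ?R by (rule ring_path_algebra)
  have lI: "left_ideal I ?R" and I_ne: "I \<noteq> carrier ?R"
    using I by (auto simp: maximal_left_ideal_def)
  interpret I: additive_subgroup I ?R using lI by (simp add: left_ideal_def)
  interpret A: additive_subgroup ?A ?R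
    using path_filtration_left_ideal unfolding left_ideal_def by blast
  let ?S = "I <+>\<^bsub>?R\<^esub> ?A"
  have S: "left_ideal ?S ?R"
  proof (rule R.left_idealI)
    have "additive_subgroup ?S ?R"
      using R.add_additive_subgroups I.additive_subgroup_axioms A.additive_subgroup_axioms by blast
    then interpret S: additive_subgroup ?S ?R .
    show "?S \<subseteq> carrier ?R" "\<zero>\<^bsub>?R\<^esub> \<in> ?S" "\<And>x y. x \<in> ?S \<Longrightarrow> y \<in> ?S \<Longrightarrow> x \<oplus>\<^bsub>?R\<^esub> y \<in> ?S"
      using S.a_subset S.zero_closed S.a_closed by blast+
    fix a s assume a: "a \<in> carrier ?R" and "s \<in> ?S"
    then obtain x b where x: "x \<in> I" and b: "b \<in> ?A" and s: "s = x \<oplus>\<^bsub>?R\<^esub> b"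
      unfolding set_add_def' by blast
    have "a \<otimes>\<^bsub>?R\<^esub> s = a \<otimes>\<^bsub>?R\<^esub> x \<oplus>\<^bsub>?R\<^esub> a \<otimes>\<^bsub>?R\<^esub> b"
      unfolding s using a x b I.a_subset A.a_subset by (intro R.r_distr) auto
    moreover have "a \<otimes>\<^bsub>?R\<^esub> x \<in> I" "a \<otimes>\<^bsub>?R\<^esub> b \<in> ?A"
      using a x b lI path_filtration_left_ideal unfolding left_ideal_def by blast+
    ultimately show "a \<otimes>\<^bsub>?R\<^esub> s \<in> ?S"
      unfolding set_add_def' by blast
  qed
  have sub: "x \<in> ?S" if "x \<in> I \<union> ?A" for x
  proof -
    have "x = x \<oplus>\<^bsub>?R\<^esub> \<zero>\<^bsub>?R\<^esub>" "x = \<zero>\<^bsub>?R\<^esub> \<oplus>\<^bsub>?R\<^esub> x"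
      by auto
    then show ?thesis
      using that I.zero_closed A.zero_closed unfolding set_add_def' by blast
  qed
  then have "?S = carrier ?R"
    using I S not unfolding maximal_left_ideal_def by blast
  then obtain x a where x: "x \<in> I" and a: "a \<in> ?A" and one: "\<one>\<^bsub>?R\<^esub> = x \<oplus>\<^bsub>?R\<^esub> a"
    using R.one_closed unfolding set_add_def' by blast
  have xa: "x \<in> carrier ?R" "a \<in> carrier ?R"
    using x a I.a_subset A.a_subset by blast+
  have "path_filtration (card (verts Q) - k) \<subseteq> I" for k
  proof (induction k)
    case 0
    then show ?case using I.zero_closed by (simp add: path_filtration_trivial)
  next
    case (Suc k)
    show ?case
    proof (cases "k < card (verts Q)")
      case True
      let ?n = "card (verts Q) - Suc k"
      have n: "card (verts Q) - k = ?n + 1" using True by simp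
      show ?thesis
      proof
        fix b :: "('v, 'e) path \<Rightarrow> 'k" assume b: "b \<in> path_filtration ?n"
        then have bc: "b \<in> carrier ?R" using path_filtration_subset by blast
        have "b = b \<otimes>\<^bsub>?R\<^esub> (x \<oplus>\<^bsub>?R\<^esub> a)"
          using bc by (simp only: one[symmetric] R.r_one)
        also have "\<dots> = b \<otimes>\<^bsub>?R\<^esub> x \<oplus>\<^bsub>?R\<^esub> b \<otimes>\<^bsub>?R\<^esub> a"
          by (rule R.r_distr[OF xa bc])
        finally have "b = b \<otimes>\<^bsub>?R\<^esub> x \<oplus>\<^bsub>?R\<^esub> b \<otimes>\<^bsub>?R\<^esub> a" .
        moreover have "b \<otimes>\<^bsub>?R\<^esub> x \<in> I"
          using lI x bc by (simp only: left_ideal_def)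
        moreover have "b \<otimes>\<^bsub>?R\<^esub> a \<in> I"
          using path_filtration_mult[OF b a] Suc.IH unfolding n by blast
        ultimately show "b \<in> I" using I.a_closed by metis
      qed
    qed (use Suc.IH in simp)
  qed
  from this[of "card (verts Q)"] have "carrier ?R \<subseteq> I"
    by (simp add: path_filtration_0)
  then show False using I_ne I.a_subset by blast
qed

theorem jacobson_radical_path_algebra:
  "jacobson_radical \<Lambda> = (path_filtration 1 :: (_ \<Rightarrow> 'k::field) set)"
proof
  show "jacobson_radical \<Lambda> \<subseteq> (path_filtration 1 :: (_ \<Rightarrow> 'k) set)"
  proof
    fix a :: "('v, 'e) path \<Rightarrow> 'k" assume a: "a \<in> jacobson_radical \<Lambda>"
    have "a (u, []) = 0" for u
      using a maximal_left_ideal_at_vertex[of u, where 'k = 'k]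
      by (cases "u \<in> verts Q") (auto simp: jacobson_radical_def path_algebra_carrier_iff)
    then show "a \<in> path_filtration 1"
      using a by (auto simp: path_filtration_def jacobson_radical_def)
  qed
  show "(path_filtration 1 :: (_ \<Rightarrow> 'k) set) \<subseteq> jacobson_radical \<Lambda>"
    using arrow_ideal_in_maximal_left_ideal path_filtration_subset
    unfolding jacobson_radical_def by blast
qed

corollary ideal_power_jacobson_radical:
  "ideal_power \<Lambda> (jacobson_radical \<Lambda>) n = (path_filtration n :: (_ \<Rightarrow> 'k::field) set)"
  by (induction n)
    (simp_all add: path_filtration_0 jacobson_radical_path_algebra ideal_prod_path_filtration
      del: One_nat_def)

end

section \<open>Linear algebra with coordinates\<close>

text \<open>
  Induction over linear combinations of those unit vectors that occur in \<open>v\<close> with a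
  nonzero coefficient. Restricting to these makes the rule apply to coordinate subspaces.
\<close>

lemma vec_support_induct:
  fixes v :: "'k::field vec"
  assumes v: "v \<in> carrier_vec n"
    and zero: "0\<^sub>v n \<in> X"
    and add: "\<And>y z. y \<in> X \<Longrightarrow> z \<in> X \<Longrightarrow> y + z \<in> X"
    and unit: "\<And>k. k < n \<Longrightarrow> v $ k \<noteq> 0 \<Longrightarrow> v $ k \<cdot>\<^sub>v unit_vec n k \<in> X"
  shows "v \<in> X"
proof -
  have "vec n (\<lambda>i. if i < m then v $ i else 0) \<in> X" if "m \<le> n" for m
    using that
  proof (induction m)
    case 0
    moreover have "vec n (\<lambda>i. if i < 0 then v $ i else 0) = 0\<^sub>v n"
      by (intro eq_vecI) auto
    ultimately show ?case using zero by simp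
  next
    case (Suc m)
    show ?case
    proof (cases "v $ m = 0")
      case True
      have "vec n (\<lambda>i. if i < Suc m then v $ i else 0) = vec n (\<lambda>i. if i < m then v $ i else 0)"
        using True by (intro eq_vecI) (auto simp: less_Suc_eq)
      then show ?thesis using Suc by simp
    next
      case False
      have "vec n (\<lambda>i. if i < Suc m then v $ i else 0)
          = vec n (\<lambda>i. if i < m then v $ i else 0) + v $ m \<cdot>\<^sub>v unit_vec n m"
        using Suc.prems by (intro eq_vecI) (auto simp: less_Suc_eq)
      then show ?thesis using Suc False add unit[of m] by simp
    qed
  qed
  from this[of n] have "vec n (\<lambda>i. if i < n then v $ i else 0) \<in> X" by simp
  also have "vec n (\<lambda>i. if i < n then v $ i else 0) = v"
    using v by (intro eq_vecI) auto
  finally show ?thesis .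
qed

lemma mult_mat_zero_vec:
  fixes A :: "'k::field mat"
  assumes "A \<in> carrier_mat n m"
  shows "A *\<^sub>v 0\<^sub>v m = 0\<^sub>v n"
  using assms by (intro eq_vecI) auto

lemma mat_mult_unit_vec:
  fixes A :: "'k::field mat"
  assumes "A \<in> carrier_mat n m" "k < m"
  shows "A *\<^sub>v unit_vec m k = col A k"
  using assms by (intro eq_vecI) auto

lemma mat_mult_sum_cols_induct:
  fixes A :: "'k::field mat"
  assumes A: "A \<in> carrier_mat n m" and v: "v \<in> carrier_vec m"
    and zero: "0\<^sub>v n \<in> X"
    and add: "\<And>y z. y \<in> X \<Longrightarrow> z \<in> X \<Longrightarrow> y + z \<in> X"
    and col: "\<And>k. k < m \<Longrightarrow> v $ k \<noteq> 0 \<Longrightarrow> v $ k \<cdot>\<^sub>v col A k \<in> X"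
  shows "A *\<^sub>v v \<in> X"
proof -
  have "v \<in> {y \<in> carrier_vec m. A *\<^sub>v y \<in> X}"
  proof (rule vec_support_induct[OF v])
    show "0\<^sub>v m \<in> {y \<in> carrier_vec m. A *\<^sub>v y \<in> X}"
      using A zero by (simp add: mult_mat_zero_vec[OF A])
    show "y + z \<in> {y \<in> carrier_vec m. A *\<^sub>v y \<in> X}"
      if "y \<in> {y \<in> carrier_vec m. A *\<^sub>v y \<in> X}" "z \<in> {y \<in> carrier_vec m. A *\<^sub>v y \<in> X}" for y z
      using that A add by (simp add: mult_add_distrib_mat_vec[OF A])
    show "v $ k \<cdot>\<^sub>v unit_vec m k \<in> {y \<in> carrier_vec m. A *\<^sub>v y \<in> X}"
      if "k < m" "v $ k \<noteq> 0" for k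
      using that col[OF that] A by (simp add: mult_mat_vec[OF A] mat_mult_unit_vec)
  qed
  then show ?thesis by simp
qed

lemma det_nonzero_inverse:
  fixes A :: "'k::field mat"
  assumes A: "A \<in> carrier_mat n n" and det: "det A \<noteq> 0"
  obtains B where "B \<in> carrier_mat n n" "A * B = 1\<^sub>m n"
  using det_non_zero_imp_unit[OF A det, of "()"] unfolding Units_def ring_mat_simps
  by auto

text \<open>
  If \<open>m\<close> linearly independent vectors lie in the span of \<open>m\<close> vectors,
  then they span the same space. In terms of matrices, \<open>A = B C\<close> with a square
  matrix \<open>C\<close>, which is injective because \<open>A\<close> is, so that \<open>B = A
  C\<^sup>-\<^sup>1\<close>.
\<close>

lemma injective_matrix_range_maximal:
  fixes A B :: "'k::field mat"
  assumes A: "A \<in> carrier_mat n m" and B: "B \<in> carrier_mat n m"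
    and inj: "\<And>v. v \<in> carrier_vec m \<Longrightarrow> A *\<^sub>v v = 0\<^sub>v n \<Longrightarrow> v = 0\<^sub>v m"
    and cols: "\<And>k. k < m \<Longrightarrow> \<exists>c\<in>carrier_vec m. col A k = B *\<^sub>v c"
    and c: "c \<in> carrier_vec m"
  shows "\<exists>v\<in>carrier_vec m. B *\<^sub>v c = A *\<^sub>v v"
proof -
  obtain f where f: "\<And>k. k < m \<Longrightarrow> f k \<in> carrier_vec m \<and> col A k = B *\<^sub>v f k"
    using cols by metis
  define C where "C = mat m m (\<lambda>(i, k). f k $ i)"
  have C: "C \<in> carrier_mat m m" by (simp add: C_def)
  have "col C k = f k" if "k < m" for k
    using f[OF that] that by (intro eq_vecI) (auto simp: C_def)
  then have AC: "A = B * C"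
    using A B C f by (intro mat_col_eqI) (auto simp: col_mult2[OF B C])
  have "det C \<noteq> 0"
  proof
    assume "det C = 0"
    then obtain v where v: "v \<in> carrier_vec m" "v \<noteq> 0\<^sub>v m" "C *\<^sub>v v = 0\<^sub>v m"
      using det_0_iff_vec_prod_zero[OF C] by blast
    have "A *\<^sub>v v = B *\<^sub>v (C *\<^sub>v v)"
      unfolding AC using B C v(1) by (rule assoc_mult_mat_vec)
    also have "\<dots> = 0\<^sub>v n" using v(3) B by auto
    finally show False using inj v by blast
  qed
  then obtain D where D: "D \<in> carrier_mat m m" "C * D = 1\<^sub>m m"
    using det_nonzero_inverse[OF C] by metis
  have "A *\<^sub>v (D *\<^sub>v c) = B *\<^sub>v (C *\<^sub>v (D *\<^sub>v c))"
    unfolding AC using B C D c by (intro assoc_mult_mat_vec) auto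
  also have "C *\<^sub>v (D *\<^sub>v c) = c"
    using assoc_mult_mat_vec[OF C D(1) c] D(2) c by simp
  finally show ?thesis
    using D(1) c by (intro bexI[of _ "D *\<^sub>v c"]) auto
qed

section \<open>Representations with adapted bases\<close>

lemma path_action_Nil [simp]: "path_action x [] v = v"
  by (simp add: path_action_def)

lemma path_action_snoc [simp]: "path_action x (p @ [e]) v = x e *\<^sub>v path_action x p v"
  by (simp add: path_action_def)

context acyclic_quiver
begin

context
  fixes d :: "'v \<Rightarrow> nat" and x :: "'e \<Rightarrow> 'k::field mat"
  assumes x: "x \<in> Rep Q d"
begin

lemma Rep_carrier: "e \<in> arcs Q \<Longrightarrow> x e \<in> carrier_mat (d (head Q e)) (d (tail Q e))"
  using x by (auto simp: Rep_def)

lemma path_action_closed: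
  "(u, p) \<in> paths Q \<Longrightarrow> v \<in> carrier_vec (d u) \<Longrightarrow>
    path_action x p v \<in> carrier_vec (d (path_target Q (u, p)))"
proof (induction p rule: rev_induct)
  case (snoc e p)
  then show ?case
    using Rep_carrier[of e] by (auto simp: paths_append_iff intro!: mult_mat_vec_carrier)
qed simp

lemma path_action_add:
  "(u, p) \<in> paths Q \<Longrightarrow> v \<in> carrier_vec (d u) \<Longrightarrow> w \<in> carrier_vec (d u) \<Longrightarrow>
    path_action x p (v + w) = path_action x p v + path_action x p w"
proof (induction p rule: rev_induct)
  case (snoc e p)
  then show ?case
    using Rep_carrier[of e] path_action_closed[of u p]
    by (auto simp: paths_append_iff intro!: mult_add_distrib_mat_vec)
qed simp

end

lemma rep_carrier_iff:
  "m \<in> carrier (rep_module Q d x) \<longleftrightarrow> m \<in> (\<Pi>\<^sub>E i\<in>verts Q. carrier_vec (d i))"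
  by (simp add: rep_module_def)

lemma rep_component: "m \<in> carrier (rep_module Q d x) \<Longrightarrow> i \<in> verts Q \<Longrightarrow> m i \<in> carrier_vec (d i)"
  by (auto simp: rep_module_def)

lemma rep_zero_apply [simp]: "i \<in> verts Q \<Longrightarrow> \<zero>\<^bsub>rep_module Q d x\<^esub> i = 0\<^sub>v (d i)"
  by (simp add: rep_module_def)

lemma rep_add_apply [simp]: "i \<in> verts Q \<Longrightarrow> (m \<oplus>\<^bsub>rep_module Q d x\<^esub> n) i = m i + n i"
  by (simp add: rep_module_def)

lemma rep_eqI:
  assumes "m \<in> carrier (rep_module Q d x)" "n \<in> carrier (rep_module Q d x)"
    and "\<And>i. i \<in> verts Q \<Longrightarrow> m i = n i"
  shows "m = n"
  using assms unfolding rep_carrier_iff by (rule PiE_ext)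

lemma abelian_group_rep_module: "abelian_group (rep_module Q d (x :: 'e \<Rightarrow> 'k::field mat))"
proof (rule abelian_groupI)
  let ?M = "rep_module Q d x"
  show closed: "m \<oplus>\<^bsub>?M\<^esub> n \<in> carrier ?M" if "m \<in> carrier ?M" "n \<in> carrier ?M" for m n
    using rep_component[OF that(1)] rep_component[OF that(2)] by (auto simp: rep_module_def)
  show zero: "\<zero>\<^bsub>?M\<^esub> \<in> carrier ?M"
    by (auto simp: rep_module_def)
  fix m assume m: "m \<in> carrier ?M"
  show "\<zero>\<^bsub>?M\<^esub> \<oplus>\<^bsub>?M\<^esub> m = m"
    using m rep_component[OF m] by (intro rep_eqI[of _ d x] closed zero) auto
  show "\<exists>n\<in>carrier ?M. n \<oplus>\<^bsub>?M\<^esub> m = \<zero>\<^bsub>?M\<^esub>"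
    using m by (intro bexI[of _ "\<lambda>i\<in>verts Q. - m i"])
      (auto simp: rep_module_def PiE_mem intro!: restrict_ext uminus_l_inv_vec)
  fix n assume n: "n \<in> carrier ?M"
  show "m \<oplus>\<^bsub>?M\<^esub> n = n \<oplus>\<^bsub>?M\<^esub> m"
    using m n by (intro rep_eqI[of _ d x] closed) (auto intro: comm_add_vec[OF rep_component rep_component])
  fix k assume k: "k \<in> carrier ?M"
  show "m \<oplus>\<^bsub>?M\<^esub> n \<oplus>\<^bsub>?M\<^esub> k = m \<oplus>\<^bsub>?M\<^esub> (n \<oplus>\<^bsub>?M\<^esub> k)"
    using m n k by (intro rep_eqI[of _ d x] closed)
      (auto intro: assoc_add_vec[OF rep_component rep_component rep_component])
qed

lemma rep_add_closed:
  "m \<in> carrier (rep_module Q d (x :: 'e \<Rightarrow> 'k::field mat)) \<Longrightarrow> n \<in> carrier (rep_module Q d x) \<Longrightarrow>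
    m \<oplus>\<^bsub>rep_module Q d x\<^esub> n \<in> carrier (rep_module Q d x)"
  by (meson abelian_group.axioms(1) abelian_monoid.a_closed abelian_group_rep_module)

definition single_vertex :: "('v \<Rightarrow> nat) \<Rightarrow> 'v \<Rightarrow> 'k::zero vec \<Rightarrow> 'v \<Rightarrow> 'k vec" where
  "single_vertex d i v = (\<lambda>j\<in>verts Q. if j = i then v else 0\<^sub>v (d j))"

lemma single_vertex_apply [simp]:
  "j \<in> verts Q \<Longrightarrow> single_vertex d i v j = (if j = i then v else 0\<^sub>v (d j))"
  by (simp add: single_vertex_def)

lemma single_vertex_closed [simp]:
  "v \<in> carrier_vec (d i) \<Longrightarrow> single_vertex d i v \<in> (\<Pi>\<^sub>E i\<in>verts Q. carrier_vec (d i))"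
  by (auto simp: single_vertex_def)

lemma single_vertex_add:
  "v \<in> carrier_vec (n i) \<Longrightarrow> v' \<in> carrier_vec (n i) \<Longrightarrow> single_vertex n i (v + v' :: 'k::field vec)
    = (\<lambda>j\<in>verts Q. single_vertex n i v j + single_vertex n i v' j)"
  by (auto simp: single_vertex_def intro!: restrict_ext)

lemma single_vertex_smult:
  "single_vertex n i (c \<cdot>\<^sub>v v :: 'k::field vec) = (\<lambda>j\<in>verts Q. c \<cdot>\<^sub>v single_vertex n i v j)"
  by (auto simp: single_vertex_def intro!: restrict_ext eq_vecI)

lemma single_vertex_zero: "single_vertex n i (0\<^sub>v (n i) :: 'k::field vec) = (\<lambda>j\<in>verts Q. 0\<^sub>v (n j))"
  by (auto simp: single_vertex_def intro!: restrict_ext)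

text \<open>
  A module is the sum of its components at the vertices; in the form of an induction principle.
\<close>

lemma vertexwise_induct:
  fixes m :: "'v \<Rightarrow> 'k::field vec"
  assumes m: "m \<in> (\<Pi>\<^sub>E i\<in>verts Q. carrier_vec (d i))"
    and zero: "(\<lambda>i\<in>verts Q. 0\<^sub>v (d i)) \<in> X"
    and add: "\<And>y z. y \<in> X \<Longrightarrow> z \<in> X \<Longrightarrow> (\<lambda>i\<in>verts Q. y i + z i) \<in> X"
    and single: "\<And>i. i \<in> verts Q \<Longrightarrow> single_vertex d i (m i) \<in> X"
  shows "m \<in> X"
proof -
  define part where "part S = (\<lambda>j\<in>verts Q. if j \<in> S then m j else 0\<^sub>v (d j))" for S
  have m_j: "m j \<in> carrier_vec (d j)" if "j \<in> verts Q" for j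
    using m that by auto
  have "part S \<in> X" if "finite S" "S \<subseteq> verts Q" for S
    using that
  proof (induction S rule: finite_induct)
    case empty
    have "part {} = (\<lambda>i\<in>verts Q. 0\<^sub>v (d i))" by (simp add: part_def restrict_def)
    then show ?case using zero by (simp only:)
  next
    case (insert s S)
    have "part (insert s S) = (\<lambda>j\<in>verts Q. single_vertex d s (m s) j + part S j)"
      unfolding part_def using insert.hyps m_j by (intro restrict_ext) auto
    then show ?case
      using insert by (simp only: add single insert_subset)
  qed
  from this[OF finite_verts] have "part (verts Q) \<in> X" by simp
  also have "part (verts Q) = m"
    using m by (auto simp: part_def PiE_iff extensional_def)
  finally show ?thesis .
qed

end

text \<open>
  The number \<open>w l j\<close> is the expected dimension of the component of \<open>J\<^sup>l
  M\<close> at \<open>j\<close>, and the columns of the invertible matrix \<open>G j\<close> are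
  a basis adapted to the radical filtration: by the last assumption, the first \<open>w l
  j\<close> columns are images under paths of length at least \<open>l\<close>. The number
  \<open>N\<close> bounds the degrees \<open>l\<close> that are considered.
\<close>

locale adapted_rep = acyclic_quiver Q for Q :: "('v, 'e) pre_digraph" +
  fixes d :: "'v \<Rightarrow> nat" and x :: "'e \<Rightarrow> 'k::field mat"
    and w :: "nat \<Rightarrow> 'v \<Rightarrow> nat" and N :: nat and G :: "'v \<Rightarrow> 'k mat"
  assumes x: "x \<in> Rep Q d"
    and w_0: "w 0 = d"
    and w_Suc: "l < N \<Longrightarrow> j \<in> verts Q \<Longrightarrow>
      w (Suc l) j = min (d j) (\<Sum>e\<in>{e\<in>arcs Q. head Q e = j}. w l (tail Q e))"
    and w_antimono: "l < N \<Longrightarrow> j \<in> verts Q \<Longrightarrow> w (Suc l) j \<le> w l j"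
    and G_carrier: "j \<in> verts Q \<Longrightarrow> G j \<in> carrier_mat (d j) (d j)"
    and det_G: "j \<in> verts Q \<Longrightarrow> det (G j) \<noteq> 0"
    and col_G: "j \<in> verts Q \<Longrightarrow> k < d j \<Longrightarrow> \<exists>u p s. (u, p) \<in> paths Q \<and> path_target Q (u, p) = j
      \<and> s < d u \<and> col (G j) k = path_action x p (unit_vec (d u) s)
      \<and> (\<forall>l\<le>N. k < w l j \<longrightarrow> l \<le> length p)"
begin

abbreviation M :: "(('v, 'e) path \<Rightarrow> 'k, 'v \<Rightarrow> 'k vec) module" where
  "M \<equiv> rep_module Q d x"

text \<open>
  Coordinates, relative to the columns of \<open>G i\<close>, of the span of the first \<open>w
  l i\<close> columns.
\<close>

definition V :: "nat \<Rightarrow> 'v \<Rightarrow> 'k vec set" where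
  "V l i = {v \<in> carrier_vec (d i). \<forall>k<d i. w l i \<le> k \<longrightarrow> v $ k = 0}"

definition W :: "nat \<Rightarrow> 'v \<Rightarrow> 'k vec set" where
  "W l i = (\<lambda>v. G i *\<^sub>v v) ` V l i"

lemma w_le_d: "l \<le> N \<Longrightarrow> j \<in> verts Q \<Longrightarrow> w l j \<le> d j"
  by (cases l) (auto simp: w_0 w_Suc)

lemma W_subset: "i \<in> verts Q \<Longrightarrow> W l i \<subseteq> carrier_vec (d i)"
  using G_carrier by (auto simp: W_def V_def intro!: mult_mat_vec_carrier)

lemma W_add: "i \<in> verts Q \<Longrightarrow> y \<in> W l i \<Longrightarrow> z \<in> W l i \<Longrightarrow> y + z \<in> W l i"
  unfolding W_def V_def
  by (auto simp: mult_add_distrib_mat_vec[OF G_carrier, symmetric])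

lemma W_smult: "i \<in> verts Q \<Longrightarrow> y \<in> W l i \<Longrightarrow> c \<cdot>\<^sub>v y \<in> W l i"
  unfolding W_def V_def
  by (auto simp: mult_mat_vec[OF G_carrier, symmetric])

lemma W_zero: "i \<in> verts Q \<Longrightarrow> 0\<^sub>v (d i) \<in> W l i"
  unfolding W_def V_def
  by (auto intro!: image_eqI[of _ _ "0\<^sub>v (d i)"] simp: mult_mat_zero_vec[OF G_carrier])

lemma G_inj: "i \<in> verts Q \<Longrightarrow> v \<in> carrier_vec (d i) \<Longrightarrow> G i *\<^sub>v v = 0\<^sub>v (d i) \<Longrightarrow> v = 0\<^sub>v (d i)"
  using det_0_iff_vec_prod_zero[OF G_carrier] det_G by blast

lemma G_surj: "i \<in> verts Q \<Longrightarrow> y \<in> carrier_vec (d i) \<Longrightarrow> \<exists>v\<in>carrier_vec (d i). y = G i *\<^sub>v v"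
proof -
  assume i: "i \<in> verts Q" and y: "y \<in> carrier_vec (d i)"
  obtain B where B: "B \<in> carrier_mat (d i) (d i)" "G i * B = 1\<^sub>m (d i)"
    using det_nonzero_inverse[OF G_carrier det_G] i by metis
  have "G i *\<^sub>v (B *\<^sub>v y) = y"
    using assoc_mult_mat_vec[OF G_carrier[OF i] B(1) y] B(2) y by simp
  then show ?thesis
    using B(1) y by (intro bexI[of _ "B *\<^sub>v y"]) auto
qed

lemma W_full: "i \<in> verts Q \<Longrightarrow> d i \<le> w l i \<Longrightarrow> W l i = carrier_vec (d i)"
  using G_surj[of i] W_subset[of i l] unfolding W_def V_def image_def by force

lemma W_antimono: "l < N \<Longrightarrow> i \<in> verts Q \<Longrightarrow> W (Suc l) i \<subseteq> W l i"
  using w_antimono[of l i] by (auto simp: W_def V_def)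

lemma W_induct:
  assumes i: "i \<in> verts Q" and y: "y \<in> W l i"
    and zero: "0\<^sub>v (d i) \<in> X"
    and add: "\<And>y z. y \<in> X \<Longrightarrow> z \<in> X \<Longrightarrow> y + z \<in> X"
    and col: "\<And>k c. k < d i \<Longrightarrow> k < w l i \<Longrightarrow> c \<cdot>\<^sub>v col (G i) k \<in> X"
  shows "y \<in> X"
proof -
  obtain v where v: "v \<in> carrier_vec (d i)" "\<forall>k<d i. w l i \<le> k \<longrightarrow> v $ k = 0" "y = G i *\<^sub>v v"
    using y by (auto simp: W_def V_def)
  show ?thesis
    unfolding v(3) using mat_mult_sum_cols_induct[OF G_carrier[OF i] v(1) zero add] col v(2)
    by (meson not_le)
qed


text \<open>
  Let \<open>n\<close> be the sum of the \<open>w l (tail e)\<close> over the arrows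
  \<open>e\<close> into a vertex \<open>j\<close>. If \<open>n \<ge> d j\<close>, then \<open>W
  (Suc l) j\<close> is the full space. Otherwise \<open>w (Suc l) j = n\<close>, and the images
  of the \<open>W l (tail e)\<close> under the arrows are together spanned by \<open>n\<close>
  vectors. The first \<open>n\<close> columns of \<open>G j\<close> are linearly independent and
  lie in this span, because they are images under paths whose last arrow is applied to an
  element of some \<open>W l (tail e)\<close>. So they span it.
\<close>

lemma arrow_maps_W_up:
  assumes l: "l < N" and e: "e \<in> arcs Q"
    and paths_in_W: "\<And>u p v. (u, p) \<in> paths Q \<Longrightarrow> l \<le> length p \<Longrightarrow> v \<in> carrier_vec (d u) \<Longrightarrow>
      path_action x p v \<in> W l (path_target Q (u, p))"
    and y: "y \<in> W l (tail Q e)"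
  shows "x e *\<^sub>v y \<in> W (Suc l) (head Q e)"
proof -
  define j where "j = head Q e"
  have j: "j \<in> verts Q" using e by (simp add: j_def)
  let ?E = "{e \<in> arcs Q. head Q e = j}"
  define n where "n = (\<Sum>e\<in>?E. w l (tail Q e))"
  have w_j: "w (Suc l) j = min (d j) n"
    using w_Suc[OF l j] by (simp add: n_def)
  have x_col: "x e \<in> carrier_mat (d j) (d (tail Q e))" if "e \<in> ?E" for e
    using Rep_carrier[OF x, of e] that by auto
  have "x e *\<^sub>v y \<in> carrier_vec (d j)"
    using x_col[of e] e W_subset[of "tail Q e" l] y by (auto simp: j_def intro!: mult_mat_vec_carrier)
  moreover have ?thesis if "n < d j"
  proof -
    define P where "P = (SIGMA e:?E. {..<w l (tail Q e)})"
    have "card P = n"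
      unfolding P_def n_def by (subst card_SigmaI) auto
    moreover have "finite P" by (auto simp: P_def)
    ultimately obtain \<kappa> where \<kappa>: "bij_betw \<kappa> {..<n} P"
      using ex_bij_betw_nat_finite[of P] by (auto simp: atLeast0LessThan)
    \<comment> \<open>The columns of \<open>B\<close> are the images of the basis vectors of all \<open>W l (tail e)\<close>, those of \<open>A\<close>
      below are the first \<open>n\<close> columns of \<open>G j\<close>.\<close>
    define B where "B = mat (d j) n (\<lambda>(r, i). case \<kappa> i of (e, k) \<Rightarrow> (x e *\<^sub>v col (G (tail Q e)) k) $ r)"
    have B: "B \<in> carrier_mat (d j) n" by (simp add: B_def)
    have r_lt: "k < d (tail Q e)" if "(e, k) \<in> P" for e k
      using that w_le_d[of l "tail Q e"] l by (auto simp: P_def)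
    have col_B: "col B i = x e *\<^sub>v col (G (tail Q e)) k" if "i < n" "\<kappa> i = (e, k)" for i e k
    proof -
      have "(e, k) \<in> P" using bij_betwE[OF \<kappa>] that by force
      then have "x e \<in> carrier_mat (d j) (d (tail Q e))" using x_col by (auto simp: P_def)
      then show ?thesis using that by (intro eq_vecI) (auto simp: B_def)
    qed
    have in_B: "\<exists>c\<in>carrier_vec n. x e *\<^sub>v z = B *\<^sub>v c" if e: "e \<in> ?E" and z: "z \<in> W l (tail Q e)" for e z
    proof -
      let ?u = "tail Q e"
      have u: "?u \<in> verts Q" using e by simp
      have xe: "x e \<in> carrier_mat (d j) (d ?u)" using x_col[OF e] .
      have "z \<in> {z \<in> carrier_vec (d ?u). \<exists>c\<in>carrier_vec n. x e *\<^sub>v z = B *\<^sub>v c}" (is "z \<in> ?X")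
      proof (rule W_induct[OF u z])
        show "0\<^sub>v (d ?u) \<in> ?X"
          using mult_mat_zero_vec[OF xe] mult_mat_zero_vec[OF B] by (auto intro!: bexI[of _ "0\<^sub>v n"])
        show "y + z \<in> ?X" if y: "y \<in> ?X" and z: "z \<in> ?X" for y z
        proof -
          obtain a b where "a \<in> carrier_vec n" "x e *\<^sub>v y = B *\<^sub>v a" "b \<in> carrier_vec n" "x e *\<^sub>v z = B *\<^sub>v b"
            using y z by blast
          then show ?thesis
            using y z mult_add_distrib_mat_vec[OF xe, of y z] mult_add_distrib_mat_vec[OF B, of a b]
            by (auto intro!: bexI[of _ "a + b"])
        qed
        show "c \<cdot>\<^sub>v col (G ?u) k \<in> ?X" if k: "k < d ?u" "k < w l ?u" for k c
        proof -
          have "(e, k) \<in> P" using e k by (auto simp: P_def)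
          then obtain i where i: "i < n" "\<kappa> i = (e, k)"
            using \<kappa> unfolding bij_betw_def by (metis imageE lessThan_iff)
          have "col (G ?u) k \<in> carrier_vec (d ?u)"
            using G_carrier[OF u] by (intro carrier_vecI) auto
          moreover from this have "x e *\<^sub>v (c \<cdot>\<^sub>v col (G ?u) k) = B *\<^sub>v (c \<cdot>\<^sub>v unit_vec n i)"
            using i by (simp add: mult_mat_vec[OF xe] mult_mat_vec[OF B] mat_mult_unit_vec[OF B] col_B)
          ultimately show ?thesis by auto
        qed
      qed
      then show ?thesis by blast
    qed
    define A where "A = mat (d j) n (\<lambda>(r, k). G j $$ (r, k))"
    have A: "A \<in> carrier_mat (d j) n" by (simp add: A_def)
    define pad where "pad v = vec (d j) (\<lambda>k. if k < n then v $ k else 0)" for v :: "'k vec"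
    have pad: "A *\<^sub>v v = G j *\<^sub>v pad v" if v: "v \<in> carrier_vec n" for v
    proof (rule eq_vecI)
      fix r assume "r < dim_vec (G j *\<^sub>v pad v)"
      then have r: "r < d j" using G_carrier[OF j] by simp
      have "(A *\<^sub>v v) $ r = (\<Sum>k<n. G j $$ (r, k) * v $ k)"
        using r v A by (auto simp: A_def scalar_prod_def lessThan_atLeast0)
      also have "\<dots> = (\<Sum>k<d j. G j $$ (r, k) * (if k < n then v $ k else 0))"
        using that \<open>n < d j\<close> by (intro sum.mono_neutral_cong_left) auto
      also have "\<dots> = (G j *\<^sub>v pad v) $ r"
        using r G_carrier[OF j] by (auto simp: pad_def scalar_prod_def lessThan_atLeast0)
      finally show "(A *\<^sub>v v) $ r = (G j *\<^sub>v pad v) $ r" .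
    qed (use A G_carrier[OF j] in auto)
    have pad_V: "pad v \<in> V (Suc l) j" for v
      using \<open>n < d j\<close> by (auto simp: pad_def V_def w_j)
    have "x e *\<^sub>v y \<in> W (Suc l) j"
    proof -
      obtain c where c: "c \<in> carrier_vec n" "x e *\<^sub>v y = B *\<^sub>v c"
        using in_B[OF _ y] e by (auto simp: j_def)
      have "\<exists>v\<in>carrier_vec n. B *\<^sub>v c = A *\<^sub>v v"
      proof (rule injective_matrix_range_maximal[OF A B _ _ c(1)])
        fix v assume v: "v \<in> carrier_vec n" and "A *\<^sub>v v = 0\<^sub>v (d j)"
        then have "pad v = 0\<^sub>v (d j)"
          using G_inj[OF j, of "pad v"] pad[OF v] by (simp add: pad_def)
        then have "v $ k = 0" if "k < n" for k
          using that \<open>n < d j\<close> by (auto simp: pad_def dest!: arg_cong[of _ _ "\<lambda>v. v $ k"])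
        then show "v = 0\<^sub>v n" using v by (intro eq_vecI) auto
      next
        fix k assume k: "k < n"
        have "k < w (Suc l) j" using k \<open>n < d j\<close> by (simp add: w_j)
        then obtain u p s where p: "(u, p) \<in> paths Q" "path_target Q (u, p) = j" "s < d u"
          "col (G j) k = path_action x p (unit_vec (d u) s)" "Suc l \<le> length p"
          using col_G[OF j, of k] k \<open>n < d j\<close> l by fastforce
        obtain p' e' where p': "p = p' @ [e']" "l \<le> length p'"
          using p(5) by (cases p rule: rev_exhaust) auto
        have path: "(u, p') \<in> paths Q" "path_target Q (u, p') = tail Q e'" "e' \<in> ?E"
          using p(1,2) unfolding p'(1) paths_append_iff by auto
        have "col A k = col (G j) k"
          using k \<open>n < d j\<close> G_carrier[OF j] by (intro eq_vecI) (auto simp: A_def)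
        also have "\<dots> = x e' *\<^sub>v path_action x p' (unit_vec (d u) s)"
          by (simp add: p(4) p'(1))
        finally show "\<exists>c\<in>carrier_vec n. col A k = B *\<^sub>v c"
          using in_B[OF path(3)] paths_in_W[OF path(1) p'(2), of "unit_vec (d u) s"] path(2) by auto
      qed
      then show ?thesis
        unfolding c(2) W_def using pad pad_V by auto
    qed
    then show ?thesis by (simp add: j_def)
  qed
  ultimately show ?thesis
    using W_full[OF j, of "Suc l"] by (cases "n < d j") (auto simp: w_j simp flip: j_def)
qed

text \<open>
  This is the inclusion of \<open>J\<^sup>l M\<close> in the span of the first \<open>w l
  j\<close> columns of the matrices \<open>G j\<close>. It is proved together with the preceding
  statement by induction on \<open>l\<close>, which is why the latter has it as a hypothesis.
\<close>

lemma path_action_in_W: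
  assumes "l \<le> N" "(u, p) \<in> paths Q" "l \<le> length p" "v \<in> carrier_vec (d u)"
  shows "path_action x p v \<in> W l (path_target Q (u, p))"
  using assms
proof (induction l arbitrary: u p v)
  case 0
  then show ?case
    using path_action_closed[OF x] W_full[of "path_target Q (u, p)" 0] path_target_in_verts
    by (simp add: w_0)
next
  case (Suc l)
  obtain p' e where p: "p = p' @ [e]" "l \<le> length p'"
    using Suc.prems(3) by (cases p rule: rev_exhaust) auto
  have path: "(u, p') \<in> paths Q" "path_target Q (u, p') = tail Q e" "e \<in> arcs Q"
    using Suc.prems(2) unfolding p(1) paths_append_iff by auto
  have "path_action x p' v \<in> W l (tail Q e)"
    using Suc.IH[OF _ path(1) p(2) Suc.prems(4)] Suc.prems(1) path(2) by simp
  then have "x e *\<^sub>v path_action x p' v \<in> W (Suc l) (head Q e)"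
    using Suc.prems(1) by (intro arrow_maps_W_up path(3) Suc.IH) auto
  then show ?case by (simp add: p(1))
qed

end

section \<open>The radical layers of an adapted representation\<close>

text \<open>
  The semisimple module in which the simple module at the vertex \<open>i\<close> occurs
  \<open>n i\<close> times: the paths of positive length act as zero.
\<close>

definition vertex_module ::
    "('v, 'e) pre_digraph \<Rightarrow> ('v \<Rightarrow> nat) \<Rightarrow> (('v, 'e) path \<Rightarrow> 'k::field, 'v \<Rightarrow> 'k vec) module" where
  "vertex_module Q n =
     \<lparr>carrier = (\<Pi>\<^sub>E i\<in>verts Q. carrier_vec (n i)), mult = undefined, one = undefined,
      zero = (\<lambda>i\<in>verts Q. 0\<^sub>v (n i)),
      add = (\<lambda>m m'. \<lambda>i\<in>verts Q. m i + m' i),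
      smult = (\<lambda>a m. \<lambda>i\<in>verts Q. a (i, []) \<cdot>\<^sub>v m i)\<rparr>"

text \<open>
  The map \<open>f\<close> identifies \<open>E\<close> with a complement of \<open>H\<close> in
  \<open>M\<close> as an abelian group. Such a complement is usually not a submodule, so
  \<open>f\<close> commutes with the action modulo \<open>H\<close> only.
\<close>

lemma module_iso_quotientI:
  assumes M: "abelian_group M" and H: "additive_subgroup H M"
    and smult_closed: "\<And>a y. a \<in> carrier R \<Longrightarrow> y \<in> carrier M \<Longrightarrow> a \<odot>\<^bsub>M\<^esub> y \<in> carrier M"
    and smult_coset: "\<And>a h y. a \<in> carrier R \<Longrightarrow> h \<in> H \<Longrightarrow> y \<in> carrier M \<Longrightarrow>
      \<exists>h'\<in>H. a \<odot>\<^bsub>M\<^esub> (h \<oplus>\<^bsub>M\<^esub> y) = h' \<oplus>\<^bsub>M\<^esub> a \<odot>\<^bsub>M\<^esub> y"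
    and E_smult: "\<And>a m. a \<in> carrier R \<Longrightarrow> m \<in> carrier E \<Longrightarrow> a \<odot>\<^bsub>E\<^esub> m \<in> carrier E"
    and closed: "\<And>m. m \<in> carrier E \<Longrightarrow> f m \<in> carrier M"
    and add: "\<And>m n. m \<in> carrier E \<Longrightarrow> n \<in> carrier E \<Longrightarrow> f (m \<oplus>\<^bsub>E\<^esub> n) = f m \<oplus>\<^bsub>M\<^esub> f n"
    and smult: "\<And>a m. a \<in> carrier R \<Longrightarrow> m \<in> carrier E \<Longrightarrow>
      \<exists>h\<in>H. a \<odot>\<^bsub>M\<^esub> f m = h \<oplus>\<^bsub>M\<^esub> f (a \<odot>\<^bsub>E\<^esub> m)"
    and inj: "\<And>m n h. m \<in> carrier E \<Longrightarrow> n \<in> carrier E \<Longrightarrow> h \<in> H \<Longrightarrow> f m = h \<oplus>\<^bsub>M\<^esub> f n \<Longrightarrow> m = n"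
    and surj: "\<And>y. y \<in> carrier M \<Longrightarrow> \<exists>h\<in>H. \<exists>m\<in>carrier E. y = h \<oplus>\<^bsub>M\<^esub> f m"
  shows "module_iso R E (quotient_module M H)"
proof -
  interpret M: abelian_group M by (rule M)
  interpret H: abelian_subgroup H M
    using H M by (simp add: abelian_subgroupI3)
  let ?N = "quotient_module M H" and ?g = "\<lambda>m. H +>\<^bsub>M\<^esub> f m"
  have H_sub: "h \<in> carrier M" if "h \<in> H" for h
    using that H.a_subset by blast
  have coset_eq: "H +>\<^bsub>M\<^esub> (h \<oplus>\<^bsub>M\<^esub> y) = H +>\<^bsub>M\<^esub> y" if "h \<in> H" "y \<in> carrier M" for h y
    using that H_sub by (intro H.a_repr_independence'[symmetric]) (auto simp: a_r_coset_def')
  have coset_mem: "y \<in> H +>\<^bsub>M\<^esub> z \<longleftrightarrow> (\<exists>h\<in>H. y = h \<oplus>\<^bsub>M\<^esub> z)" for y z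
    by (auto simp: a_r_coset_def')
  have g_mem: "?g m \<in> carrier ?N" if "m \<in> carrier E" for m
    using closed[OF that] by (auto simp: quotient_module_def A_RCOSETS_def')
  have "?g \<in> LinearCombinations.module_hom R E ?N"
    unfolding LinearCombinations.module_hom_def
  proof (intro CollectI conjI allI impI)
    show "?g \<in> carrier E \<rightarrow> carrier ?N" using g_mem by blast
  next
    fix m n assume "m \<in> carrier E \<and> n \<in> carrier E"
    then show "?g (m \<oplus>\<^bsub>E\<^esub> n) = ?g m \<oplus>\<^bsub>?N\<^esub> ?g n"
      using closed by (simp add: quotient_module_def add H.a_rcos_sum)
  next
    fix a m assume "a \<in> carrier R \<and> m \<in> carrier E"
    then have a: "a \<in> carrier R" and m: "m \<in> carrier E" by auto
    have "H +>\<^bsub>M\<^esub> (a \<odot>\<^bsub>M\<^esub> y) = H +>\<^bsub>M\<^esub> (a \<odot>\<^bsub>M\<^esub> f m)" if "y \<in> ?g m" for y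
      using that smult_coset[OF a _ closed[OF m]] smult_closed[OF a closed[OF m]] coset_eq
      unfolding coset_mem by metis
    moreover have "f m \<in> ?g m"
      using closed[OF m] H.a_rcos_self by blast
    ultimately have "(\<Union>y\<in>?g m. H +>\<^bsub>M\<^esub> (a \<odot>\<^bsub>M\<^esub> y)) = H +>\<^bsub>M\<^esub> (a \<odot>\<^bsub>M\<^esub> f m)"
      by blast
    moreover have "H +>\<^bsub>M\<^esub> (a \<odot>\<^bsub>M\<^esub> f m) = ?g (a \<odot>\<^bsub>E\<^esub> m)"
      using smult[OF a m] coset_eq[OF _ closed[OF E_smult[OF a m]]] by metis
    ultimately show "?g (a \<odot>\<^bsub>E\<^esub> m) = a \<odot>\<^bsub>?N\<^esub> ?g m"
      by (simp add: quotient_module_def)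
  qed
  moreover have "bij_betw ?g (carrier E) (carrier ?N)"
    unfolding bij_betw_def
  proof
    show "inj_on ?g (carrier E)"
    proof (rule inj_onI)
      fix m n assume m: "m \<in> carrier E" and n: "n \<in> carrier E" and "?g m = ?g n"
      then have "f m \<in> ?g n"
        using closed[OF m] H.a_rcos_self by metis
      then show "m = n"
        using inj[OF m n] unfolding coset_mem by blast
    qed
    have "X \<in> ?g ` carrier E" if X: "X \<in> carrier ?N" for X
    proof -
      obtain y where y: "y \<in> carrier M" "X = H +>\<^bsub>M\<^esub> y"
        using X by (auto simp: quotient_module_def A_RCOSETS_def')
      then show ?thesis
        using surj[OF y(1)] coset_eq closed by blast
    qed
    then show "?g ` carrier E = carrier ?N" using g_mem by blast
  qed
  ultimately show ?thesis
    unfolding module_iso_def by blast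
qed

context acyclic_quiver
begin

lemma rep_smult_apply:
  "j \<in> verts Q \<Longrightarrow> (a \<odot>\<^bsub>rep_module Q d x\<^esub> m) j = vec (d j) (\<lambda>k.
     \<Sum>r\<in>{r. a r \<noteq> 0 \<and> path_target Q r = j}. a r * path_action x (snd r) (m (fst r)) $ k)"
  by (simp add: rep_module_def case_prod_unfold)

lemma rep_smult_closed [simp]: "a \<odot>\<^bsub>rep_module Q d x\<^esub> m \<in> carrier (rep_module Q d x)"
  by (auto simp: rep_module_def)

lemma rep_smult_add:
  fixes x :: "'e \<Rightarrow> 'k::field mat"
  assumes x: "x \<in> Rep Q d" and a: "a \<in> carrier \<Lambda>"
    and m: "m \<in> carrier (rep_module Q d x)" and n: "n \<in> carrier (rep_module Q d x)"
  shows "a \<odot>\<^bsub>rep_module Q d x\<^esub> (m \<oplus>\<^bsub>rep_module Q d x\<^esub> n)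
    = a \<odot>\<^bsub>rep_module Q d x\<^esub> m \<oplus>\<^bsub>rep_module Q d x\<^esub> a \<odot>\<^bsub>rep_module Q d x\<^esub> n" (is "?l = ?r")
proof -
  let ?M = "rep_module Q d x"
  have "?l j = ?r j" if j: "j \<in> verts Q" for j
  proof (rule eq_vecI)
    show "dim_vec (?l j) = dim_vec (?r j)"
      using j by (simp add: rep_smult_apply)
    fix k assume "k < dim_vec (?r j)"
    then have k: "k < d j" using j by (simp add: rep_smult_apply)
    let ?S = "{r. a r \<noteq> 0 \<and> path_target Q r = j}"
    have "?l j $ k = (\<Sum>r\<in>?S. a r * path_action x (snd r) (m (fst r)) $ k
        + a r * path_action x (snd r) (n (fst r)) $ k)"
      unfolding rep_smult_apply[OF j] index_vec[OF k]
    proof (intro sum.cong refl)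
      fix r assume r: "r \<in> ?S"
      obtain u p where up: "r = (u, p)" by fastforce
      have path: "(u, p) \<in> paths Q" "path_target Q (u, p) = j"
        using a r by (auto simp: path_algebra_carrier_iff up)
      have u: "u \<in> verts Q" using path path_source_in_verts by blast
      have "path_action x p (n u) \<in> carrier_vec (d j)"
        using path_action_closed[OF x path(1) rep_component[OF n u]] path(2) by simp
      then show "a r * path_action x (snd r) ((m \<oplus>\<^bsub>?M\<^esub> n) (fst r)) $ k
        = a r * path_action x (snd r) (m (fst r)) $ k + a r * path_action x (snd r) (n (fst r)) $ k"
        using k u path_action_add[OF x path(1) rep_component[OF m u] rep_component[OF n u]]
        by (simp add: up distrib_left)
    qed
    then show "?l j $ k = ?r j $ k"
      using j k by (simp add: rep_smult_apply sum.distrib)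
  qed
  moreover have "?l \<in> carrier ?M" "?r \<in> carrier ?M"
    using rep_add_closed[of _ d x] by simp_all
  ultimately show ?thesis
    by (intro rep_eqI[of ?l d x ?r])
qed

end

context adapted_rep
begin

definition F :: "nat \<Rightarrow> ('v \<Rightarrow> 'k vec) set" where
  "F l = {m \<in> carrier M. \<forall>i\<in>verts Q. m i \<in> W l i}"

lemma sum_in_W:
  assumes "i \<in> verts Q" "finite S" "\<And>r. r \<in> S \<Longrightarrow> y r \<in> W l i"
  shows "vec (d i) (\<lambda>k. \<Sum>r\<in>S. c r * y r $ k) \<in> W l i"
  using assms(2,3)
proof (induction S rule: finite_induct)
  case empty
  have "vec (d i) (\<lambda>k. 0 :: 'k) = 0\<^sub>v (d i)" by auto
  then show ?case using W_zero[OF assms(1)] by simp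
next
  case (insert s S)
  have "y s \<in> carrier_vec (d i)"
    using insert.prems W_subset[OF assms(1)] by blast
  then have "vec (d i) (\<lambda>k. \<Sum>r\<in>insert s S. c r * y r $ k)
      = c s \<cdot>\<^sub>v y s + vec (d i) (\<lambda>k. \<Sum>r\<in>S. c r * y r $ k)"
    using insert.hyps by (intro eq_vecI) auto
  then show ?case
    using insert W_add W_smult assms(1) by simp
qed

lemma smult_in_F:
  assumes a: "a \<in> carrier \<Lambda>"
    and path: "\<And>u p. a (u, p) \<noteq> 0 \<Longrightarrow> (u, p) \<in> paths Q \<Longrightarrow> path_action x p (m u) \<in> W l (path_target Q (u, p))"
  shows "a \<odot>\<^bsub>M\<^esub> m \<in> F l"
proof -
  have "(a \<odot>\<^bsub>M\<^esub> m) j \<in> W l j" if j: "j \<in> verts Q" for j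
    unfolding rep_smult_apply[OF j]
  proof (rule sum_in_W[OF j])
    show "finite {r. a r \<noteq> 0 \<and> path_target Q r = j}"
      using a by (auto simp: path_algebra_carrier_iff intro: finite_subset)
    show "path_action x (snd r) (m (fst r)) \<in> W l j"
      if "r \<in> {r. a r \<noteq> 0 \<and> path_target Q r = j}" for r
      using that path[of "fst r" "snd r"] a
      by (cases r) (auto simp: path_algebra_carrier_iff)
  qed
  then show ?thesis by (simp add: F_def)
qed

lemma zero_in_ideal_smult: "(\<lambda>j\<in>verts Q. 0\<^sub>v (d j)) \<in> ideal_smult (path_filtration l) M"
proof -
  have "(\<lambda>_. 0) \<in> path_filtration l"
    by (simp add: path_filtration_def path_algebra_carrier_iff)
  moreover have "(\<lambda>j\<in>verts Q. 0\<^sub>v (d j)) \<in> carrier M"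
    by (simp add: rep_carrier_iff)
  ultimately have "(\<lambda>_. 0) \<odot>\<^bsub>M\<^esub> (\<lambda>j\<in>verts Q. 0\<^sub>v (d j)) \<in> ideal_smult (path_filtration l) M"
    by (rule ideal_smult.prod)
  also have "(\<lambda>_. 0) \<odot>\<^bsub>M\<^esub> (\<lambda>j\<in>verts Q. 0\<^sub>v (d j)) = (\<lambda>j\<in>verts Q. 0\<^sub>v (d j))"
    by (auto simp: rep_module_def intro!: restrict_ext)
  finally show ?thesis .
qed

text \<open>
  The columns that span \<open>W l i\<close> are images of unit vectors under paths of length at
  least \<open>l\<close>, so they lie in \<open>J\<^sup>l M\<close>.
\<close>

lemma single_vertex_in_ideal_smult:
  assumes i: "i \<in> verts Q" and y: "y \<in> W l i" and l: "l \<le> N"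
  shows "single_vertex d i y \<in> ideal_smult (path_filtration l) M"
proof -
  let ?I = "ideal_smult (path_filtration l) M"
  have "y \<in> {y \<in> carrier_vec (d i). single_vertex d i y \<in> ?I}" (is "_ \<in> ?X")
  proof (rule W_induct[OF i y])
    have "single_vertex d i (0\<^sub>v (d i) :: 'k vec) = (\<lambda>j\<in>verts Q. 0\<^sub>v (d j))"
      by (auto simp: single_vertex_def intro!: restrict_ext)
    then show "0\<^sub>v (d i) \<in> ?X"
      using zero_in_ideal_smult by simp
    show "y + z \<in> ?X" if "y \<in> ?X" "z \<in> ?X" for y z
    proof -
      have "single_vertex d i (y + z) = single_vertex d i y \<oplus>\<^bsub>M\<^esub> single_vertex d i z"
        using that by (auto simp: rep_module_def single_vertex_def intro!: restrict_ext)
      then show ?thesis using that ideal_smult.sum by fastforce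
    qed
    show "c \<cdot>\<^sub>v col (G i) k \<in> ?X" if k: "k < d i" "k < w l i" for k c
    proof -
      obtain u p s where p: "(u, p) \<in> paths Q" "path_target Q (u, p) = i" "s < d u"
          "col (G i) k = path_action x p (unit_vec (d u) s)" "l \<le> length p"
        using col_G[OF i k(1)] k(2) l by blast
      have u: "u \<in> verts Q" using p(1) path_source_in_verts by blast
      let ?s = "single_vertex d u (unit_vec (d u) s)"
      have "?s \<in> carrier M"
        by (simp add: rep_carrier_iff)
      then have "path_monomial c (u, p) \<odot>\<^bsub>M\<^esub> ?s \<in> ?I"
        by (intro ideal_smult.prod path_monomial_in_filtration p)
      also have "path_monomial c (u, p) \<odot>\<^bsub>M\<^esub> ?s = single_vertex d i (c \<cdot>\<^sub>v col (G i) k)"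
      proof (rule rep_eqI)
        have col: "path_action x p (unit_vec (d u) s) \<in> carrier_vec (d i)"
          using path_action_closed[OF x p(1), of "unit_vec (d u) s"] p(2) by simp
        then show "single_vertex d i (c \<cdot>\<^sub>v col (G i) k) \<in> carrier M"
          by (simp add: rep_carrier_iff p(4))
        fix j assume j: "j \<in> verts Q"
        have "{r. path_monomial c (u, p) r \<noteq> 0 \<and> path_target Q r = j}
            = (if c \<noteq> 0 \<and> j = i then {(u, p)} else {})"
          using p(2) by (auto split: if_splits)
        then show "(path_monomial c (u, p) \<odot>\<^bsub>M\<^esub> ?s) j = single_vertex d i (c \<cdot>\<^sub>v col (G i) k) j"
          using u i j col by (auto simp: rep_smult_apply p(4) simp del: path_monomial_apply intro!: eq_vecI)
             (simp_all add: path_monomial_apply)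
      qed simp
      finally show ?thesis
        using k G_carrier[OF i] by auto
    qed
  qed
  then show ?thesis by simp
qed

lemma radical_power_eq_F:
  assumes l: "l \<le> N"
  shows "radical_power \<Lambda> M l = F l"
  unfolding radical_power_def ideal_power_jacobson_radical
proof
  let ?I = "ideal_smult (path_filtration l) M"
  show "?I \<subseteq> F l"
  proof
    fix m assume "m \<in> ?I"
    then show "m \<in> F l"
    proof induction
      case (prod a m)
      have m: "m u \<in> carrier_vec (d u)" if "u \<in> verts Q" for u
        using prod(2) that by (auto simp: rep_carrier_iff)
      show ?case
      proof (rule smult_in_F)
        show "a \<in> carrier \<Lambda>" using prod(1) path_filtration_subset by blast
        fix u p assume "a (u, p) \<noteq> 0" and path: "(u, p) \<in> paths Q"
        then have "l \<le> length p"
          using prod(1) not_less unfolding path_filtration_def by blast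
        then show "path_action x p (m u) \<in> W l (path_target Q (u, p))"
          using path_action_in_W[OF l path] m path_source_in_verts[OF path] by blast
      qed
    next
      case (sum m n)
      then show ?case
        using W_add rep_add_closed[of m d x n] by (simp add: F_def)
    qed
  qed
  show "F l \<subseteq> ?I"
  proof
    fix m assume m: "m \<in> F l"
    show "m \<in> ?I"
    proof (rule vertexwise_induct[OF _ zero_in_ideal_smult])
      show "m \<in> (\<Pi>\<^sub>E i\<in>verts Q. carrier_vec (d i))"
        using m by (simp add: F_def rep_carrier_iff)
      show "(\<lambda>i\<in>verts Q. y i + z i) \<in> ?I" if "y \<in> ?I" "z \<in> ?I" for y z
        using ideal_smult.sum[OF that] by (simp add: rep_module_def)
      show "single_vertex d i (m i) \<in> ?I" if "i \<in> verts Q" for i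
        using single_vertex_in_ideal_smult[OF that _ l] m that by (simp add: F_def)
    qed
  qed
qed

end

lemma (in acyclic_quiver) vertex_module_smult_closed [simp]:
  "m \<in> carrier (vertex_module Q n) \<Longrightarrow> a \<odot>\<^bsub>vertex_module Q n\<^esub> m \<in> carrier (vertex_module Q n)"
  by (auto simp: vertex_module_def)

lemma (in acyclic_quiver) vertex_module_add_closed [simp]:
  "m \<in> carrier (vertex_module Q n) \<Longrightarrow> m' \<in> carrier (vertex_module Q n) \<Longrightarrow>
    m \<oplus>\<^bsub>vertex_module Q n\<^esub> m' \<in> carrier (vertex_module Q n)"
  by (auto simp: vertex_module_def intro!: add_carrier_vec)

context adapted_rep
begin

lemma F_carrier: "m \<in> F l \<Longrightarrow> m \<in> carrier M"
  by (simp add: F_def)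

lemma F_antimono: "l < N \<Longrightarrow> F (Suc l) \<subseteq> F l"
  using W_antimono by (auto simp: F_def)

lemma F_add: "m \<in> F l \<Longrightarrow> n \<in> F l \<Longrightarrow> m \<oplus>\<^bsub>M\<^esub> n \<in> F l"
  using W_add rep_add_closed[of m d x n] by (simp add: F_def)

lemma F_zero: "\<zero>\<^bsub>M\<^esub> \<in> F l"
  using W_zero abelian_monoid.zero_closed[OF abelian_group.axioms(1)[OF abelian_group_rep_module]]
  by (simp add: F_def)

lemma F_neg: "m \<in> F l \<Longrightarrow> \<exists>n\<in>F l. n \<oplus>\<^bsub>M\<^esub> m = \<zero>\<^bsub>M\<^esub>"
proof -
  assume m: "m \<in> F l"
  let ?n = "\<lambda>i\<in>verts Q. (- 1) \<cdot>\<^sub>v m i"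
  have mi: "m i \<in> carrier_vec (d i)" if "i \<in> verts Q" for i
    using rep_component[OF F_carrier[OF m] that] .
  have "?n \<in> F l"
    using m W_smult mi by (auto simp: F_def rep_carrier_iff)
  moreover have "?n \<oplus>\<^bsub>M\<^esub> m = \<zero>\<^bsub>M\<^esub>"
    using mi by (auto simp: rep_module_def carrier_vecD[OF mi] intro!: restrict_ext eq_vecI)
  ultimately show ?thesis by blast
qed

lemma abelian_group_F: "abelian_group (M\<lparr>carrier := F l\<rparr>)"
proof -
  interpret M: abelian_group M by (rule abelian_group_rep_module)
  show ?thesis
    by (rule abelian_groupI)
      (use F_carrier F_add F_zero F_neg M.a_assoc M.a_comm in auto)
qed

lemma additive_subgroup_F:
  assumes "l < N"
  shows "additive_subgroup (F (Suc l)) (M\<lparr>carrier := F l\<rparr>)"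
proof -
  let ?M = "M\<lparr>carrier := F l\<rparr>"
  interpret F: abelian_group ?M by (rule abelian_group_F)
  show ?thesis
    unfolding additive_subgroup_def
  proof (rule F.add.subgroupI)
    show "F (Suc l) \<subseteq> carrier ?M" using F_antimono[OF assms] by simp
    show "F (Suc l) \<noteq> {}" using F_zero by blast
    show "m \<oplus>\<^bsub>?M\<^esub> n \<in> F (Suc l)" if "m \<in> F (Suc l)" "n \<in> F (Suc l)" for m n
      using F_add that by simp
    fix m assume m: "m \<in> F (Suc l)"
    obtain n where n: "n \<in> F (Suc l)" "n \<oplus>\<^bsub>M\<^esub> m = \<zero>\<^bsub>M\<^esub>"
      using F_neg[OF m] by blast
    have "\<ominus>\<^bsub>?M\<^esub> m = n"
      using n m F_antimono[OF assms] by (intro F.minus_equality) auto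
    then show "\<ominus>\<^bsub>?M\<^esub> m \<in> F (Suc l)" using n by simp
  qed
qed

text \<open>
  Every arrow raises the degree by one, and the spaces \<open>W l\<close> decrease with
  \<open>l\<close>.
\<close>

lemma path_raises_W:
  assumes "l < N" "(u, p) \<in> paths Q" "p \<noteq> []" "v \<in> W l u"
  shows "path_action x p v \<in> W (Suc l) (path_target Q (u, p))"
  using assms(2-4)
proof (induction p rule: rev_induct)
  case (snoc e p)
  have path: "(u, p) \<in> paths Q" "path_target Q (u, p) = tail Q e" "e \<in> arcs Q"
    using snoc.prems(1) unfolding paths_append_iff by auto
  have "path_action x p v \<in> W l (tail Q e)"
  proof (cases "p = []")
    case True
    then show ?thesis using snoc.prems path by simp
  next
    case False
    then show ?thesis
      using snoc.IH[OF path(1) False snoc.prems(3)] path W_antimono[OF assms(1), of "tail Q e"] by auto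
  qed
  then have "x e *\<^sub>v path_action x p v \<in> W (Suc l) (head Q e)"
    using assms(1) path by (intro arrow_maps_W_up path_action_in_W) auto
  then show ?case by simp
qed simp

text \<open>
  Paths of positive length map the degree \<open>l\<close> to the degree \<open>l + 1\<close>,
  so that only the coefficients at trivial paths act on the quotient.
\<close>

lemma smult_mod_F:
  assumes l: "l < N" and a: "a \<in> carrier \<Lambda>" and m: "m \<in> F l"
  shows "\<exists>h\<in>F (Suc l). a \<odot>\<^bsub>M\<^esub> m = h \<oplus>\<^bsub>M\<^esub> (\<lambda>i\<in>verts Q. a (i, []) \<cdot>\<^sub>v m i)"
proof
  define a' where "a' = (\<lambda>(u, p). if p = [] then 0 else a (u, p))"
  have a': "a' \<in> carrier \<Lambda>"
  proof -
    have "{r. a' r \<noteq> 0} \<subseteq> {r. a r \<noteq> 0}"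
      by (auto simp: a'_def split: if_splits)
    then show ?thesis
      using a by (auto simp: path_algebra_carrier_iff finite_subset a'_def)
  qed
  have mi: "m i \<in> carrier_vec (d i)" if "i \<in> verts Q" for i
    using rep_component[OF F_carrier[OF m] that] .
  show h: "a' \<odot>\<^bsub>M\<^esub> m \<in> F (Suc l)"
  proof (rule smult_in_F[OF a'])
    fix u p assume "a' (u, p) \<noteq> 0" and path: "(u, p) \<in> paths Q"
    then have "p \<noteq> []" by (auto simp: a'_def)
    then show "path_action x p (m u) \<in> W (Suc l) (path_target Q (u, p))"
      using m path_source_in_verts[OF path] by (intro path_raises_W[OF l path]) (auto simp: F_def)
  qed
  let ?t = "\<lambda>i\<in>verts Q. a (i, []) \<cdot>\<^sub>v m i"
  have t: "?t \<in> carrier M" using mi by (auto simp: rep_carrier_iff)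
  show "a \<odot>\<^bsub>M\<^esub> m = a' \<odot>\<^bsub>M\<^esub> m \<oplus>\<^bsub>M\<^esub> ?t"
  proof (rule rep_eqI)
    show "a' \<odot>\<^bsub>M\<^esub> m \<oplus>\<^bsub>M\<^esub> ?t \<in> carrier M"
      by (rule rep_add_closed[OF _ t]) simp
    fix j assume j: "j \<in> verts Q"
    let ?S = "{r. a r \<noteq> 0 \<and> path_target Q r = j}" and ?S' = "{r. a' r \<noteq> 0 \<and> path_target Q r = j}"
    have fin: "finite ?S'"
      using a' by (auto simp: path_algebra_carrier_iff intro: finite_subset)
    have S: "?S = (if a (j, []) \<noteq> 0 then insert (j, []) ?S' else ?S')"
      by (auto simp: a'_def split: if_splits)
    have "(j, []) \<notin> ?S'" by (simp add: a'_def)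
    then have "(\<Sum>r\<in>?S. a r * path_action x (snd r) (m (fst r)) $ k)
        = (\<Sum>r\<in>?S'. a r * path_action x (snd r) (m (fst r)) $ k) + a (j, []) * m j $ k" for k
      using fin by (simp add: S)
    moreover have "(\<Sum>r\<in>?S'. a r * path_action x (snd r) (m (fst r)) $ k)
        = (\<Sum>r\<in>?S'. a' r * path_action x (snd r) (m (fst r)) $ k)" for k
      by (intro sum.cong refl) (auto simp: a'_def split: if_splits)
    ultimately show "(a \<odot>\<^bsub>M\<^esub> m) j = (a' \<odot>\<^bsub>M\<^esub> m \<oplus>\<^bsub>M\<^esub> ?t) j"
      using j mi[OF j] by (intro eq_vecI) (simp_all add: rep_smult_apply)
  qed simp
qed

lemma G_eq_iff:
  assumes i: "i \<in> verts Q" and v: "v \<in> carrier_vec (d i)" "v' \<in> carrier_vec (d i)"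
    and eq: "G i *\<^sub>v v = G i *\<^sub>v v'"
  shows "v = v'"
proof -
  have "G i *\<^sub>v (v - v') = 0\<^sub>v (d i)"
    using mult_minus_distrib_mat_vec[OF G_carrier[OF i] v] eq G_carrier[OF i] by auto
  then have "v - v' = 0\<^sub>v (d i)"
    using G_inj[OF i, of "v - v'"] v by simp
  then have "v $ k = v' $ k" if "k < d i" for k
    using v that by (auto dest!: arg_cong[of _ _ "\<lambda>y. y $ k"])
  then show ?thesis using v by (intro eq_vecI) auto
qed

text \<open>
  Coordinates of elements of a complement of \<open>W (Suc l) i\<close> in \<open>W l i\<close>,
  namely the span of the columns of \<open>G i\<close> with indices from \<open>w (Suc l)
  i\<close> to \<open>w l i - 1\<close>.
\<close>

definition shift :: "nat \<Rightarrow> 'v \<Rightarrow> 'k vec \<Rightarrow> 'k vec" where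
  "shift l i v = vec (d i) (\<lambda>k. if w (Suc l) i \<le> k \<and> k < w l i then v $ (k - w (Suc l) i) else 0)"

definition layer_embedding :: "nat \<Rightarrow> ('v \<Rightarrow> 'k vec) \<Rightarrow> 'v \<Rightarrow> 'k vec" where
  "layer_embedding l m = (\<lambda>i\<in>verts Q. G i *\<^sub>v shift l i (m i))"

lemma shift_carrier [simp]: "shift l i v \<in> carrier_vec (d i)"
  by (simp add: shift_def)

theorem module_iso_radical_layering:
  assumes l: "l < N"
  shows "module_iso \<Lambda> (vertex_module Q (\<lambda>i. w l i - w (Suc l) i)) (radical_layering \<Lambda> M l)"
proof -
  let ?n = "\<lambda>i. w l i - w (Suc l) i" and ?M = "M\<lparr>carrier := F l\<rparr>"
  let ?E = "vertex_module Q ?n :: (('v, 'e) path \<Rightarrow> 'k, 'v \<Rightarrow> 'k vec) module"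
  have E: "m i \<in> carrier_vec (?n i)" if "m \<in> carrier ?E" "i \<in> verts Q" for m i
    using that by (auto simp: vertex_module_def)
  have w_le: "w (Suc l) i \<le> w l i" "w l i \<le> d i" if "i \<in> verts Q" for i
    using that w_antimono w_le_d l by auto
  have shift_V: "shift l i v \<in> V l i" for i v
    by (simp add: shift_def V_def)
  have emb_closed: "layer_embedding l m \<in> F l" for m
    using shift_V G_carrier by (auto simp: layer_embedding_def F_def W_def rep_carrier_iff
        intro!: mult_mat_vec_carrier)
  have "module_iso (\<Lambda> :: (('v, 'e) path \<Rightarrow> 'k) ring) ?E (quotient_module ?M (F (Suc l)))"
  proof (rule module_iso_quotientI[where f = "layer_embedding l"])
    show "abelian_group ?M" by (rule abelian_group_F)
    show "additive_subgroup (F (Suc l)) ?M" using l by (rule additive_subgroup_F)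
  next
    fix a :: "('v, 'e) path \<Rightarrow> 'k" and m
    assume a: "a \<in> carrier \<Lambda>" and "m \<in> carrier ?M"
    then have m: "m \<in> F l" by simp
    obtain h where h: "h \<in> F (Suc l)" "a \<odot>\<^bsub>M\<^esub> m = h \<oplus>\<^bsub>M\<^esub> (\<lambda>i\<in>verts Q. a (i, []) \<cdot>\<^sub>v m i)"
      using smult_mod_F[OF l a m] by blast
    have "(\<lambda>i\<in>verts Q. a (i, []) \<cdot>\<^sub>v m i) \<in> F l"
      using m W_smult rep_component[OF F_carrier[OF m]] by (auto simp: F_def rep_carrier_iff)
    then show "a \<odot>\<^bsub>?M\<^esub> m \<in> carrier ?M"
      using h F_add F_antimono[OF l] by auto
  next
    fix a :: "('v, 'e) path \<Rightarrow> 'k" and h m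
    assume a: "a \<in> carrier \<Lambda>" and h: "h \<in> F (Suc l)" and "m \<in> carrier ?M"
    then have "a \<odot>\<^bsub>M\<^esub> (h \<oplus>\<^bsub>M\<^esub> m) = a \<odot>\<^bsub>M\<^esub> h \<oplus>\<^bsub>M\<^esub> a \<odot>\<^bsub>M\<^esub> m"
      using F_carrier by (intro rep_smult_add x) auto
    moreover have "a \<odot>\<^bsub>M\<^esub> h \<in> F (Suc l)"
    proof (rule smult_in_F[OF a])
      fix u p assume path: "(u, p) \<in> paths Q"
      then have "u \<in> verts Q" by (rule path_source_in_verts)
      then have "h u \<in> W (Suc l) u" using h by (simp add: F_def)
      then show "path_action x p (h u) \<in> W (Suc l) (path_target Q (u, p))"
        using path_raises_W[OF l path, of "h u"] W_antimono[OF l \<open>u \<in> verts Q\<close>]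
        by (cases "p = []") auto
    qed
    ultimately show "\<exists>h'\<in>F (Suc l). a \<odot>\<^bsub>?M\<^esub> (h \<oplus>\<^bsub>?M\<^esub> m) = h' \<oplus>\<^bsub>?M\<^esub> a \<odot>\<^bsub>?M\<^esub> m"
      by auto
  next
    fix m n assume m: "m \<in> carrier ?E" and n: "n \<in> carrier ?E"
    have "shift l i (m i + n i) = shift l i (m i) + shift l i (n i)" if "i \<in> verts Q" for i
      using E[OF m that] E[OF n that] w_le[OF that] by (intro eq_vecI) (auto simp: shift_def)
    then show "layer_embedding l (m \<oplus>\<^bsub>?E\<^esub> n) = layer_embedding l m \<oplus>\<^bsub>?M\<^esub> layer_embedding l n"
      by (auto simp: layer_embedding_def vertex_module_def rep_module_def
          mult_add_distrib_mat_vec[OF G_carrier] intro!: restrict_ext)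
  next
    fix a :: "('v, 'e) path \<Rightarrow> 'k" and m
    assume a: "a \<in> carrier \<Lambda>" and m: "m \<in> carrier ?E"
    have "shift l i (a (i, []) \<cdot>\<^sub>v m i) = a (i, []) \<cdot>\<^sub>v shift l i (m i)" if "i \<in> verts Q" for i
      using E[OF m that] w_le[OF that] by (intro eq_vecI) (auto simp: shift_def)
    then have "layer_embedding l (a \<odot>\<^bsub>?E\<^esub> m) = (\<lambda>i\<in>verts Q. a (i, []) \<cdot>\<^sub>v layer_embedding l m i)"
      by (auto simp: layer_embedding_def vertex_module_def mult_mat_vec[OF G_carrier] intro!: restrict_ext)
    then show "\<exists>h\<in>F (Suc l). a \<odot>\<^bsub>?M\<^esub> layer_embedding l m = h \<oplus>\<^bsub>?M\<^esub> layer_embedding l (a \<odot>\<^bsub>?E\<^esub> m)"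
      using smult_mod_F[OF l a emb_closed, of m] by simp
  next
    fix m n h assume m: "m \<in> carrier ?E" and n: "n \<in> carrier ?E" and h: "h \<in> F (Suc l)"
      and eq: "layer_embedding l m = h \<oplus>\<^bsub>?M\<^esub> layer_embedding l n"
    have "m i = n i" if i: "i \<in> verts Q" for i
    proof -
      obtain v where v: "v \<in> V (Suc l) i" "h i = G i *\<^sub>v v"
        using h i by (auto simp: F_def W_def)
      have vc: "v \<in> carrier_vec (d i)" using v(1) by (simp add: V_def)
      have "G i *\<^sub>v shift l i (m i) = G i *\<^sub>v v + G i *\<^sub>v shift l i (n i)"
        using fun_cong[OF eq, of i] i by (simp add: layer_embedding_def v(2))
      also have "\<dots> = G i *\<^sub>v (v + shift l i (n i))"
        by (rule mult_add_distrib_mat_vec[OF G_carrier[OF i] vc shift_carrier, symmetric])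
      finally have s: "shift l i (m i) = v + shift l i (n i)"
        by (rule G_eq_iff[OF i shift_carrier add_carrier_vec[OF vc shift_carrier]])
      show ?thesis
      proof (rule eq_vecI)
        fix k assume "k < dim_vec (n i)"
        then have k: "k < ?n i" using E[OF n i] by auto
        let ?k = "k + w (Suc l) i"
        have kw: "?k < w l i" "?k < d i" using k w_le(2)[OF i] by simp_all
        then have shift_k: "shift l i y $ ?k = y $ k" for y
          by (simp add: shift_def)
        have "shift l i (m i) $ ?k = v $ ?k + shift l i (n i) $ ?k"
          unfolding s using kw(2) by (simp add: shift_def)
        moreover have "v $ ?k = 0"
          using v(1) kw(2) by (simp add: V_def)
        ultimately show "m i $ k = n i $ k"
          by (simp add: shift_k)
      qed (use E[OF m i] E[OF n i] in auto)
    qed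
    then show "m = n"
      using m n PiE_ext[of m "verts Q" "\<lambda>i. carrier_vec (?n i)" n] by (simp add: vertex_module_def)
  next
    fix y assume "y \<in> carrier ?M"
    then have y: "y \<in> F l" by simp
    then have "\<exists>v. v \<in> V l i \<and> y i = G i *\<^sub>v v" if "i \<in> verts Q" for i
      using that by (auto simp: F_def W_def)
    then obtain v where v: "\<And>i. i \<in> verts Q \<Longrightarrow> v i \<in> V l i \<and> y i = G i *\<^sub>v v i"
      by metis
    define m where "m = (\<lambda>i\<in>verts Q. vec (?n i) (\<lambda>k. v i $ (k + w (Suc l) i)))"
    define b where "b i = vec (d i) (\<lambda>k. if k < w (Suc l) i then v i $ k else 0)" for i
    define h where "h = (\<lambda>i\<in>verts Q. G i *\<^sub>v b i)"
    have b: "b i \<in> V (Suc l) i" for i by (simp add: b_def V_def)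
    then have h: "h \<in> F (Suc l)"
      using G_carrier unfolding h_def F_def W_def V_def
      by (auto simp: rep_carrier_iff intro!: mult_mat_vec_carrier)
    have m: "m \<in> carrier ?E" by (auto simp: m_def vertex_module_def)
    have "y = h \<oplus>\<^bsub>M\<^esub> layer_embedding l m"
    proof (rule rep_eqI)
      show "y \<in> carrier M" "h \<oplus>\<^bsub>M\<^esub> layer_embedding l m \<in> carrier M"
        using F_carrier[OF y] rep_add_closed[OF F_carrier[OF h] F_carrier[OF emb_closed]] by simp_all
      fix i assume i: "i \<in> verts Q"
      have "v i = b i + shift l i (m i)"
        using v[OF i] i w_le[OF i] by (intro eq_vecI) (auto simp: b_def shift_def m_def V_def)
      then have "G i *\<^sub>v v i = G i *\<^sub>v b i + G i *\<^sub>v shift l i (m i)"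
        using mult_add_distrib_mat_vec[OF G_carrier[OF i], of "b i" "shift l i (m i)"] b[of i]
        by (simp add: V_def)
      then show "y i = (h \<oplus>\<^bsub>M\<^esub> layer_embedding l m) i"
        using i v[OF i] by (simp add: h_def layer_embedding_def)
    qed
    then show "\<exists>h\<in>F (Suc l). \<exists>m\<in>carrier ?E. y = h \<oplus>\<^bsub>?M\<^esub> layer_embedding l m"
      using h m by auto
  qed (use emb_closed in simp_all)
  then show ?thesis
    using l by (simp add: radical_layering_def radical_power_eq_F)
qed

end

section \<open>Irreducibility of the representation variety\<close>

text \<open>
  Over a finite field, the polynomial \<open>1 + \<Prod>\<^sub>a (X - a)\<close> has no roots.
\<close>

lemma infinite_alg_closed_field: "infinite (UNIV :: 'k::alg_closed_field set)"
proof
  assume fin: "finite (UNIV :: 'k set)"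
  define p where "p = (\<Prod>a\<in>(UNIV :: 'k set). [:- a, 1:])"
  have "degree p = card (UNIV :: 'k set)"
    unfolding p_def by (subst degree_prod_eq_sum_degree) (auto simp: fin)
  then have "degree p > 0"
    using fin by (simp add: card_gt_0_iff)
  then have "degree (p + 1) > 0"
    by (simp add: degree_add_eq_left)
  then obtain a where "poly (p + 1) a = 0"
    using alg_closed_imp_poly_has_root by blast
  moreover have "poly p a = 0"
    unfolding p_def poly_prod using fin by (intro prod_zero) auto
  ultimately show False by simp
qed

lemma polynomial_function_on_line:
  fixes x y :: "'e \<Rightarrow> 'k::field mat"
  assumes "f \<in> polynomial_functions Q d"
  shows "\<exists>q. \<forall>s. f (\<lambda>e\<in>arcs Q. mat (d (head Q e)) (d (tail Q e))
    (\<lambda>i. x e $$ i + s * (y e $$ i - x e $$ i))) = poly q s"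
    (is "\<exists>q. \<forall>s. f (?line s) = _")
  using assms
proof induction
  case (const c)
  show ?case by (intro exI[of _ "[:c:]"]) simp
next
  case (coord e r s)
  then show ?case
    by (intro exI[of _ "[:x e $$ (r, s), y e $$ (r, s) - x e $$ (r, s):]"]) simp
next
  case (add f g)
  then obtain p q where "\<And>s. f (?line s) = poly p s" "\<And>s. g (?line s) = poly q s" by blast
  then show ?case by (intro exI[of _ "p + q"]) (simp only: poly_add simp_thms)
next
  case (mult f g)
  then obtain p q where "\<And>s. f (?line s) = poly p s" "\<And>s. g (?line s) = poly q s" by blast
  then show ?case by (intro exI[of _ "p * q"]) (simp only: poly_mult simp_thms)
qed

text \<open>
  Choose polynomial functions \<open>f\<close> and \<open>g\<close> that vanish outside of
  \<open>T\<close> and \<open>U\<close> respectively, but not at points \<open>x\<close> and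
  \<open>y\<close>. On the line through \<open>x\<close> and \<open>y\<close> they are nonzero
  polynomials in one parameter, whose product has finitely many roots.
\<close>

lemma zariski_open_Int_nonempty:
  fixes T U :: "('e \<Rightarrow> 'k::alg_closed_field mat) set"
  assumes T: "openin (zariski Q d) T" "T \<noteq> {}" and U: "openin (zariski Q d) U" "U \<noteq> {}"
  shows "T \<inter> U \<noteq> {}"
proof -
  have nonvanishing: "\<exists>x\<in>Rep Q d. \<exists>f\<in>polynomial_functions Q d. f x \<noteq> 0 \<and> (\<forall>z\<in>Rep Q d. f z \<noteq> 0 \<longrightarrow> z \<in> W)"
    if "openin (zariski Q d) W" "W \<noteq> {}" for W :: "('e \<Rightarrow> 'k mat) set"
    using that unfolding openin_zariski zariski_open_def by blast
  obtain x f where x: "x \<in> Rep Q d" and f: "f \<in> polynomial_functions Q d" "f x \<noteq> 0"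
    and fT: "\<And>z. z \<in> Rep Q d \<Longrightarrow> f z \<noteq> 0 \<Longrightarrow> z \<in> T"
    using nonvanishing[OF T] by blast
  obtain y g where y: "y \<in> Rep Q d" and g: "g \<in> polynomial_functions Q d" "g y \<noteq> 0"
    and gU: "\<And>z. z \<in> Rep Q d \<Longrightarrow> g z \<noteq> 0 \<Longrightarrow> z \<in> U"
    using nonvanishing[OF U] by blast
  define line where "line s = (\<lambda>e\<in>arcs Q. mat (d (head Q e)) (d (tail Q e))
    (\<lambda>i. x e $$ i + s * (y e $$ i - x e $$ i)))" for s
  have line: "line s \<in> Rep Q d" for s
    by (auto simp: line_def Rep_def)
  have "mat (d (head Q e)) (d (tail Q e)) (\<lambda>i. x e $$ i) = x e" if "e \<in> arcs Q" for e
    using PiE_mem[OF x[unfolded Rep_def] that] by (intro eq_matI) auto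
  then have line_0: "line 0 = x"
    using x unfolding line_def Rep_def by (auto simp: PiE_iff extensional_def)
  have "mat (d (head Q e)) (d (tail Q e)) (\<lambda>i. y e $$ i) = y e" if "e \<in> arcs Q" for e
    using PiE_mem[OF y[unfolded Rep_def] that] by (intro eq_matI) auto
  then have line_1: "line 1 = y"
    using y unfolding line_def Rep_def by (auto simp: PiE_iff extensional_def)
  obtain p where p: "\<And>s. f (line s) = poly p s"
    using polynomial_function_on_line[OF f(1)] unfolding line_def by blast
  obtain q where q: "\<And>s. g (line s) = poly q s"
    using polynomial_function_on_line[OF g(1)] unfolding line_def by blast
  have "p \<noteq> 0" "q \<noteq> 0"
    using p[of 0] f(2) q[of 1] g(2) by (auto simp: line_0 line_1)
  then have "finite {s. poly (p * q) s = 0}"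
    by (intro poly_roots_finite) simp
  then obtain s where "poly (p * q) s \<noteq> 0"
    using infinite_alg_closed_field by (metis (mono_tags, lifting) UNIV_eq_I mem_Collect_eq)
  then have "f (line s) \<noteq> 0" "g (line s) \<noteq> 0"
    by (auto simp: p q)
  then show ?thesis
    using fT gU line by blast
qed

lemma zariski_open_dense:
  fixes U :: "('e \<Rightarrow> 'k::alg_closed_field mat) set"
  assumes "openin (zariski Q d) U" "U \<noteq> {}"
  shows "zariski Q d closure_of U = topspace (zariski Q d)"
  unfolding dense_intersects_open using zariski_open_Int_nonempty assms by blast

text \<open>
  Expressions such as the entries of products of matrices agree with polynomial functions only
  where the matrices have the sizes prescribed by \<open>d\<close>.
\<close>

definition polynomial_on_Rep where
  "polynomial_on_Rep Q d f \<longleftrightarrow> (\<exists>g\<in>polynomial_functions Q d. \<forall>x\<in>Rep Q d. g x = f x)"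

lemma polynomial_on_Rep_const: "polynomial_on_Rep Q d (\<lambda>x. c)"
  unfolding polynomial_on_Rep_def by (intro bexI[of _ "\<lambda>x. c"] polynomial_functions.const) simp

lemma polynomial_on_Rep_coord:
  assumes "e \<in> arcs Q" "r < d (head Q e)" "s < d (tail Q e)"
  shows "polynomial_on_Rep Q d (\<lambda>x. x e $$ (r, s))"
  unfolding polynomial_on_Rep_def by (rule bexI[OF _ polynomial_functions.coord[OF assms]]) simp

lemma polynomial_on_Rep_add:
  "polynomial_on_Rep Q d f \<Longrightarrow> polynomial_on_Rep Q d g \<Longrightarrow> polynomial_on_Rep Q d (\<lambda>x. f x + g x)"
  unfolding polynomial_on_Rep_def
proof (elim bexE)
  fix f' g' assume "f' \<in> polynomial_functions Q d" "g' \<in> polynomial_functions Q d"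
    "\<forall>x\<in>Rep Q d. f' x = f x" "\<forall>x\<in>Rep Q d. g' x = g x"
  then show "\<exists>h\<in>polynomial_functions Q d. \<forall>x\<in>Rep Q d. h x = f x + g x"
    by (intro bexI[of _ "\<lambda>x. f' x + g' x"] polynomial_functions.add) auto
qed

lemma polynomial_on_Rep_mult:
  "polynomial_on_Rep Q d f \<Longrightarrow> polynomial_on_Rep Q d g \<Longrightarrow> polynomial_on_Rep Q d (\<lambda>x. f x * g x)"
  unfolding polynomial_on_Rep_def
proof (elim bexE)
  fix f' g' assume "f' \<in> polynomial_functions Q d" "g' \<in> polynomial_functions Q d"
    "\<forall>x\<in>Rep Q d. f' x = f x" "\<forall>x\<in>Rep Q d. g' x = g x"
  then show "\<exists>h\<in>polynomial_functions Q d. \<forall>x\<in>Rep Q d. h x = f x * g x"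
    by (intro bexI[of _ "\<lambda>x. f' x * g' x"] polynomial_functions.mult) auto
qed

lemma polynomial_on_Rep_sum:
  "(\<And>i. i \<in> I \<Longrightarrow> polynomial_on_Rep Q d (f i)) \<Longrightarrow> polynomial_on_Rep Q d (\<lambda>x. \<Sum>i\<in>I. f i x)"
  by (induction I rule: infinite_finite_induct)
    (auto intro: polynomial_on_Rep_const polynomial_on_Rep_add)

lemma polynomial_on_Rep_prod:
  "(\<And>i. i \<in> I \<Longrightarrow> polynomial_on_Rep Q d (f i)) \<Longrightarrow> polynomial_on_Rep Q d (\<lambda>x. \<Prod>i\<in>I. f i x)"
  by (induction I rule: infinite_finite_induct)
    (auto intro: polynomial_on_Rep_const polynomial_on_Rep_mult)

lemma polynomial_on_Rep_cong:
  "polynomial_on_Rep Q d f \<Longrightarrow> (\<And>x. x \<in> Rep Q d \<Longrightarrow> f x = g x) \<Longrightarrow> polynomial_on_Rep Q d g"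
  unfolding polynomial_on_Rep_def by auto

lemma polynomial_on_Rep_det:
  assumes A: "\<And>x. x \<in> Rep Q d \<Longrightarrow> A x \<in> carrier_mat n n"
    and entries: "\<And>i j. i < n \<Longrightarrow> j < n \<Longrightarrow> polynomial_on_Rep Q d (\<lambda>x. A x $$ (i, j))"
  shows "polynomial_on_Rep Q d (\<lambda>x. det (A x) :: 'k::field)"
proof (rule polynomial_on_Rep_cong)
  show "polynomial_on_Rep Q d (\<lambda>x. \<Sum>\<pi>\<in>{\<pi>. \<pi> permutes {0..<n}}. signof \<pi> * (\<Prod>i\<in>{0..<n}. A x $$ (i, \<pi> i)))"
    by (intro polynomial_on_Rep_sum polynomial_on_Rep_mult polynomial_on_Rep_const
        polynomial_on_Rep_prod entries) (auto dest: permutes_in_image)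
qed (simp add: det_def'[OF A])

lemma zariski_open_nonvanishing:
  assumes "polynomial_on_Rep Q d f"
  shows "openin (zariski Q d) {x \<in> Rep Q d. f x \<noteq> 0}"
proof -
  obtain g where "g \<in> polynomial_functions Q d" "\<And>x. x \<in> Rep Q d \<Longrightarrow> g x = f x"
    using assms unfolding polynomial_on_Rep_def by blast
  then show ?thesis
    unfolding openin_zariski zariski_open_def by (intro exI[of _ "{g}"]) auto
qed

context acyclic_quiver
begin

lemma polynomial_on_Rep_path_action:
  fixes v :: "'k::field vec"
  assumes v: "v \<in> carrier_vec (d u)"
  shows "(u, p) \<in> paths Q \<Longrightarrow> r < d (path_target Q (u, p)) \<Longrightarrow>
    polynomial_on_Rep Q d (\<lambda>x. path_action x p v $ r)"
proof (induction p arbitrary: r rule: rev_induct)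
  case Nil
  then show ?case by (simp add: polynomial_on_Rep_const)
next
  case (snoc e p)
  have path: "(u, p) \<in> paths Q" "path_target Q (u, p) = tail Q e" "e \<in> arcs Q"
    using snoc.prems(1) unfolding paths_append_iff by auto
  have r: "r < d (head Q e)" using snoc.prems(2) by simp
  show ?case
  proof (rule polynomial_on_Rep_cong)
    show "polynomial_on_Rep Q d (\<lambda>x. \<Sum>s\<in>{0..<d (tail Q e)}. x e $$ (r, s) * path_action x p v $ s)"
      using path r by (intro polynomial_on_Rep_sum polynomial_on_Rep_mult polynomial_on_Rep_coord snoc.IH) auto
    fix x :: "'e \<Rightarrow> 'k mat" assume x: "x \<in> Rep Q d"
    show "(\<Sum>s\<in>{0..<d (tail Q e)}. x e $$ (r, s) * path_action x p v $ s) = path_action x (p @ [e]) v $ r"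
      using path_action_closed[OF x path(1) v] Rep_carrier[OF x path(3)] path(2) r
      by (simp add: scalar_prod_def)
  qed
qed

end

section \<open>The generic dimensions are attained\<close>

text \<open>
  Enumerate the smallest set first, then the rest of the next larger one, and so on.
\<close>

lemma chain_enumeration:
  fixes P :: "nat \<Rightarrow> 'a set"
  assumes "finite (P 0)" and "\<And>l. P (Suc l) \<subseteq> P l"
  shows "\<exists>\<kappa>. inj_on \<kappa> (P 0) \<and> (\<forall>l\<le>n. \<kappa> ` P l = {..<card (P l)})"
  using assms
proof (induction n arbitrary: P)
  case 0
  obtain h where "bij_betw h (P 0) {0..<card (P 0)}"
    using ex_bij_betw_finite_nat[OF 0(1)] by blast
  then show ?case
    by (auto simp: bij_betw_def atLeast0LessThan)
next
  case (Suc n)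
  have fin: "finite (P (Suc 0))"
    using Suc.prems finite_subset by blast
  obtain \<kappa> where \<kappa>: "inj_on \<kappa> (P (Suc 0))" "\<And>l. l \<le> n \<Longrightarrow> \<kappa> ` P (Suc l) = {..<card (P (Suc l))}"
    using Suc.IH[of "\<lambda>l. P (Suc l)"] fin Suc.prems(2) by auto
  let ?D = "P 0 - P (Suc 0)" and ?m = "card (P (Suc 0))"
  obtain h where h: "bij_betw h ?D {0..<card ?D}"
    using ex_bij_betw_finite_nat[of ?D] Suc.prems(1) by blast
  define \<kappa>' where "\<kappa>' p = (if p \<in> P (Suc 0) then \<kappa> p else ?m + h p)" for p
  have sub: "P (Suc l) \<subseteq> P (Suc 0)" for l
    using lift_Suc_antimono_le[of P 1 "Suc l"] Suc.prems(2) by auto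
  have \<kappa>'_Suc: "\<kappa>' ` P (Suc l) = \<kappa> ` P (Suc l)" for l
    using sub[of l] by (intro image_cong) (auto simp: \<kappa>'_def)
  have D: "\<kappa>' ` ?D = {?m..<?m + card ?D}"
  proof -
    have "\<kappa>' ` ?D = (+) ?m ` h ` ?D" by (auto simp: \<kappa>'_def image_iff)
    also have "\<dots> = (+) ?m ` {0..<card ?D}" using h by (simp add: bij_betw_def)
    also have "\<dots> = {?m..<?m + card ?D}"
      by (simp add: image_add_atLeastLessThan add.commute)
    finally show ?thesis .
  qed
  have card: "card (P 0) = ?m + card ?D"
    using Suc.prems fin by (simp add: card_Diff_subset card_mono)
  have P0: "P 0 = P (Suc 0) \<union> ?D" using Suc.prems(2) by auto
  have 0: "\<kappa>' ` P 0 = {..<card (P 0)}"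
    unfolding card by (subst P0, subst image_Un, subst D, subst \<kappa>'_Suc) (auto simp: \<kappa>(2)[of 0])
  then have "inj_on \<kappa>' (P 0)"
    using Suc.prems(1) by (intro eq_card_imp_inj_on) auto
  moreover have "\<kappa>' ` P l = {..<card (P l)}" if "l \<le> Suc n" for l
    using that 0 \<kappa>'_Suc \<kappa>(2) by (cases l) auto
  ultimately show ?case by blast
qed

context acyclic_quiver
begin

text \<open>
  The maximal dimension of the component of \<open>J\<^sup>l M\<close> at a vertex, for modules
  \<open>M\<close> with dimension vector \<open>d\<close>.
\<close>

primrec generic_dim :: "('v \<Rightarrow> nat) \<Rightarrow> nat \<Rightarrow> 'v \<Rightarrow> nat" where
  "generic_dim d 0 = d"
| "generic_dim d (Suc l) = (\<lambda>j. min (generic_dim d l j)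
     (\<Sum>e\<in>{e \<in> arcs Q. head Q e = j}. generic_dim d l (tail Q e)))"

lemma generic_dim_antimono: "generic_dim d (Suc l) j \<le> generic_dim d l j"
  by simp

text \<open>
  The sums over the arrows decrease with \<open>l\<close>, so the minimum in the recursion can
  be taken with the initial value.
\<close>

lemma generic_dim_Suc_eq:
  "generic_dim d (Suc l) j = min (d j) (\<Sum>e\<in>{e \<in> arcs Q. head Q e = j}. generic_dim d l (tail Q e))"
proof (induction l)
  case (Suc l)
  have "(\<Sum>e\<in>{e \<in> arcs Q. head Q e = j}. generic_dim d (Suc l) (tail Q e))
      \<le> (\<Sum>e\<in>{e \<in> arcs Q. head Q e = j}. generic_dim d l (tail Q e))"
    by (intro sum_mono generic_dim_antimono)
  then show ?case
    by (simp only: generic_dim.simps(2)[of d "Suc l"] Suc.IH min.assoc min.absorb2)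
qed simp

lemma generic_dim_le: "generic_dim d l j \<le> d j"
  by (induction l arbitrary: j) (auto intro: le_trans[OF min.cobounded1])

text \<open>
  Take the pairs \<open>(e, s)\<close> of an arrow \<open>e\<close> into \<open>j\<close> and an
  index \<open>s\<close> at its tail. By \<open>chain_enumeration\<close>, they can be
  numbered by a map \<open>\<kappa> j\<close> such that, for every \<open>l \<le> n\<close>, the pairs with \<open>s
  < generic_dim d l (tail e)\<close> get the smallest numbers. The arrow \<open>e\<close> sends
  the unit vector \<open>s\<close> to the unit vector with the number of \<open>(e, s)\<close>,
  or to zero if the number is not smaller than \<open>d j\<close>.
\<close>

lemma unit_vectors_by_paths:
  "\<exists>x \<in> Rep Q d. \<forall>l j k. l \<le> Suc n \<longrightarrow> j \<in> verts Q \<longrightarrow> k < generic_dim d l j \<longrightarrow>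
    (\<exists>u p s. (u, p) \<in> paths Q \<and> path_target Q (u, p) = j \<and> length p = l \<and> s < d u
      \<and> path_action x p (unit_vec (d u) s) = (unit_vec (d j) k :: 'k::field vec))"
proof -
  let ?E = "\<lambda>j. {e \<in> arcs Q. head Q e = j}"
  define P where "P j l = (SIGMA e:?E j. {..<generic_dim d l (tail Q e)})" for j l
  have card_P: "card (P j l) = (\<Sum>e\<in>?E j. generic_dim d l (tail Q e))" for j l
    unfolding P_def by (subst card_SigmaI) auto
  have "\<exists>\<kappa>. inj_on \<kappa> (P j 0) \<and> (\<forall>l\<le>n. \<kappa> ` P j l = {..<card (P j l)})" for j
  proof (rule chain_enumeration)
    show "finite (P j 0)" by (auto simp: P_def)
    show "P j (Suc l) \<subseteq> P j l" for l
      unfolding P_def using less_le_trans[OF _ generic_dim_antimono] by (intro Sigma_mono) auto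
  qed
  then obtain \<kappa> where inj: "\<And>j. inj_on (\<kappa> j) (P j 0)"
    and \<kappa>: "\<And>j l. l \<le> n \<Longrightarrow> \<kappa> j ` P j l = {..<card (P j l)}"
    by metis
  define x :: "'e \<Rightarrow> 'k mat" where
    "x = (\<lambda>e\<in>arcs Q. mat (d (head Q e)) (d (tail Q e)) (\<lambda>(r, s). if r = \<kappa> (head Q e) (e, s) then 1 else 0))"
  have x: "x \<in> Rep Q d" by (auto simp: x_def Rep_def)
  have x_unit: "x e *\<^sub>v unit_vec (d (tail Q e)) s = unit_vec (d (head Q e)) (\<kappa> (head Q e) (e, s))"
    if e: "e \<in> arcs Q" and s: "s < d (tail Q e)" for e s
    using mat_mult_unit_vec[OF Rep_carrier[OF x e] s] e s
    by (auto simp: x_def unit_vec_def intro!: eq_vecI)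
  have "\<exists>u p s. (u, p) \<in> paths Q \<and> path_target Q (u, p) = j \<and> length p = l \<and> s < d u
        \<and> path_action x p (unit_vec (d u) s) = unit_vec (d j) k"
    if "l \<le> Suc n" "j \<in> verts Q" "k < generic_dim d l j" for l j k
    using that
  proof (induction l arbitrary: j k)
    case 0
    then show ?case by (intro exI[of _ j] exI[of _ "[]"] exI[of _ k]) simp
  next
    case (Suc l)
    have "k \<in> \<kappa> j ` P j l"
      using Suc.prems by (simp add: \<kappa> card_P)
    then obtain e s where e: "e \<in> arcs Q" "head Q e = j" and s: "s < generic_dim d l (tail Q e)"
      and k: "k = \<kappa> j (e, s)"
      by (auto simp: P_def)
    obtain u p r where p: "(u, p) \<in> paths Q" "path_target Q (u, p) = tail Q e" "length p = l" "r < d u"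
      "path_action x p (unit_vec (d u) r) = unit_vec (d (tail Q e)) s"
      using Suc.IH[of "tail Q e" s] s e Suc.prems(1) by auto
    have "x e *\<^sub>v path_action x p (unit_vec (d u) r) = unit_vec (d j) k"
      using x_unit[OF e(1)] s generic_dim_le[of d l "tail Q e"] by (simp add: p(5) e(2) k)
    then show ?case
      using p e by (intro exI[of _ u] exI[of _ "p @ [e]"] exI[of _ r]) (simp add: paths_append_iff)
  qed
  then show ?thesis using x by blast
qed

text \<open>
  Choose paths for the representation of the preceding lemma, as long as possible. Each of them
  still yields a vector in any other representation, and these vectors form the columns of
  \<open>G x j\<close>. The open set is the locus where all determinants of these matrices are
  nonzero.
\<close>

theorem generic_adapted_rep:
  "\<exists>(U :: ('e \<Rightarrow> 'k::alg_closed_field mat) set) G. openin (zariski Q d) U \<and> U \<noteq> {} \<and> U \<subseteq> Rep Q d \<and>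
    (\<forall>x\<in>U. adapted_rep Q d x (generic_dim d) (Suc n) (G x))"
proof -
  obtain x0 :: "'e \<Rightarrow> 'k mat" where x0: "x0 \<in> Rep Q d"
    and path: "\<forall>l j k. l \<le> Suc n \<longrightarrow> j \<in> verts Q \<longrightarrow> k < generic_dim d l j \<longrightarrow>
      (\<exists>u p s. (u, p) \<in> paths Q \<and> path_target Q (u, p) = j \<and> length p = l \<and> s < d u
        \<and> path_action x0 p (unit_vec (d u) s) = unit_vec (d j) k)"
    by (rule bexE[OF unit_vectors_by_paths[of d n, where 'k = 'k]])
  \<comment> \<open>A path as long as the maximal degree in which the unit vector \<open>k\<close> occurs serves for all
    smaller degrees as well.\<close>
  have good_ex: "\<exists>u p s. (u, p) \<in> paths Q \<and> path_target Q (u, p) = j \<and> s < d u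
      \<and> path_action x0 p (unit_vec (d u) s) = unit_vec (d j) k
      \<and> (\<forall>l\<le>Suc n. k < generic_dim d l j \<longrightarrow> l \<le> length p)" if j: "j \<in> verts Q" and k: "k < d j" for j k
  proof -
    let ?L = "{l. l \<le> Suc n \<and> k < generic_dim d l j}"
    have "0 \<in> ?L" using k by simp
    then have "Max ?L \<in> ?L" by (intro Max_in) auto
    then obtain u p s where "(u, p) \<in> paths Q" "path_target Q (u, p) = j" "length p = Max ?L" "s < d u"
      "path_action x0 p (unit_vec (d u) s) = unit_vec (d j) k"
      using path[rule_format, of "Max ?L" j k] j by (elim CollectE conjE) blast
    moreover have "l \<le> Max ?L" if "l \<le> Suc n" "k < generic_dim d l j" for l
      using that by (intro Max_ge) auto
    ultimately show ?thesis by metis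
  qed
  define good where "good j k = (\<lambda>(u, p, s). (u, p) \<in> paths Q \<and> path_target Q (u, p) = j \<and> s < d u
      \<and> path_action x0 p (unit_vec (d u) s) = unit_vec (d j) k
      \<and> (\<forall>l\<le>Suc n. k < generic_dim d l j \<longrightarrow> l \<le> length p))" for j k
  define choice where "choice j k = (SOME t. good j k t)" for j k
  define u p s where "u j k = fst (choice j k)" and "p j k = fst (snd (choice j k))"
    and "s j k = snd (snd (choice j k))" for j k
  have ps: "(u j k, p j k) \<in> paths Q \<and> path_target Q (u j k, p j k) = j \<and> s j k < d (u j k)
      \<and> path_action x0 (p j k) (unit_vec (d (u j k)) (s j k)) = unit_vec (d j) k
      \<and> (\<forall>l\<le>Suc n. k < generic_dim d l j \<longrightarrow> l \<le> length (p j k))"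
    if j: "j \<in> verts Q" and k: "k < d j" for j k
  proof -
    have "\<exists>t. good j k t" using good_ex[OF j k] by (auto simp: good_def)
    then have "good j k (choice j k)" unfolding choice_def by (rule someI_ex)
    then show ?thesis by (simp add: good_def case_prod_unfold u_def p_def s_def)
  qed
  define G :: "('e \<Rightarrow> 'k mat) \<Rightarrow> 'v \<Rightarrow> 'k mat" where
    "G x j = mat (d j) (d j) (\<lambda>(r, k). path_action x (p j k) (unit_vec (d (u j k)) (s j k)) $ r)" for x j
  define U where "U = {x \<in> Rep Q d. (\<Prod>j\<in>verts Q. det (G x j)) \<noteq> 0}"
  have "polynomial_on_Rep Q d (\<lambda>x. \<Prod>j\<in>verts Q. det (G x j))"
  proof (intro polynomial_on_Rep_prod polynomial_on_Rep_det)
    fix j assume j: "j \<in> verts Q"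
    show "G x j \<in> carrier_mat (d j) (d j)" for x by (simp add: G_def)
    fix r k assume "r < d j" "k < d j"
    then show "polynomial_on_Rep Q d (\<lambda>x. G x j $$ (r, k))"
      using ps[OF j, of k] polynomial_on_Rep_path_action[of "unit_vec (d (u j k)) (s j k)" d "u j k" "p j k" r]
      by (simp add: G_def)
  qed
  then have "openin (zariski Q d) U"
    unfolding U_def by (rule zariski_open_nonvanishing)
  moreover have "x0 \<in> U"
  proof -
    have "G x0 j = 1\<^sub>m (d j)" if j: "j \<in> verts Q" for j
      using ps[OF j] by (intro eq_matI) (auto simp: G_def)
    then show ?thesis using x0 by (simp add: U_def)
  qed
  moreover have "adapted_rep Q d x (generic_dim d) (Suc n) (G x)" if "x \<in> U" for x
  proof
    show x: "x \<in> Rep Q d" using that by (simp add: U_def)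
    fix j assume j: "j \<in> verts Q"
    show "det (G x j) \<noteq> 0" using that j by (simp add: U_def)
    show "G x j \<in> carrier_mat (d j) (d j)" by (simp add: G_def)
    fix k assume k: "k < d j"
    have "path_action x (p j k) (unit_vec (d (u j k)) (s j k)) \<in> carrier_vec (d j)"
      using path_action_closed[OF x, of "u j k" "p j k"] ps[OF j k] by (metis unit_vec_carrier)
    then have "col (G x j) k = path_action x (p j k) (unit_vec (d (u j k)) (s j k))"
      using k by (intro eq_vecI) (auto simp: G_def)
    then show "\<exists>u p s. (u, p) \<in> paths Q \<and> path_target Q (u, p) = j \<and> s < d u
        \<and> col (G x j) k = path_action x p (unit_vec (d u) s)
        \<and> (\<forall>l\<le>Suc n. k < generic_dim d l j \<longrightarrow> l \<le> length p)"
      using ps[OF j k] by blast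
  qed (simp, rule generic_dim_Suc_eq, rule generic_dim_antimono)
  moreover have "U \<subseteq> Rep Q d" by (auto simp: U_def)
  ultimately show ?thesis
    by (intro exI[of _ U] exI[of _ G]) auto
qed

end

section \<open>Modules over the path algebra\<close>

lemma coordinate_isomorphism:
  fixes V :: "('k::field, 'm, 's) module_scheme"
  assumes V: "vectorspace class_ring V" and fin: "vectorspace.fin_dim class_ring V"
    and dim: "vectorspace.dim class_ring V = n"
  obtains \<phi> where "bij_betw \<phi> (carrier_vec n) (carrier V)"
    and "\<And>v v'. v \<in> carrier_vec n \<Longrightarrow> v' \<in> carrier_vec n \<Longrightarrow> \<phi> (v + v') = \<phi> v \<oplus>\<^bsub>V\<^esub> \<phi> v'"
    and "\<And>c v. v \<in> carrier_vec n \<Longrightarrow> \<phi> (c \<cdot>\<^sub>v v) = c \<odot>\<^bsub>V\<^esub> \<phi> v"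
proof -
  interpret V: vectorspace "class_ring :: 'k ring" V by (rule V)
  obtain A where A: "finite A" "V.basis A"
    using V.finite_basis_exists[OF fin] by blast
  have A_sub: "A \<subseteq> carrier V" using A(2) by (simp add: V.basis_def)
  have "card A = n" using V.dim_basis[OF A] dim by simp
  then obtain h where h: "bij_betw h A {0..<n}"
    using ex_bij_betw_finite_nat[OF A(1)] by blast
  have h_lt: "h a < n" if "a \<in> A" for a using bij_betwE[OF h] that by auto
  have crit: "\<exists>!a. a \<in> A \<rightarrow>\<^sub>E carrier (class_ring :: 'k ring) \<and> V.lincomb a A = y"
    if "y \<in> carrier V" for y
    using V.basis_criterion[OF A(1) A_sub] A(2) that by blast
  define \<phi> where "\<phi> v = V.lincomb (\<lambda>a. v $ h a) A" for v
  have \<phi>_closed: "\<phi> v \<in> carrier V" for v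
    unfolding \<phi>_def by (intro V.lincomb_closed A_sub) auto
  have \<phi>_restrict: "\<phi> v = V.lincomb (restrict (\<lambda>a. v $ h a) A) A" for v
    unfolding \<phi>_def by (intro V.lincomb_cong A_sub refl) auto
  have "inj_on \<phi> (carrier_vec n)"
  proof (rule inj_onI)
    fix v v' :: "'k vec" assume v: "v \<in> carrier_vec n" "v' \<in> carrier_vec n" and eq: "\<phi> v = \<phi> v'"
    have "restrict (\<lambda>a. v $ h a) A = restrict (\<lambda>a. v' $ h a) A"
      using crit[OF \<phi>_closed[of v]] eq \<phi>_restrict
      by (metis (mono_tags, lifting) UNIV_I class_ring_simps(1) restrict_PiE_iff)
    then have "v $ h a = v' $ h a" if "a \<in> A" for a
      using that by (metis restrict_apply')
    then show "v = v'"
      using v h by (intro eq_vecI) (auto simp: bij_betw_def, metis atLeastLessThan_iff imageE zero_le)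
  qed
  moreover have "y \<in> \<phi> ` carrier_vec n" if y: "y \<in> carrier V" for y
  proof -
    obtain a where a: "a \<in> A \<rightarrow>\<^sub>E carrier (class_ring :: 'k ring)" "V.lincomb a A = y"
      using crit[OF y] by blast
    have "vec n (\<lambda>k. a (inv_into A h k)) $ h b = a b" if "b \<in> A" for b
      using that h h_lt by (auto simp: bij_betw_def)
    then have "\<phi> (vec n (\<lambda>k. a (inv_into A h k))) = V.lincomb a A"
      unfolding \<phi>_def using a(1) by (intro V.lincomb_cong A_sub refl) auto
    then show ?thesis using a(2) by (metis image_eqI vec_carrier)
  qed
  ultimately have "bij_betw \<phi> (carrier_vec n) (carrier V)"
    using \<phi>_closed by (auto simp: bij_betw_def)
  moreover have "\<phi> (v + v') = \<phi> v \<oplus>\<^bsub>V\<^esub> \<phi> v'" if "v \<in> carrier_vec n" "v' \<in> carrier_vec n" for v v'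
  proof -
    have "\<phi> (v + v') = V.lincomb (\<lambda>a. v $ h a \<oplus>\<^bsub>class_ring\<^esub> v' $ h a) A"
      unfolding \<phi>_def using that h_lt by (intro V.lincomb_cong A_sub refl) auto
    then show ?thesis
      unfolding \<phi>_def by (subst V.lincomb_sum[symmetric]) (use A(1) A_sub in auto)
  qed
  moreover have "\<phi> (c \<cdot>\<^sub>v v) = c \<odot>\<^bsub>V\<^esub> \<phi> v" if "v \<in> carrier_vec n" for c v
  proof -
    have "\<phi> (c \<cdot>\<^sub>v v) = V.lincomb (\<lambda>a. c \<otimes>\<^bsub>class_ring\<^esub> v $ h a) A"
      unfolding \<phi>_def using that h_lt by (intro V.lincomb_cong A_sub refl) auto
    then show ?thesis
      unfolding \<phi>_def by (subst V.lincomb_smult[symmetric]) (use A_sub in auto)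
  qed
  ultimately show ?thesis by (rule that)
qed

context left_module
begin

lemma smult_zero_left: "y \<in> carrier M \<Longrightarrow> \<zero>\<^bsub>R\<^esub> \<odot>\<^bsub>M\<^esub> y = \<zero>\<^bsub>M\<^esub>"
proof -
  assume y: "y \<in> carrier M"
  have "\<zero>\<^bsub>R\<^esub> \<odot>\<^bsub>M\<^esub> y \<oplus>\<^bsub>M\<^esub> \<zero>\<^bsub>R\<^esub> \<odot>\<^bsub>M\<^esub> y = \<zero>\<^bsub>R\<^esub> \<odot>\<^bsub>M\<^esub> y"
    using smult_l_distr[of "\<zero>\<^bsub>R\<^esub>" "\<zero>\<^bsub>R\<^esub>" y] y by simp
  then show ?thesis
    using y smult_closed[of "\<zero>\<^bsub>R\<^esub>" y] M.add.r_cancel_one by simp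
qed

lemma smult_zero_right: "a \<in> carrier R \<Longrightarrow> a \<odot>\<^bsub>M\<^esub> \<zero>\<^bsub>M\<^esub> = \<zero>\<^bsub>M\<^esub>"
proof -
  assume a: "a \<in> carrier R"
  have "a \<odot>\<^bsub>M\<^esub> \<zero>\<^bsub>M\<^esub> \<oplus>\<^bsub>M\<^esub> a \<odot>\<^bsub>M\<^esub> \<zero>\<^bsub>M\<^esub> = a \<odot>\<^bsub>M\<^esub> \<zero>\<^bsub>M\<^esub>"
    using smult_r_distr[of a "\<zero>\<^bsub>M\<^esub>" "\<zero>\<^bsub>M\<^esub>"] a by simp
  then show ?thesis
    using a smult_closed[of a "\<zero>\<^bsub>M\<^esub>"] M.add.r_cancel_one by simp
qed

lemma smult_minus_one: "y \<in> carrier M \<Longrightarrow> (\<ominus>\<^bsub>R\<^esub> \<one>\<^bsub>R\<^esub>) \<odot>\<^bsub>M\<^esub> y = \<ominus>\<^bsub>M\<^esub> y"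
proof -
  assume y: "y \<in> carrier M"
  have "(\<ominus>\<^bsub>R\<^esub> \<one>\<^bsub>R\<^esub>) \<odot>\<^bsub>M\<^esub> y \<oplus>\<^bsub>M\<^esub> y = (\<ominus>\<^bsub>R\<^esub> \<one>\<^bsub>R\<^esub> \<oplus>\<^bsub>R\<^esub> \<one>\<^bsub>R\<^esub>) \<odot>\<^bsub>M\<^esub> y"
    using y smult_l_distr[of "\<ominus>\<^bsub>R\<^esub> \<one>\<^bsub>R\<^esub>" "\<one>\<^bsub>R\<^esub>" y] by (simp add: smult_one)
  also have "\<dots> = \<zero>\<^bsub>M\<^esub>"
    using y by (simp add: R.l_neg smult_zero_left)
  finally show ?thesis
    using y smult_closed by (intro M.minus_equality[symmetric]) auto
qed

lemma submoduleI:
  assumes sub: "N \<subseteq> carrier M" and zero: "\<zero>\<^bsub>M\<^esub> \<in> N"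
    and add: "\<And>x y. x \<in> N \<Longrightarrow> y \<in> N \<Longrightarrow> x \<oplus>\<^bsub>M\<^esub> y \<in> N"
    and smult: "\<And>a x. a \<in> carrier R \<Longrightarrow> x \<in> N \<Longrightarrow> a \<odot>\<^bsub>M\<^esub> x \<in> N"
  shows "Module.submodule N R M"
  unfolding Module.submodule_def Module.submodule_axioms_def
proof (intro conjI allI impI)
  show "subgroup N (add_monoid M)"
  proof (rule M.add.subgroupI)
    show "\<ominus>\<^bsub>M\<^esub> x \<in> N" if "x \<in> N" for x
      using smult[OF _ that, of "\<ominus>\<^bsub>R\<^esub> \<one>\<^bsub>R\<^esub>"] smult_minus_one[of x] that sub by auto
  qed (use assms in auto)
qed (use smult in auto)

lemma submoduleD:
  assumes "Module.submodule N R M"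
  shows "N \<subseteq> carrier M" "\<zero>\<^bsub>M\<^esub> \<in> N" "\<And>x y. x \<in> N \<Longrightarrow> y \<in> N \<Longrightarrow> x \<oplus>\<^bsub>M\<^esub> y \<in> N"
    "\<And>a x. a \<in> carrier R \<Longrightarrow> x \<in> N \<Longrightarrow> a \<odot>\<^bsub>M\<^esub> x \<in> N"
  using assms subgroup.subset[of N "add_monoid M"] subgroup.one_closed[of N "add_monoid M"]
    subgroup.m_closed[of N "add_monoid M"]
  unfolding Module.submodule_def Module.submodule_axioms_def by auto

end

context acyclic_quiver
begin

abbreviation scalar :: "'k::field \<Rightarrow> ('v, 'e) path \<Rightarrow> 'k" where
  "scalar c \<equiv> (\<lambda>r. c * \<one>\<^bsub>\<Lambda>\<^esub> r)"

lemma one_closed: "\<one>\<^bsub>\<Lambda>\<^esub> \<in> carrier (\<Lambda> :: (('v, 'e) path \<Rightarrow> 'k::field) ring)"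
proof -
  interpret R: ring "\<Lambda> :: (('v, 'e) path \<Rightarrow> 'k) ring" by (rule ring_path_algebra)
  show ?thesis by (rule R.one_closed)
qed

lemma scaled_closed:
  assumes "a \<in> carrier \<Lambda>" shows "(\<lambda>r. c * a r) \<in> carrier (\<Lambda> :: (('v, 'e) path \<Rightarrow> 'k::field) ring)"
proof -
  have "{r. c * a r \<noteq> 0} \<subseteq> {r. a r \<noteq> 0}" by auto
  then show ?thesis using assms by (auto simp: path_algebra_carrier_iff finite_subset)
qed

lemma scalar_closed: "scalar c \<in> carrier \<Lambda>"
  using scaled_closed[OF one_closed] .

lemma scalar_mult:
  assumes "a \<in> carrier \<Lambda>"
  shows "scalar c \<otimes>\<^bsub>\<Lambda>\<^esub> a = (\<lambda>r. c * a r)"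
proof (rule ext, clarify)
  interpret R: ring "\<Lambda> :: (('v, 'e) path \<Rightarrow> 'a) ring" by (rule ring_path_algebra)
  fix u p
  have "(scalar c \<otimes>\<^bsub>\<Lambda>\<^esub> a) (u, p) = c * (\<one>\<^bsub>\<Lambda>\<^esub> \<otimes>\<^bsub>\<Lambda>\<^esub> a) (u, p)"
    unfolding path_algebra_mult by (simp add: sum_distrib_left mult.assoc)
  then show "(scalar c \<otimes>\<^bsub>\<Lambda>\<^esub> a) (u, p) = c * a (u, p)"
    by (simp only: R.l_one[OF assms])
qed

end

locale path_algebra_module = acyclic_quiver Q + S: left_module "path_algebra Q" S
  for Q :: "('v, 'e) pre_digraph" and S :: "(('v, 'e) path \<Rightarrow> 'k::field, 'm) module"
begin

abbreviation e :: "'v \<Rightarrow> ('v, 'e) path \<Rightarrow> 'k" where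
  "e i \<equiv> path_monomial 1 (i, [])"

abbreviation V :: "('k, 'm) module" where
  "V \<equiv> underlying_space Q S"

definition component :: "'v \<Rightarrow> 'm set" where
  "component i = (\<lambda>y. e i \<odot>\<^bsub>S\<^esub> y) ` carrier S"

lemma V_simps [simp]:
  "carrier V = carrier S" "zero V = zero S" "add V = add S" "c \<odot>\<^bsub>V\<^esub> y = scalar c \<odot>\<^bsub>S\<^esub> y"
  by (simp_all add: underlying_space_def)

lemma scalar_smult:
  assumes "a \<in> carrier \<Lambda>" "y \<in> carrier S"
  shows "scalar c \<odot>\<^bsub>S\<^esub> (a \<odot>\<^bsub>S\<^esub> y) = (\<lambda>r. c * a r) \<odot>\<^bsub>S\<^esub> y"
  using assms S.smult_assoc1[OF scalar_closed assms(1,2)] by (simp only: scalar_mult)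

lemma smult_scalar_commute:
  assumes a: "a \<in> carrier \<Lambda>" and y: "y \<in> carrier S"
  shows "a \<odot>\<^bsub>S\<^esub> (scalar c \<odot>\<^bsub>S\<^esub> y) = scalar c \<odot>\<^bsub>S\<^esub> (a \<odot>\<^bsub>S\<^esub> y)"
proof -
  have *: "a \<otimes>\<^bsub>\<Lambda>\<^esub> scalar c = (\<lambda>r. c * a r)"
  proof (rule ext, clarify)
    fix u p
    have "(a \<otimes>\<^bsub>\<Lambda>\<^esub> scalar c) (u, p) = c * (a \<otimes>\<^bsub>\<Lambda>\<^esub> \<one>\<^bsub>\<Lambda>\<^esub>) (u, p)"
      unfolding path_algebra_mult by (simp add: sum_distrib_left mult.left_commute)
    then show "(a \<otimes>\<^bsub>\<Lambda>\<^esub> scalar c) (u, p) = c * a (u, p)"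
      by (simp only: S.R.r_one[OF a])
  qed
  show ?thesis
    unfolding scalar_smult[OF a y] S.smult_assoc1[OF a scalar_closed y, symmetric] * ..
qed

lemma vectorspace_V: "vectorspace class_ring V"
proof (rule vs_criteria, unfold V_simps)
  show "field (class_ring :: 'k ring)" by (rule class_field)
  show "\<forall>v\<in>carrier S. \<exists>neg_v\<in>carrier S. v \<oplus>\<^bsub>S\<^esub> neg_v = \<zero>\<^bsub>S\<^esub>"
    using S.M.r_neg S.M.a_inv_closed by blast
  show "\<forall>c v. c \<in> carrier class_ring \<and> v \<in> carrier S \<longrightarrow> scalar c \<odot>\<^bsub>S\<^esub> v \<in> carrier S"
    using S.smult_closed[OF scalar_closed] by blast
  show "\<forall>a b v. a \<in> carrier class_ring \<and> b \<in> carrier class_ring \<and> v \<in> carrier S \<longrightarrow>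
    scalar (a \<otimes>\<^bsub>class_ring\<^esub> b) \<odot>\<^bsub>S\<^esub> v = scalar a \<odot>\<^bsub>S\<^esub> (scalar b \<odot>\<^bsub>S\<^esub> v)"
    using scalar_smult[OF scalar_closed] by (simp only: class_ring_simps mult.assoc) simp
  show "\<forall>v\<in>carrier S. scalar \<one>\<^bsub>class_ring\<^esub> \<odot>\<^bsub>S\<^esub> v = v"
    using S.smult_one by (simp only: class_ring_simps mult_1_left) simp
  show "\<forall>a b v. a \<in> carrier class_ring \<and> b \<in> carrier class_ring \<and> v \<in> carrier S \<longrightarrow>
    scalar (a \<oplus>\<^bsub>class_ring\<^esub> b) \<odot>\<^bsub>S\<^esub> v = scalar a \<odot>\<^bsub>S\<^esub> v \<oplus>\<^bsub>S\<^esub> scalar b \<odot>\<^bsub>S\<^esub> v"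
  proof (intro allI impI)
    fix a b :: 'k and v
    assume "a \<in> carrier class_ring \<and> b \<in> carrier class_ring \<and> v \<in> carrier S"
    then have v: "v \<in> carrier S" by blast
    have "scalar (a \<oplus>\<^bsub>class_ring\<^esub> b) = scalar a \<oplus>\<^bsub>\<Lambda>\<^esub> scalar b"
      by (simp only: class_ring_simps path_algebra_simps(3) distrib_right)
    then show "scalar (a \<oplus>\<^bsub>class_ring\<^esub> b) \<odot>\<^bsub>S\<^esub> v = scalar a \<odot>\<^bsub>S\<^esub> v \<oplus>\<^bsub>S\<^esub> scalar b \<odot>\<^bsub>S\<^esub> v"
      using S.smult_l_distr[OF scalar_closed scalar_closed v] by (simp only:)
  qed
  show "\<forall>a v w. a \<in> carrier class_ring \<and> v \<in> carrier S \<and> w \<in> carrier S \<longrightarrow>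
    scalar a \<odot>\<^bsub>S\<^esub> (v \<oplus>\<^bsub>S\<^esub> w) = scalar a \<odot>\<^bsub>S\<^esub> v \<oplus>\<^bsub>S\<^esub> scalar a \<odot>\<^bsub>S\<^esub> w"
    using S.smult_r_distr[OF scalar_closed] by blast
qed (auto intro: S.M.a_comm S.M.a_assoc)

lemma e_closed: "i \<in> verts Q \<Longrightarrow> e i \<in> carrier \<Lambda>"
  by simp

lemma e_mult:
  assumes "i \<in> verts Q" "y \<in> carrier S" and j: "j \<in> verts Q"
  shows "e j \<odot>\<^bsub>S\<^esub> (e i \<odot>\<^bsub>S\<^esub> y) = (if j = i then e i \<odot>\<^bsub>S\<^esub> y else \<zero>\<^bsub>S\<^esub>)"
proof -
  have "(e j \<otimes>\<^bsub>\<Lambda>\<^esub> e i :: ('v, 'e) path \<Rightarrow> 'k) = (if j = i then e i else (\<lambda>_. 0))"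
  proof (cases "j = i")
    case True
    then show ?thesis
      using path_monomial_append[of "1 :: 'k" i "[]" "[]"] by simp
  next
    case False
    have "(e j \<otimes>\<^bsub>\<Lambda>\<^esub> e i :: ('v, 'e) path \<Rightarrow> 'k) (u, p) = 0" for u p
      unfolding path_algebra_mult using False by (intro sum.neutral) auto
    then show ?thesis using False by auto
  qed
  then have "(if j = i then e i else (\<lambda>_. 0)) \<odot>\<^bsub>S\<^esub> y = e j \<odot>\<^bsub>S\<^esub> (e i \<odot>\<^bsub>S\<^esub> y)"
    using S.smult_assoc1[OF e_closed[OF j] e_closed[OF assms(1)] assms(2)] by (simp only:)
  then show ?thesis
    using S.smult_zero_left[OF assms(2)] by (simp split: if_splits)
qed

lemma component_iff:
  assumes "i \<in> verts Q"
  shows "y \<in> component i \<longleftrightarrow> y \<in> carrier S \<and> e i \<odot>\<^bsub>S\<^esub> y = y"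
proof
  assume "y \<in> component i"
  then obtain z where "z \<in> carrier S" "y = e i \<odot>\<^bsub>S\<^esub> z"
    by (auto simp: component_def)
  then show "y \<in> carrier S \<and> e i \<odot>\<^bsub>S\<^esub> y = y"
    using e_mult[OF assms _ assms] S.smult_closed[OF e_closed[OF assms]] by simp
next
  assume "y \<in> carrier S \<and> e i \<odot>\<^bsub>S\<^esub> y = y"
  then show "y \<in> component i"
    unfolding component_def by (metis image_eqI)
qed

lemma component_space:
  assumes i: "i \<in> verts Q"
  shows "vectorspace class_ring (V\<lparr>carrier := component i\<rparr>)"
proof -
  interpret V: vectorspace class_ring V by (rule vectorspace_V)
  have "subspace class_ring (component i) V"
  proof (intro subspace.intro vectorspace_V LinearCombinations.submodule.intro)
    show "module class_ring V" by (rule V.module_axioms)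
    show "component i \<subseteq> carrier V" by (auto simp: component_iff[OF i])
    show "\<zero>\<^bsub>V\<^esub> \<in> component i"
      using S.smult_zero_right[OF e_closed[OF i]] by (simp add: component_iff[OF i])
    show "v \<oplus>\<^bsub>V\<^esub> w \<in> component i" if "v \<in> component i" "w \<in> component i" for v w
      using that S.smult_r_distr[OF e_closed[OF i]] by (simp add: component_iff[OF i])
    show "c \<odot>\<^bsub>V\<^esub> v \<in> component i" if "v \<in> component i" for c v
      using that smult_scalar_commute[OF e_closed[OF i]] S.smult_closed[OF scalar_closed]
      unfolding component_iff[OF i] V_simps by (simp only: simp_thms)
  qed
  then show ?thesis by (rule V.subspace_is_vs)
qed

lemma dimension_vector_eq: "dimension_vector Q S i = vectorspace.dim class_ring (V\<lparr>carrier := component i\<rparr>)"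
  by (simp add: dimension_vector_def component_def vertex_idempotent_eq)

lemma fin_dim_component:
  assumes i: "i \<in> verts Q" and fin: "finite_dimensional Q S"
  shows "vectorspace.fin_dim class_ring (V\<lparr>carrier := component i\<rparr>)"
proof -
  have "linear_map class_ring V (V\<lparr>carrier := component i\<rparr>) (\<lambda>y. e i \<odot>\<^bsub>S\<^esub> y)"
    unfolding linear_map_def mod_hom_def mod_hom_axioms_def LinearCombinations.module_hom_def
    using vectorspace_V component_space[OF i] vectorspace.axioms(1)[OF vectorspace_V]
      vectorspace.axioms(1)[OF component_space[OF i]]
      S.smult_r_distr[OF e_closed[OF i]] smult_scalar_commute[OF e_closed[OF i]]
    by (auto simp: component_def)
  then show ?thesis
    using fin by (rule_tac linear_map.surj_fin_dim)
      (auto simp: finite_dimensional_def component_def)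
qed

lemma sum_of_components:
  assumes "finite X" "X \<subseteq> verts Q" and y: "y \<in> carrier S"
  shows "(\<Oplus>\<^bsub>S\<^esub>i\<in>X. e i \<odot>\<^bsub>S\<^esub> y) = (\<lambda>(u, p). if u \<in> X \<and> p = [] then 1 else 0) \<odot>\<^bsub>S\<^esub> y"
  using assms(1,2)
proof (induction X rule: finite_induct)
  case empty
  have "(\<lambda>(u, p). if u \<in> {} \<and> p = [] then 1 else 0) = (\<zero>\<^bsub>\<Lambda>\<^esub> :: ('v, 'e) path \<Rightarrow> 'k)"
    by auto
  then show ?case using S.smult_zero_left[OF y] by (simp only: S.M.finsum_empty)
next
  case (insert i X)
  let ?id = "\<lambda>X. (\<lambda>(u, p). if u \<in> X \<and> p = [] then 1 else 0) :: ('v, 'e) path \<Rightarrow> 'k"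
  have i: "i \<in> verts Q" using insert by blast
  have "{r. ?id X r \<noteq> 0} \<subseteq> (\<lambda>u. (u, [])) ` X" by (auto split: if_splits)
  then have X: "?id X \<in> carrier \<Lambda>"
    using insert by (auto simp: path_algebra_carrier_iff intro: finite_subset)
  have closed: "e j \<odot>\<^bsub>S\<^esub> y \<in> carrier S" if "j \<in> verts Q" for j
    using S.smult_closed[OF e_closed[OF that] y] .
  have "(\<Oplus>\<^bsub>S\<^esub>i\<in>insert i X. e i \<odot>\<^bsub>S\<^esub> y) = e i \<odot>\<^bsub>S\<^esub> y \<oplus>\<^bsub>S\<^esub> (\<Oplus>\<^bsub>S\<^esub>i\<in>X. e i \<odot>\<^bsub>S\<^esub> y)"
    using insert closed by (intro S.M.finsum_insert) auto
  also have "\<dots> = e i \<odot>\<^bsub>S\<^esub> y \<oplus>\<^bsub>S\<^esub> ?id X \<odot>\<^bsub>S\<^esub> y"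
    using insert.IH insert.prems by (simp only: insert_subset simp_thms)
  also have "\<dots> = (e i \<oplus>\<^bsub>\<Lambda>\<^esub> ?id X) \<odot>\<^bsub>S\<^esub> y"
    using S.smult_l_distr[OF e_closed[OF i] X y] by simp
  also have "e i \<oplus>\<^bsub>\<Lambda>\<^esub> ?id X = ?id (insert i X)"
    using insert.hyps by (auto simp: fun_eq_iff)
  finally show ?case .
qed

lemma ideal_smult_filtration_zero:
  "(\<zero>\<^bsub>S\<^esub>) \<in> ideal_smult (path_filtration k) S"
proof -
  have "(\<lambda>_. 0 :: 'k) \<in> path_filtration k"
    by (simp add: path_filtration_def path_algebra_carrier_iff)
  then show ?thesis
    using ideal_smult.prod[of "\<lambda>_. 0" "path_filtration k" "\<zero>\<^bsub>S\<^esub>" S]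
      S.smult_zero_left[of "\<zero>\<^bsub>S\<^esub>"] by simp
qed

lemma ideal_smult_filtration_closed:
  "y \<in> ideal_smult (path_filtration k) S \<Longrightarrow> y \<in> carrier S"
proof (induction rule: ideal_smult.induct)
  case (prod a y)
  then have "a \<in> carrier \<Lambda>" using path_filtration_subset by blast
  then show ?case using prod(2) by (rule S.smult_closed)
qed simp

lemma smult_ideal_smult_filtration:
  assumes a: "a \<in> path_filtration l"
  shows "y \<in> ideal_smult (path_filtration k) S \<Longrightarrow> a \<odot>\<^bsub>S\<^esub> y \<in> ideal_smult (path_filtration (l + k)) S"
proof (induction rule: ideal_smult.induct)
  case (prod b y)
  have "(a \<otimes>\<^bsub>\<Lambda>\<^esub> b) \<odot>\<^bsub>S\<^esub> y \<in> ideal_smult (path_filtration (l + k)) S"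
    using path_filtration_mult[OF a prod(1)] prod(2) by (rule ideal_smult.prod)
  moreover have "a \<in> carrier \<Lambda>" "b \<in> carrier \<Lambda>"
    using a prod(1) path_filtration_subset by blast+
  ultimately show ?case
    using S.smult_assoc1 prod(2) by simp
next
  case (sum y z)
  have "a \<in> carrier \<Lambda>" using a path_filtration_subset by blast
  then show ?case
    using sum ideal_smult_filtration_closed S.smult_r_distr ideal_smult.sum by metis
qed

lemma ideal_smult_submodule: "Module.submodule (ideal_smult (path_filtration k) S) \<Lambda> S"
proof (rule S.submoduleI)
  show "a \<odot>\<^bsub>S\<^esub> y \<in> ideal_smult (path_filtration k) S"
    if "a \<in> carrier \<Lambda>" "y \<in> ideal_smult (path_filtration k) S" for a y
    using smult_ideal_smult_filtration[of a 0 y k] that by (simp add: path_filtration_0)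
qed (use ideal_smult_filtration_closed ideal_smult_filtration_zero ideal_smult.sum in auto)

text \<open>
  Let \<open>A\<close> be the ideal of the paths of positive length, and let \<open>N'\<close>
  be a complement of \<open>A S\<close>. Then \<open>A N' \<subseteq> A S \<inter> N' =
  0\<close>, so \<open>A S = A (A S)\<close>, and the nilpotency of \<open>A\<close> implies
  \<open>A S = 0\<close>.
\<close>

lemma semisimple_arrows_vanish:
  assumes ss: "semisimple_module \<Lambda> S" and a: "a \<in> path_filtration 1" and y: "y \<in> carrier S"
  shows "a \<odot>\<^bsub>S\<^esub> y = \<zero>\<^bsub>S\<^esub>"
proof -
  let ?N = "\<lambda>k. ideal_smult (path_filtration k) S"
  obtain N' where N': "Module.submodule N' \<Lambda> S" "?N 1 \<inter> N' = {\<zero>\<^bsub>S\<^esub>}" "?N 1 <+>\<^bsub>S\<^esub> N' = carrier S"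
    using ss ideal_smult_submodule[of 1] unfolding semisimple_module_def by blast
  note N'_closed = S.submoduleD[OF N'(1)]
  have split: "\<exists>u\<in>?N 1. b \<odot>\<^bsub>S\<^esub> z = b \<odot>\<^bsub>S\<^esub> u" if b: "b \<in> path_filtration 1" and z: "z \<in> carrier S" for b z
  proof -
    have bc: "b \<in> carrier \<Lambda>" using b path_filtration_subset by blast
    obtain u v where uv: "u \<in> ?N 1" "v \<in> N'" "z = u \<oplus>\<^bsub>S\<^esub> v"
      using z N'(3) unfolding set_add_def' by blast
    have vc: "v \<in> carrier S" using uv(2) N'_closed(1) by blast
    have uc: "u \<in> carrier S" using uv(1) by (rule ideal_smult_filtration_closed)
    have "b \<odot>\<^bsub>S\<^esub> v \<in> ?N 1" using b vc by (rule ideal_smult.prod)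
    moreover have "b \<odot>\<^bsub>S\<^esub> v \<in> N'" using bc uv(2) by (rule N'_closed(4))
    ultimately have "b \<odot>\<^bsub>S\<^esub> v = \<zero>\<^bsub>S\<^esub>" using N'(2) by blast
    then have "b \<odot>\<^bsub>S\<^esub> z = b \<odot>\<^bsub>S\<^esub> u"
      unfolding uv(3) using S.smult_r_distr[OF bc uc vc] S.smult_closed[OF bc uc] by simp
    then show ?thesis using uv(1) by blast
  qed
  have "?N 1 \<subseteq> ?N (Suc k)" for k
  proof (induction k)
    case (Suc k)
    show ?case
    proof
      fix x assume "x \<in> ?N 1"
      then show "x \<in> ?N (Suc (Suc k))"
      proof (induction rule: ideal_smult.induct)
        case (prod b z)
        obtain u where u: "u \<in> ?N 1" "b \<odot>\<^bsub>S\<^esub> z = b \<odot>\<^bsub>S\<^esub> u"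
          using split[OF prod] by blast
        have "b \<odot>\<^bsub>S\<^esub> u \<in> ?N (1 + Suc k)"
          using Suc.IH u(1) by (intro smult_ideal_smult_filtration[OF prod(1)]) blast
        then show ?case using u(2) by simp
      qed (rule ideal_smult.sum)
    qed
  qed simp
  from this[of "card (verts Q)"] have "?N 1 \<subseteq> ?N (card (verts Q) + 1)" by simp
  moreover have "x = \<zero>\<^bsub>S\<^esub>" if "x \<in> ?N (card (verts Q) + 1)" for x
    using that
  proof (induction rule: ideal_smult.induct)
    case (prod b z)
    have "b \<in> path_filtration (card (verts Q))"
      using prod(1) by (auto simp: path_filtration_def)
    then have "b = (\<lambda>_. 0)" by (simp add: path_filtration_trivial)
    then show ?case using S.smult_zero_left[OF prod(2)] by simp
  qed simp
  moreover have "a \<odot>\<^bsub>S\<^esub> y \<in> ?N 1" using a y by (rule ideal_smult.prod)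
  ultimately show ?thesis by blast
qed

text \<open>
  The product of \<open>a\<close> with the idempotent at \<open>i\<close> is \<open>a (i,
  [])\<close> times this idempotent, up to paths of positive length.
\<close>

lemma smult_component:
  assumes vanish: "\<And>a y. a \<in> path_filtration 1 \<Longrightarrow> y \<in> carrier S \<Longrightarrow> a \<odot>\<^bsub>S\<^esub> y = \<zero>\<^bsub>S\<^esub>"
    and i: "i \<in> verts Q" and a: "a \<in> carrier \<Lambda>" and y: "y \<in> component i"
  shows "a \<odot>\<^bsub>S\<^esub> y = scalar (a (i, [])) \<odot>\<^bsub>S\<^esub> y"
proof -
  have yc: "y \<in> carrier S" and ey: "e i \<odot>\<^bsub>S\<^esub> y = y"
    using y by (auto simp: component_iff[OF i])
  define b where "b = (\<lambda>(u, p). if u = i \<and> p \<noteq> [] then a (u, p) else 0)"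
  have "{r. b r \<noteq> 0} \<subseteq> {r. a r \<noteq> 0}"
    by (auto simp: b_def split: if_splits)
  then have b: "b \<in> path_filtration 1"
    using a by (auto simp: path_filtration_def path_algebra_carrier_iff finite_subset b_def)
  then have bc: "b \<in> carrier \<Lambda>" using path_filtration_subset by blast
  let ?c = "\<lambda>r. a (i, []) * e i r"
  have c: "?c \<in> carrier \<Lambda>" using scaled_closed[OF e_closed[OF i]] .
  have "a \<otimes>\<^bsub>\<Lambda>\<^esub> e i = b \<oplus>\<^bsub>\<Lambda>\<^esub> ?c"
  proof (rule ext, clarify)
    fix u :: 'v and p :: "'e list"
    have "(a \<otimes>\<^bsub>\<Lambda>\<^esub> e i) (u, p) = (\<Sum>k\<le>length p. if k = 0 then (if u = i then a (u, p) else 0) else 0)"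
      unfolding path_algebra_mult by (intro sum.cong refl) auto
    also have "\<dots> = (if u = i then a (u, p) else 0)" by simp
    also have "\<dots> = (b \<oplus>\<^bsub>\<Lambda>\<^esub> ?c) (u, p)" by (simp add: b_def)
    finally show "(a \<otimes>\<^bsub>\<Lambda>\<^esub> e i) (u, p) = (b \<oplus>\<^bsub>\<Lambda>\<^esub> ?c) (u, p)" .
  qed
  then have "a \<odot>\<^bsub>S\<^esub> (e i \<odot>\<^bsub>S\<^esub> y) = b \<odot>\<^bsub>S\<^esub> y \<oplus>\<^bsub>S\<^esub> ?c \<odot>\<^bsub>S\<^esub> y"
    using S.smult_assoc1[OF a e_closed[OF i] yc] S.smult_l_distr[OF bc c yc] by simp
  also have "\<dots> = scalar (a (i, [])) \<odot>\<^bsub>S\<^esub> (e i \<odot>\<^bsub>S\<^esub> y)"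
    using vanish[OF b yc] scalar_smult[OF e_closed[OF i] yc] S.smult_closed[OF c yc] by simp
  finally show ?thesis by (simp only: ey)
qed

lemma smult_finsum:
  assumes a: "a \<in> carrier \<Lambda>" and "finite X" "\<And>i. i \<in> X \<Longrightarrow> f i \<in> carrier S"
  shows "a \<odot>\<^bsub>S\<^esub> (\<Oplus>\<^bsub>S\<^esub>i\<in>X. f i) = (\<Oplus>\<^bsub>S\<^esub>i\<in>X. a \<odot>\<^bsub>S\<^esub> f i)"
  using assms(2,3)
proof (induction X rule: finite_induct)
  case empty
  then show ?case using S.smult_zero_right[OF a] by simp
next
  case (insert i X)
  have "(\<Oplus>\<^bsub>S\<^esub>i\<in>X. f i) \<in> carrier S" using insert by (intro S.M.finsum_closed) auto
  then show ?case
    using insert S.smult_closed[OF a] S.smult_r_distr[OF a]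
    by (simp add: S.M.finsum_insert Pi_def)
qed

text \<open>
  Bases of the components at the vertices yield an isomorphism of vector spaces, which is
  compatible with the action because only trivial paths act nontrivially.
\<close>

theorem semisimple_module_iso_vertex_module:
  assumes ss: "semisimple_module \<Lambda> S" and fin: "finite_dimensional Q S"
    and dim: "\<And>i. i \<in> verts Q \<Longrightarrow> dimension_vector Q S i = n i"
  shows "module_iso \<Lambda> (vertex_module Q n) S"
proof -
  let ?E = "vertex_module Q n :: (('v, 'e) path \<Rightarrow> 'k, 'v \<Rightarrow> 'k vec) module"
  let ?C = "\<lambda>i. V\<lparr>carrier := component i\<rparr>"
  have "\<exists>\<phi>. bij_betw \<phi> (carrier_vec (n i)) (component i)
      \<and> (\<forall>v v'. v \<in> carrier_vec (n i) \<longrightarrow> v' \<in> carrier_vec (n i) \<longrightarrow> \<phi> (v + v') = \<phi> v \<oplus>\<^bsub>S\<^esub> \<phi> v')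
      \<and> (\<forall>c v. v \<in> carrier_vec (n i) \<longrightarrow> \<phi> (c \<cdot>\<^sub>v v) = scalar c \<odot>\<^bsub>S\<^esub> \<phi> v)" if i: "i \<in> verts Q" for i
  proof -
    obtain \<phi> where "bij_betw \<phi> (carrier_vec (n i)) (carrier (?C i))"
      "\<And>v v'. v \<in> carrier_vec (n i) \<Longrightarrow> v' \<in> carrier_vec (n i) \<Longrightarrow> \<phi> (v + v') = \<phi> v \<oplus>\<^bsub>?C i\<^esub> \<phi> v'"
      "\<And>c v. v \<in> carrier_vec (n i) \<Longrightarrow> \<phi> (c \<cdot>\<^sub>v v) = c \<odot>\<^bsub>?C i\<^esub> \<phi> v"
      using coordinate_isomorphism[OF component_space[OF i] fin_dim_component[OF i fin], of "n i"]
        dim[OF i] by (metis dimension_vector_eq)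
    then show ?thesis by (intro exI[of _ \<phi>]) (simp add: V_simps)
  qed
  then obtain \<phi> where bij: "\<And>i. i \<in> verts Q \<Longrightarrow> bij_betw (\<phi> i) (carrier_vec (n i)) (component i)"
    and \<phi>_add: "\<And>i v v'. i \<in> verts Q \<Longrightarrow> v \<in> carrier_vec (n i) \<Longrightarrow> v' \<in> carrier_vec (n i) \<Longrightarrow>
      \<phi> i (v + v') = \<phi> i v \<oplus>\<^bsub>S\<^esub> \<phi> i v'"
    and \<phi>_smult: "\<And>i c v. i \<in> verts Q \<Longrightarrow> v \<in> carrier_vec (n i) \<Longrightarrow> \<phi> i (c \<cdot>\<^sub>v v) = scalar c \<odot>\<^bsub>S\<^esub> \<phi> i v"
    by metis
  have \<phi>_comp: "\<phi> i v \<in> component i" if "i \<in> verts Q" "v \<in> carrier_vec (n i)" for i v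
    using bij_betwE[OF bij] that by blast
  have comp_carrier: "y \<in> carrier S" if "y \<in> component i" "i \<in> verts Q" for y i
    using that component_iff by blast
  have E: "m i \<in> carrier_vec (n i)" if "m \<in> carrier ?E" "i \<in> verts Q" for m i
    using that by (auto simp: vertex_module_def)
  define f where "f m = (\<Oplus>\<^bsub>S\<^esub>i\<in>verts Q. \<phi> i (m i))" for m
  have summand: "\<phi> i (m i) \<in> carrier S" if "m \<in> carrier ?E" "i \<in> verts Q" for m i
    using comp_carrier[OF \<phi>_comp[OF that(2) E[OF that]] that(2)] .
  have f_closed: "f m \<in> carrier S" if "m \<in> carrier ?E" for m
    unfolding f_def using summand[OF that] by (intro S.M.finsum_closed) auto
  have f_comp: "e j \<odot>\<^bsub>S\<^esub> f m = \<phi> j (m j)" if m: "m \<in> carrier ?E" and j: "j \<in> verts Q" for m j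
  proof -
    have "e j \<odot>\<^bsub>S\<^esub> \<phi> i (m i) = (if j = i then \<phi> i (m i) else \<zero>\<^bsub>S\<^esub>)" if i: "i \<in> verts Q" for i
      using e_mult[OF i summand[OF m i] j] \<phi>_comp[OF i E[OF m i]] component_iff[OF i] by simp
    then have "e j \<odot>\<^bsub>S\<^esub> f m = (\<Oplus>\<^bsub>S\<^esub>i\<in>verts Q. if j = i then \<phi> i (m i) else \<zero>\<^bsub>S\<^esub>)"
      unfolding f_def using smult_finsum[OF e_closed[OF j] finite_verts] summand[OF m]
      by (simp cong: S.M.finsum_cong)
    also have "\<dots> = \<phi> j (m j)"
      using summand[OF m] j by (intro S.M.finsum_singleton) auto
    finally show ?thesis .
  qed
  have "f \<in> LinearCombinations.module_hom \<Lambda> ?E S"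
    unfolding LinearCombinations.module_hom_def
  proof (intro CollectI conjI allI impI)
    show "f \<in> carrier ?E \<rightarrow> carrier S" using f_closed by blast
    fix m m' assume "m \<in> carrier ?E \<and> m' \<in> carrier ?E"
    then have m: "m \<in> carrier ?E" "m' \<in> carrier ?E" by auto
    have "f (m \<oplus>\<^bsub>?E\<^esub> m') = (\<Oplus>\<^bsub>S\<^esub>i\<in>verts Q. \<phi> i (m i) \<oplus>\<^bsub>S\<^esub> \<phi> i (m' i))"
      unfolding f_def using \<phi>_add E[OF m(1)] E[OF m(2)] summand[OF m(1)] summand[OF m(2)]
      by (intro S.M.finsum_cong') (auto simp: vertex_module_def)
    then show "f (m \<oplus>\<^bsub>?E\<^esub> m') = f m \<oplus>\<^bsub>S\<^esub> f m'"
      unfolding f_def using summand[OF m(1)] summand[OF m(2)] by (simp add: S.M.finsum_addf Pi_def)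
  next
    fix a :: "('v, 'e) path \<Rightarrow> 'k" and m
    assume "a \<in> carrier \<Lambda> \<and> m \<in> carrier ?E"
    then have a: "a \<in> carrier \<Lambda>" and m: "m \<in> carrier ?E" by auto
    have "a \<odot>\<^bsub>S\<^esub> f m = (\<Oplus>\<^bsub>S\<^esub>i\<in>verts Q. a \<odot>\<^bsub>S\<^esub> \<phi> i (m i))"
      unfolding f_def by (rule smult_finsum[OF a finite_verts summand[OF m]])
    also have "\<dots> = f (a \<odot>\<^bsub>?E\<^esub> m)"
      unfolding f_def
    proof (intro S.M.finsum_cong' refl)
      show "(\<lambda>i. \<phi> i ((a \<odot>\<^bsub>?E\<^esub> m) i)) \<in> verts Q \<rightarrow> carrier S"
        using summand m by simp
      fix i assume i: "i \<in> verts Q"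
      have "a \<odot>\<^bsub>S\<^esub> \<phi> i (m i) = scalar (a (i, [])) \<odot>\<^bsub>S\<^esub> \<phi> i (m i)"
        using semisimple_arrows_vanish[OF ss] i a \<phi>_comp[OF i E[OF m i]] by (rule smult_component)
      then show "a \<odot>\<^bsub>S\<^esub> \<phi> i (m i) = \<phi> i ((a \<odot>\<^bsub>?E\<^esub> m) i)"
        using \<phi>_smult[OF i E[OF m i]] i by (simp add: vertex_module_def)
    qed
    finally show "f (a \<odot>\<^bsub>?E\<^esub> m) = a \<odot>\<^bsub>S\<^esub> f m" by simp
  qed
  moreover have "bij_betw f (carrier ?E) (carrier S)"
    unfolding bij_betw_def
  proof
    show "inj_on f (carrier ?E)"
    proof (rule inj_onI)
      fix m m' assume m: "m \<in> carrier ?E" "m' \<in> carrier ?E" and eq: "f m = f m'"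
      have "m i = m' i" if i: "i \<in> verts Q" for i
      proof -
        have "\<phi> i (m i) = \<phi> i (m' i)"
          using f_comp[OF m(1) i] f_comp[OF m(2) i] eq by simp
        then show ?thesis
          using bij_betw_imp_inj_on[OF bij[OF i]] E[OF m(1) i] E[OF m(2) i] by (simp add: inj_on_def)
      qed
      then show "m = m'"
        using m PiE_ext[of m "verts Q" "\<lambda>i. carrier_vec (n i)" m'] by (simp add: vertex_module_def)
    qed
    have "y \<in> f ` carrier ?E" if y: "y \<in> carrier S" for y
    proof
      let ?m = "\<lambda>i\<in>verts Q. inv_into (carrier_vec (n i)) (\<phi> i) (e i \<odot>\<^bsub>S\<^esub> y)"
      have comp: "e i \<odot>\<^bsub>S\<^esub> y \<in> component i" for i
        using y by (auto simp: component_def)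
      have m: "?m i \<in> carrier_vec (n i)" "\<phi> i (?m i) = e i \<odot>\<^bsub>S\<^esub> y" if i: "i \<in> verts Q" for i
        using bij[OF i] comp[of i] i
        by (auto simp: bij_betw_def intro!: inv_into_into f_inv_into_f)
      show "?m \<in> carrier ?E" using m(1) by (auto simp: vertex_module_def)
      have "f ?m = (\<Oplus>\<^bsub>S\<^esub>i\<in>verts Q. e i \<odot>\<^bsub>S\<^esub> y)"
        unfolding f_def using m(2) S.smult_closed[OF e_closed y] by (intro S.M.finsum_cong') auto
      also have "\<dots> = \<one>\<^bsub>\<Lambda>\<^esub> \<odot>\<^bsub>S\<^esub> y"
        using sum_of_components[OF finite_verts subset_refl y] by simp
      also have "\<dots> = y" using y by (rule S.smult_one)
      finally show "y = f ?m" by simp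
    qed
    then show "f ` carrier ?E = carrier S" using f_closed by blast
  qed
  ultimately show ?thesis unfolding module_iso_def by blast
qed

end

context acyclic_quiver
begin

definition supported_on :: "('v \<Rightarrow> nat) \<Rightarrow> ('v \<times> nat) set \<Rightarrow> ('v \<Rightarrow> 'k::field vec) set" where
  "supported_on n P = {m \<in> (\<Pi>\<^sub>E i\<in>verts Q. carrier_vec (n i)).
     \<forall>i\<in>verts Q. \<forall>k<n i. (i, k) \<notin> P \<longrightarrow> m i $ k = 0}"

text \<open>
  As in the exchange lemma, a complement of \<open>N\<close> can be spanned by unit vectors,
  which makes it a submodule. Let \<open>P\<close> be a maximal set of coordinates such that
  \<open>N\<close> contains no nonzero element supported on \<open>P\<close>. If
  \<open>m\<close> has a nonzero coordinate outside of \<open>P\<close>, then by maximality some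
  element of \<open>N\<close> has a nonzero value there and no other coordinates outside of
  \<open>P\<close>. Subtracting a multiple of it from \<open>m\<close> reduces the number of
  nonzero coordinates of \<open>m\<close> outside of \<open>P\<close>.
\<close>

lemma supported_on_complement:
  fixes N :: "('v \<Rightarrow> 'k::field vec) set"
  assumes sub: "N \<subseteq> (\<Pi>\<^sub>E i\<in>verts Q. carrier_vec (n i))"
    and zero: "(\<lambda>i\<in>verts Q. 0\<^sub>v (n i)) \<in> N"
    and add: "\<And>y z. y \<in> N \<Longrightarrow> z \<in> N \<Longrightarrow> (\<lambda>i\<in>verts Q. y i + z i) \<in> N"
    and smult: "\<And>c y. y \<in> N \<Longrightarrow> (\<lambda>i\<in>verts Q. c \<cdot>\<^sub>v y i) \<in> N"
  shows "\<exists>P. N \<inter> supported_on n P \<subseteq> {\<lambda>i\<in>verts Q. 0\<^sub>v (n i)} \<and>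
    (\<forall>m \<in> (\<Pi>\<^sub>E i\<in>verts Q. carrier_vec (n i)).
      \<exists>y\<in>N. \<exists>z\<in>supported_on n P. m = (\<lambda>i\<in>verts Q. y i + z i))"
proof -
  let ?E = "\<Pi>\<^sub>E i\<in>verts Q. carrier_vec (n i) :: 'k vec set" and ?z = "\<lambda>i\<in>verts Q. 0\<^sub>v (n i) :: 'k vec"
  define I where "I = (SIGMA i:verts Q. {..<n i})"
  have fin_I: "finite I" by (simp add: I_def)
  let ?A = "{P \<in> Pow I. N \<inter> supported_on n P \<subseteq> {?z}}"
  have E: "m i \<in> carrier_vec (n i)" if "m \<in> ?E" "i \<in> verts Q" for m i
    using that by auto
  have eqI: "m = m'" if "m \<in> ?E" "m' \<in> ?E" "\<And>i k. i \<in> verts Q \<Longrightarrow> k < n i \<Longrightarrow> m i $ k = m' i $ k" for m m'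
  proof (rule PiE_ext[OF that(1,2)])
    fix i assume "i \<in> verts Q"
    then show "m i = m' i"
      using E[OF that(1), of i] E[OF that(2), of i] that(3) by (intro eq_vecI) auto
  qed
  have "m = ?z" if "m \<in> supported_on n {}" for m
    using that by (intro eqI) (auto simp: supported_on_def)
  then have "{} \<in> ?A" by blast
  then have "?A \<noteq> {}" by (metis (no_types, lifting) empty_iff)
  moreover have "finite ?A" using fin_I by simp
  ultimately obtain P where P: "P \<in> ?A" and max': "\<forall>P'\<in>?A. P \<subseteq> P' \<longrightarrow> P = P'"
    using finite_has_maximal[of ?A] by (elim bexE[OF finite_has_maximal])
  have P_sub: "P \<subseteq> I" and P_Int: "N \<inter> supported_on n P \<subseteq> {?z}"
    using P by simp_all
  have max: "\<not> N \<inter> supported_on n (insert p P) \<subseteq> {?z}" if "p \<in> I" "p \<notin> P" for p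
  proof
    assume "N \<inter> supported_on n (insert p P) \<subseteq> {?z}"
    then have "insert p P \<in> ?A" using that P_sub by simp
    then have "P \<subseteq> insert p P \<longrightarrow> P = insert p P" by (rule bspec[OF max'])
    then have "P = insert p P" using subset_insertI by (rule mp)
    then show False using that by (metis insertI1)
  qed
  have split: "\<exists>y\<in>N. \<exists>z\<in>supported_on n P. m = (\<lambda>i\<in>verts Q. y i + z i)" if "m \<in> ?E" for m
    using that
  proof (induction "card {(i, k) \<in> I - P. m i $ k \<noteq> 0}" arbitrary: m rule: less_induct)
    case less
    let ?S = "\<lambda>m. {(i, k) \<in> I - P. m i $ k \<noteq> (0 :: 'k)}"
    show ?case
    proof (cases "?S m = {}")
      case True
      then have "m \<in> supported_on n P"
        using less.prems by (auto simp: supported_on_def I_def)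
      moreover have "m = (\<lambda>i\<in>verts Q. ?z i + m i)"
        using less.prems E[OF less.prems] by (auto simp: PiE_iff extensional_def fun_eq_iff)
      ultimately show ?thesis using zero by blast
    next
      case False
      then obtain i k where ik: "(i, k) \<in> I" "(i, k) \<notin> P" "m i $ k \<noteq> 0" by blast
      have i: "i \<in> verts Q" and k: "k < n i" using ik(1) by (auto simp: I_def)
      obtain y where y: "y \<in> N" "y \<in> supported_on n (insert (i, k) P)" "y \<noteq> ?z"
        using max[OF ik(1,2)] by (metis (no_types, lifting) IntE singletonI subsetI)
      have yE: "y \<in> ?E" using y(1) sub by blast
      have "y i $ k \<noteq> 0"
      proof
        assume "y i $ k = 0"
        then have "y \<in> supported_on n P" using y(2) by (auto simp: supported_on_def)
        then show False using P_Int y(1,3) by blast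
      qed
      define c where "c = m i $ k / y i $ k"
      define m' where "m' = (\<lambda>j\<in>verts Q. m j + (- c) \<cdot>\<^sub>v y j)"
      have m'E: "m' \<in> ?E" using E[OF less.prems] E[OF yE] by (auto simp: m'_def)
      have m'_val: "m' j $ r = m j $ r - c * y j $ r" if "j \<in> verts Q" "r < n j" for j r
        using that E[OF less.prems that(1)] E[OF yE that(1)] by (simp add: m'_def)
      have "?S m' \<subset> ?S m"
      proof
        show "?S m' \<subseteq> ?S m"
        proof
          fix t assume "t \<in> ?S m'"
          then obtain j r where t: "t = (j, r)" "(j, r) \<in> I" "(j, r) \<notin> P" "m' j $ r \<noteq> 0" by blast
          then have jr: "j \<in> verts Q" "r < n j" by (auto simp: I_def)
          have "(j, r) \<noteq> (i, k)"
            using t(4) m'_val[OF jr] \<open>y i $ k \<noteq> 0\<close> by (auto simp: c_def)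
          then have "y j $ r = 0"
            using y(2) jr t(3) by (auto simp: supported_on_def)
          then show "t \<in> ?S m" using t m'_val[OF jr] by simp
        qed
        have "(i, k) \<in> ?S m" using ik by simp
        moreover have "(i, k) \<notin> ?S m'"
          using m'_val[OF i k] \<open>y i $ k \<noteq> 0\<close> by (simp add: c_def)
        ultimately show "?S m' \<noteq> ?S m" by metis
      qed
      moreover have "finite (?S m)"
        by (rule finite_subset[OF _ fin_I]) blast
      ultimately have "card (?S m') < card (?S m)" by (intro psubset_card_mono)
      then obtain y' z where yz: "y' \<in> N" "z \<in> supported_on n P" "m' = (\<lambda>i\<in>verts Q. y' i + z i)"
        using less.hyps m'E by blast
      have zE: "z \<in> ?E" using yz(2) by (simp add: supported_on_def)
      have y'E: "y' \<in> ?E" using yz(1) sub by blast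
      let ?cy = "\<lambda>i\<in>verts Q. c \<cdot>\<^sub>v y i"
      let ?y = "\<lambda>i\<in>verts Q. y' i + ?cy i"
      have "?y \<in> N" using add[OF yz(1) smult[OF y(1)]] .
      moreover have "m = (\<lambda>i\<in>verts Q. ?y i + z i)"
      proof (rule eqI)
        show "(\<lambda>i\<in>verts Q. ?y i + z i) \<in> ?E"
          using E[OF yE] E[OF y'E] E[OF zE] by auto
        fix j r assume jr: "j \<in> verts Q" "r < n j"
        have "m j $ r - c * y j $ r = y' j $ r + z j $ r"
          using m'_val[OF jr] yz(3) jr E[OF zE jr(1)] E[OF y'E jr(1)] by simp
        then show "m j $ r = (\<lambda>i\<in>verts Q. ?y i + z i) j $ r"
          using jr E[OF zE jr(1)] E[OF y'E jr(1)] E[OF yE jr(1)] by (simp add: algebra_simps)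
      qed (rule less.prems)
      ultimately show ?thesis using yz(2) by blast
    qed
  qed
  show ?thesis
    by (intro exI[of _ P] conjI ballI P_Int split)
qed

lemma supported_on_closed:
  "m \<in> supported_on n P \<Longrightarrow> m' \<in> supported_on n P \<Longrightarrow> (\<lambda>i\<in>verts Q. m i + m' i) \<in> supported_on n P"
  "m \<in> supported_on n P \<Longrightarrow> (\<lambda>i\<in>verts Q. c i \<cdot>\<^sub>v m i) \<in> supported_on n P"
  "(\<lambda>i\<in>verts Q. 0\<^sub>v (n i)) \<in> supported_on n P"
proof -
  have carrier: "m i \<in> carrier_vec (n i)" if "m \<in> supported_on n P" "i \<in> verts Q" for m i
    using that by (auto simp: supported_on_def)
  have vanish: "m i $ k = 0" if "m \<in> supported_on n P" "i \<in> verts Q" "k < n i" "(i, k) \<notin> P" for m i k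
    using that by (auto simp: supported_on_def)
  show "(\<lambda>i\<in>verts Q. m i + m' i) \<in> supported_on n P"
    if m: "m \<in> supported_on n P" "m' \<in> supported_on n P"
  proof -
    have "(m i + m' i) $ k = 0" if "i \<in> verts Q" "k < n i" "(i, k) \<notin> P" for i k
      using that carrier[OF m(2) that(1)] vanish[OF m(1) that] vanish[OF m(2) that] by simp
    then show ?thesis
      using carrier[OF m(1)] carrier[OF m(2)] by (simp add: supported_on_def)
  qed
  show "(\<lambda>i\<in>verts Q. c i \<cdot>\<^sub>v m i) \<in> supported_on n P" if m: "m \<in> supported_on n P"
  proof -
    have "(c i \<cdot>\<^sub>v m i) $ k = 0" if "i \<in> verts Q" "k < n i" "(i, k) \<notin> P" for i k
      using that carrier[OF m that(1)] vanish[OF m that] by simp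
    then show ?thesis
      using carrier[OF m] by (simp add: supported_on_def)
  qed
  show "(\<lambda>i\<in>verts Q. 0\<^sub>v (n i)) \<in> supported_on n P"
    by (simp add: supported_on_def)
qed

end

context path_algebra_module
begin

context
  fixes n f
  assumes hom: "f \<in> LinearCombinations.module_hom \<Lambda> (vertex_module Q n) S"
    and bij: "bij_betw f (carrier (vertex_module Q n)) (carrier S)"
begin

abbreviation E :: "('v \<Rightarrow> 'k vec) set" where
  "E \<equiv> \<Pi>\<^sub>E i\<in>verts Q. carrier_vec (n i)"

lemma carrier_E: "carrier (vertex_module Q n) = E"
  by (simp add: vertex_module_def)

lemma iso_closed: "m \<in> E \<Longrightarrow> f m \<in> carrier S"
  using bij_betwE[OF bij] by (simp add: carrier_E)

lemma iso_add: "m \<in> E \<Longrightarrow> m' \<in> E \<Longrightarrow> f (\<lambda>i\<in>verts Q. m i + m' i) = f m \<oplus>\<^bsub>S\<^esub> f m'"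
  using LinearCombinations.module_hom_add[OF hom, of m m'] by (simp add: vertex_module_def)

lemma iso_smult: "a \<in> carrier \<Lambda> \<Longrightarrow> m \<in> E \<Longrightarrow> f (\<lambda>i\<in>verts Q. a (i, []) \<cdot>\<^sub>v m i) = a \<odot>\<^bsub>S\<^esub> f m"
  using LinearCombinations.module_hom_smult[OF hom, of a m] by (simp add: vertex_module_def)

lemma iso_scalar: "m \<in> E \<Longrightarrow> f (\<lambda>i\<in>verts Q. c \<cdot>\<^sub>v m i) = scalar c \<odot>\<^bsub>S\<^esub> f m"
proof -
  assume m: "m \<in> E"
  have "(\<lambda>i\<in>verts Q. scalar c (i, []) \<cdot>\<^sub>v m i) = (\<lambda>i\<in>verts Q. c \<cdot>\<^sub>v m i)"
    by (intro restrict_ext) simp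
  then show ?thesis using iso_smult[OF scalar_closed m, of c] by simp
qed

lemma zero_E: "(\<lambda>i\<in>verts Q. 0\<^sub>v (n i)) \<in> E"
  by auto

lemma iso_zero: "f (\<lambda>i\<in>verts Q. 0\<^sub>v (n i)) = \<zero>\<^bsub>S\<^esub>"
proof -
  have "(\<lambda>i\<in>verts Q. 0 \<cdot>\<^sub>v 0\<^sub>v (n i)) = (\<lambda>i\<in>verts Q. 0\<^sub>v (n i) :: 'k vec)"
    by (intro restrict_ext) auto
  moreover have "(\<lambda>i\<in>verts Q. 0 \<cdot>\<^sub>v (\<lambda>i\<in>verts Q. 0\<^sub>v (n i) :: 'k vec) i) = (\<lambda>i\<in>verts Q. 0 \<cdot>\<^sub>v 0\<^sub>v (n i))"
    by (intro restrict_ext) auto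
  moreover have "scalar 0 = \<zero>\<^bsub>\<Lambda>\<^esub>" by auto
  ultimately show ?thesis
    using iso_scalar[OF zero_E, of 0] S.smult_zero_left[OF iso_closed[OF zero_E]] by metis
qed

lemma iso_inj: "m \<in> E \<Longrightarrow> m' \<in> E \<Longrightarrow> f m = f m' \<Longrightarrow> m = m'"
  using bij_betw_imp_inj_on[OF bij] by (simp add: carrier_E inj_on_def)

lemma iso_surj: "y \<in> carrier S \<Longrightarrow> \<exists>m\<in>E. y = f m"
  using bij_betw_imp_surj_on[OF bij] by (auto simp: carrier_E)

lemma semisimple_if_iso: "semisimple_module \<Lambda> S"
  unfolding semisimple_module_def
proof (intro conjI allI impI)
  show "left_module \<Lambda> S" by (rule S.left_module_axioms)
  fix N assume "Module.submodule N \<Lambda> S"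
  note N = S.submoduleD[OF this]
  let ?N = "{m \<in> E. f m \<in> N}"
  have "\<exists>P. ?N \<inter> supported_on n P \<subseteq> {\<lambda>i\<in>verts Q. 0\<^sub>v (n i)} \<and>
    (\<forall>m\<in>E. \<exists>y\<in>?N. \<exists>z\<in>supported_on n P. m = (\<lambda>i\<in>verts Q. y i + z i))"
  proof (rule supported_on_complement)
    show "?N \<subseteq> E" by blast
    show "(\<lambda>i\<in>verts Q. 0\<^sub>v (n i)) \<in> ?N" using N(2) iso_zero by auto
    show "(\<lambda>i\<in>verts Q. y i + z i) \<in> ?N" if "y \<in> ?N" "z \<in> ?N" for y z
      using that N(3) iso_add by (auto intro!: add_carrier_vec)
    show "(\<lambda>i\<in>verts Q. c \<cdot>\<^sub>v y i) \<in> ?N" if "y \<in> ?N" for c y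
      using that N(4)[OF scalar_closed, of "f y" c] iso_scalar[of y c] by auto
  qed
  then obtain P where P0: "?N \<inter> supported_on n P \<subseteq> {\<lambda>i\<in>verts Q. 0\<^sub>v (n i)}"
    and P1: "\<And>m. m \<in> E \<Longrightarrow> \<exists>y\<in>?N. \<exists>z\<in>supported_on n P. m = (\<lambda>i\<in>verts Q. y i + z i)"
    by (elim exE conjE) simp
  have sE: "m \<in> E" if "m \<in> supported_on n P" for m
    using that by (simp add: supported_on_def)
  let ?C = "f ` supported_on n P"
  have zero_C: "\<zero>\<^bsub>S\<^esub> \<in> ?C"
    using imageI[OF supported_on_closed(3)[of n P], of f] by (simp only: iso_zero)
  have "Module.submodule ?C \<Lambda> S"
  proof (rule S.submoduleI)
    show "?C \<subseteq> carrier S" using iso_closed sE by blast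
    show "\<zero>\<^bsub>S\<^esub> \<in> ?C" by (rule zero_C)
    show "x \<oplus>\<^bsub>S\<^esub> y \<in> ?C" if "x \<in> ?C" "y \<in> ?C" for x y
    proof -
      obtain m m' where m: "m \<in> supported_on n P" "x = f m" "m' \<in> supported_on n P" "y = f m'"
        using \<open>x \<in> ?C\<close> \<open>y \<in> ?C\<close> by (elim imageE)
      show ?thesis
        using imageI[OF supported_on_closed(1)[OF m(1,3)], of f]
        by (simp only: iso_add[OF sE[OF m(1)] sE[OF m(3)]] m(2,4))
    qed
    show "a \<odot>\<^bsub>S\<^esub> y \<in> ?C" if "a \<in> carrier \<Lambda>" "y \<in> ?C" for a y
    proof -
      obtain m where m: "m \<in> supported_on n P" "y = f m"
        using \<open>y \<in> ?C\<close> by blast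
      then show ?thesis
        using imageI[OF supported_on_closed(2)[OF m(1), of "\<lambda>i. a (i, [])"], of f]
        by (simp only: iso_smult[OF \<open>a \<in> carrier \<Lambda>\<close> sE[OF m(1)]])
    qed
  qed
  moreover have "N \<inter> ?C = {\<zero>\<^bsub>S\<^esub>}"
  proof
    show "N \<inter> ?C \<subseteq> {\<zero>\<^bsub>S\<^esub>}"
    proof
      fix y assume "y \<in> N \<inter> ?C"
      then obtain m where m: "m \<in> supported_on n P" "y = f m" "f m \<in> N" by blast
      then have "m \<in> ?N \<inter> supported_on n P" using sE by simp
      then have "m = (\<lambda>i\<in>verts Q. 0\<^sub>v (n i))" using P0 by (simp add: subset_iff)
      then show "y \<in> {\<zero>\<^bsub>S\<^esub>}" using m(2) iso_zero by simp
    qed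
    show "{\<zero>\<^bsub>S\<^esub>} \<subseteq> N \<inter> ?C"
      using N(2) zero_C by simp
  qed
  moreover have "N <+>\<^bsub>S\<^esub> ?C = carrier S"
  proof
    show "N <+>\<^bsub>S\<^esub> ?C \<subseteq> carrier S"
      using N(1) iso_closed sE S.M.a_closed unfolding set_add_def' by blast
    show "carrier S \<subseteq> N <+>\<^bsub>S\<^esub> ?C"
    proof
      fix x assume "x \<in> carrier S"
      then obtain m where m: "m \<in> E" "x = f m" using iso_surj by blast
      obtain y z where yz: "y \<in> E" "f y \<in> N" "z \<in> supported_on n P" "m = (\<lambda>i\<in>verts Q. y i + z i)"
        using P1[OF m(1)] by blast
      have "x = f y \<oplus>\<^bsub>S\<^esub> f z" using iso_add[OF yz(1) sE[OF yz(3)]] m(2) yz(4) by simp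
      then show "x \<in> N <+>\<^bsub>S\<^esub> ?C" using yz(2,3) unfolding set_add_def' by blast
    qed
  qed
  ultimately show "\<exists>N'. Module.submodule N' \<Lambda> S \<and> N \<inter> N' = {\<zero>\<^bsub>S\<^esub>} \<and> N <+>\<^bsub>S\<^esub> N' = carrier S"
    by (intro exI[of _ ?C] conjI)
qed

lemma finite_dimensional_if_iso: "finite_dimensional Q S"
proof -
  interpret V: vectorspace class_ring V by (rule vectorspace_V)
  define A where "A = (\<lambda>(i, k). f (single_vertex n i (unit_vec (n i) k))) ` (SIGMA i:verts Q. {..<n i})"
  have A: "finite A" "A \<subseteq> carrier V"
    by (auto simp: A_def intro!: iso_closed single_vertex_closed)
  interpret span: LinearCombinations.submodule class_ring "V.span A" V
    using A(2) by (rule V.span_is_submodule)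
  have "f m \<in> V.span A" if m: "m \<in> E" for m
  proof -
    have "m \<in> {m \<in> E. f m \<in> V.span A}" (is "_ \<in> ?X")
    proof (rule vertexwise_induct[OF m])
      show "(\<lambda>i\<in>verts Q. 0\<^sub>v (n i)) \<in> ?X"
        using span.zero_closed iso_zero by auto
      show "(\<lambda>i\<in>verts Q. y i + z i) \<in> ?X" if "y \<in> ?X" "z \<in> ?X" for y z
        using that span.m_closed iso_add by (auto intro!: add_carrier_vec)
      fix i assume i: "i \<in> verts Q"
      have mi: "m i \<in> carrier_vec (n i)" using m i by auto
      have "m i \<in> {v \<in> carrier_vec (n i). single_vertex n i v \<in> ?X}" (is "_ \<in> ?Y")
      proof (rule vec_support_induct[OF mi])
        show "0\<^sub>v (n i) \<in> ?Y"
          using span.zero_closed iso_zero by (auto simp: single_vertex_zero)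
        show "v + v' \<in> ?Y" if v: "v \<in> ?Y" "v' \<in> ?Y" for v v'
          using v span.m_closed iso_add[of "single_vertex n i v" "single_vertex n i v'"]
          by (simp add: single_vertex_add)
        fix k assume k: "k < n i"
        let ?u = "single_vertex n i (unit_vec (n i) k :: 'k vec)" and ?c = "m i $ k"
        have u: "?u \<in> E" by (rule single_vertex_closed) simp
        have "f ?u \<in> A" using i k by (auto simp: A_def)
        then have "?c \<odot>\<^bsub>V\<^esub> f ?u \<in> V.span A"
          using V.in_own_span[OF A(2)] by (intro span.smult_closed) auto
        then have "f (single_vertex n i (?c \<cdot>\<^sub>v unit_vec (n i) k)) \<in> V.span A"
          unfolding single_vertex_smult iso_scalar[OF u] V_simps .
        then show "?c \<cdot>\<^sub>v unit_vec (n i) k \<in> ?Y"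
          by (simp add: single_vertex_closed)
      qed
      then show "single_vertex n i (m i) \<in> ?X" by simp
    qed
    then show ?thesis by simp
  qed
  then have "carrier V \<subseteq> V.span A" using iso_surj by auto
  then have "V.span A = carrier V" using span.subset by blast
  then show ?thesis
    unfolding finite_dimensional_def V.fin_dim_def using A by blast
qed

lemma dimension_vector_if_iso:
  assumes i: "i \<in> verts Q"
  shows "dimension_vector Q S i = n i"
proof -
  let ?C = "V\<lparr>carrier := component i\<rparr>" and ?K = "module_vec TYPE('k) (n i)"
  define g where "g v = f (single_vertex n i v)" for v
  have sE: "single_vertex n i v \<in> E" if "v \<in> carrier_vec (n i)" for v :: "'k vec"
    using that by (rule single_vertex_closed)
  have e_g: "e i \<odot>\<^bsub>S\<^esub> f m = g (m i)" if m: "m \<in> E" for m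
  proof -
    have "single_vertex n i (m i) = (\<lambda>j\<in>verts Q. e i (j, []) \<cdot>\<^sub>v m j)"
      unfolding single_vertex_def
    proof (rule restrict_ext)
      fix j assume "j \<in> verts Q"
      then have "m j \<in> carrier_vec (n j)" by (rule PiE_mem[OF m])
      then show "(if j = i then m i else 0\<^sub>v (n j)) = e i (j, []) \<cdot>\<^sub>v m j"
        by (auto intro!: eq_vecI)
    qed
    then show ?thesis using iso_smult[OF e_closed[OF i] m] by (simp only: g_def)
  qed
  have comp: "g v \<in> component i" if v: "v \<in> carrier_vec (n i)" for v
    unfolding component_def
    using e_g[OF sE[OF v]] iso_closed[OF sE[OF v]] i by (intro image_eqI[of _ _ "f (single_vertex n i v)"]) simp_all
  have image: "g ` carrier_vec (n i) = component i"
  proof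
    show "g ` carrier_vec (n i) \<subseteq> component i" using comp by blast
    show "component i \<subseteq> g ` carrier_vec (n i)"
    proof
      fix y assume "y \<in> component i"
      then obtain m where m: "m \<in> E" "y = e i \<odot>\<^bsub>S\<^esub> f m"
        using iso_surj by (auto simp: component_def)
      then show "y \<in> g ` carrier_vec (n i)"
        using e_g[OF m(1)] i PiE_mem[OF m(1) i] by simp
    qed
  qed
  have inj: "inj_on g (carrier_vec (n i))"
  proof (rule inj_onI)
    fix v v' assume v: "v \<in> carrier_vec (n i)" "v' \<in> carrier_vec (n i)" "g v = g v'"
    then have "single_vertex n i v = single_vertex n i v'"
      using iso_inj[OF sE sE] by (simp add: g_def)
    then show "v = v'" using i by (auto dest: fun_cong[of _ _ i])
  qed
  interpret vec: vec_space "TYPE('k)" "n i" .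
  have "linear_map class_ring ?K ?C g"
    unfolding linear_map_def mod_hom_def mod_hom_axioms_def LinearCombinations.module_hom_def
  proof (intro conjI CollectI allI impI)
    show "vectorspace class_ring ?K" by (rule vec_vs)
    then show "module class_ring ?K" by (rule vectorspace.axioms(1))
    show "vectorspace class_ring ?C" by (rule component_space[OF i])
    then show "module class_ring ?C" by (rule vectorspace.axioms(1))
    show "g \<in> carrier ?K \<rightarrow> carrier ?C" using comp by (auto simp: module_vec_simps)
    fix v v' assume "v \<in> carrier ?K \<and> v' \<in> carrier ?K"
    then have v: "v \<in> carrier_vec (n i)" "v' \<in> carrier_vec (n i)" by (auto simp: module_vec_simps)
    then show "g (v \<oplus>\<^bsub>?K\<^esub> v') = g v \<oplus>\<^bsub>?C\<^esub> g v'"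
      using iso_add[OF sE[OF v(1)] sE[OF v(2)]] by (simp add: g_def module_vec_simps single_vertex_add)
  next
    fix c :: 'k and v assume "c \<in> carrier class_ring \<and> v \<in> carrier ?K"
    then have v: "v \<in> carrier_vec (n i)" by (auto simp: module_vec_simps)
    then show "g (c \<odot>\<^bsub>?K\<^esub> v) = c \<odot>\<^bsub>?C\<^esub> g v"
      using iso_scalar[OF sE[OF v], of c] by (simp add: g_def module_vec_simps single_vertex_smult)
  qed
  then have "vectorspace.dim class_ring ?K = vectorspace.dim class_ring ?C"
    using inj image vec.fin_dim by (intro linear_map.dim_eq) (auto simp: module_vec_simps)
  then show ?thesis
    by (simp add: dimension_vector_eq vec.dim_is_n)
qed

end

theorem module_iso_vertex_module_iff:
  "module_iso \<Lambda> (vertex_module Q n) S \<longleftrightarrow>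
    semisimple_module \<Lambda> S \<and> finite_dimensional Q S \<and> (\<forall>i\<in>verts Q. dimension_vector Q S i = n i)"
proof
  assume "module_iso \<Lambda> (vertex_module Q n) S"
  then obtain f where f: "f \<in> LinearCombinations.module_hom \<Lambda> (vertex_module Q n) S"
      "bij_betw f (carrier (vertex_module Q n)) (carrier S)"
    unfolding module_iso_def by (elim bexE)
  show "semisimple_module \<Lambda> S \<and> finite_dimensional Q S \<and> (\<forall>i\<in>verts Q. dimension_vector Q S i = n i)"
    using semisimple_if_iso[OF f] finite_dimensional_if_iso[OF f] dimension_vector_if_iso[OF f] by simp
next
  assume "semisimple_module \<Lambda> S \<and> finite_dimensional Q S \<and> (\<forall>i\<in>verts Q. dimension_vector Q S i = n i)"
  then show "module_iso \<Lambda> (vertex_module Q n) S"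
    by (intro semisimple_module_iso_vertex_module) simp_all
qed

end

section \<open>The generic radical layering\<close>

lemma module_iso_trans:
  assumes "module_iso R L M" "module_iso R M N"
  shows "module_iso R L N"
proof -
  obtain f where f: "f \<in> LinearCombinations.module_hom R L M" "bij_betw f (carrier L) (carrier M)"
    using assms(1) unfolding module_iso_def by (elim bexE)
  obtain g where g: "g \<in> LinearCombinations.module_hom R M N" "bij_betw g (carrier M) (carrier N)"
    using assms(2) unfolding module_iso_def by (elim bexE)
  have "g \<circ> f \<in> LinearCombinations.module_hom R L N"
    using f(1) g(1) unfolding LinearCombinations.module_hom_def by (auto simp: Pi_iff)
  then show ?thesis
    using bij_betw_trans[OF f(2) g(2)] unfolding module_iso_def by (intro bexI)
qed

lemma module_iso_sym:
  assumes iso: "module_iso R M N"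
    and add: "\<And>x y. x \<in> carrier M \<Longrightarrow> y \<in> carrier M \<Longrightarrow> x \<oplus>\<^bsub>M\<^esub> y \<in> carrier M"
    and smult: "\<And>a x. a \<in> carrier R \<Longrightarrow> x \<in> carrier M \<Longrightarrow> a \<odot>\<^bsub>M\<^esub> x \<in> carrier M"
  shows "module_iso R N M"
proof -
  obtain f where f: "f \<in> LinearCombinations.module_hom R M N" and bij: "bij_betw f (carrier M) (carrier N)"
    using iso unfolding module_iso_def by (elim bexE)
  let ?g = "inv_into (carrier M) f"
  have g_f: "?g (f x) = x" if "x \<in> carrier M" for x
    using bij that by (rule bij_betw_inv_into_left)
  have g: "?g y \<in> carrier M" "f (?g y) = y" if "y \<in> carrier N" for y
    using bij_betw_inv_into_right[OF bij that] bij_betwE[OF bij_betw_inv_into[OF bij]] that by auto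
  have "?g \<in> LinearCombinations.module_hom R N M"
    unfolding LinearCombinations.module_hom_def
  proof (intro CollectI conjI allI impI)
    show "?g \<in> carrier N \<rightarrow> carrier M" using g(1) by blast
    fix x y assume "x \<in> carrier N \<and> y \<in> carrier N"
    then show "?g (x \<oplus>\<^bsub>N\<^esub> y) = ?g x \<oplus>\<^bsub>M\<^esub> ?g y"
      using LinearCombinations.module_hom_add[OF f, of "?g x" "?g y"] g_f[OF add, of "?g x" "?g y"] g
      by simp
  next
    fix a x assume "a \<in> carrier R \<and> x \<in> carrier N"
    then show "?g (a \<odot>\<^bsub>N\<^esub> x) = a \<odot>\<^bsub>M\<^esub> ?g x"
      using LinearCombinations.module_hom_smult[OF f, of a "?g x"] g_f[OF smult, of a "?g x"] g
      by simp
  qed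
  then show ?thesis
    using bij_betw_inv_into[OF bij] unfolding module_iso_def by (intro bexI)
qed

lemma (in acyclic_quiver) vertex_module_iso_sym:
  "module_iso \<Lambda> (vertex_module Q n) N \<Longrightarrow> module_iso \<Lambda> N (vertex_module Q n)"
  by (erule module_iso_sym) simp_all

lemma (in acyclic_quiver) times_adjacency_eq:
  "times_adjacency Q v j = (\<Sum>e\<in>{e \<in> arcs Q. head Q e = j}. v (tail Q e))"
proof -
  have "(\<Sum>e\<in>{e \<in> arcs Q. head Q e = j}. v (tail Q e))
      = (\<Sum>i\<in>verts Q. \<Sum>e\<in>{e \<in> {e \<in> arcs Q. head Q e = j}. tail Q e = i}. v (tail Q e))"
    by (intro sum.group[symmetric]) auto
  also have "\<dots> = (\<Sum>i\<in>verts Q. \<Sum>e\<in>{e \<in> arcs Q. tail Q e = i \<and> head Q e = j}. v i)"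
    by (intro sum.cong) auto
  finally show ?thesis
    by (simp add: times_adjacency_def adjacency_def mult.commute)
qed

text \<open>
  With \<open>w = generic_dim d\<close>, the sums telescope to \<open>\<d> - (\<Sum>i\<le>l. t
  i) = w (Suc l)\<close>, and \<open>sup 0 (w - w B) = w - min w (w B)\<close>.
\<close>

lemma (in acyclic_quiver) recursion_eq_generic_dim_diff:
  fixes d :: "'v \<Rightarrow> nat" and t :: "nat \<Rightarrow> 'v \<Rightarrow> int"
  defines "\<d> \<equiv> (\<lambda>i. int (d i))"
  assumes t_0: "t 0 = sup 0 (\<d> - times_adjacency Q \<d>)"
    and t_Suc: "\<And>l. l < L \<Longrightarrow>
      t (Suc l) = sup 0 ((\<d> - (\<Sum>i\<le>l. t i)) - times_adjacency Q (\<d> - (\<Sum>i\<le>l. t i)))"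
  assumes "l \<le> L" and j: "j \<in> verts Q"
  shows "t l j = int (generic_dim d l j - generic_dim d (Suc l) j)"
proof -
  let ?w = "\<lambda>l i. int (generic_dim d l i)"
  have layer: "sup 0 (?w l - times_adjacency Q (?w l)) i = ?w l i - ?w (Suc l) i" for l i
  proof -
    have "times_adjacency Q (?w l) i = int (\<Sum>e\<in>{e \<in> arcs Q. head Q e = i}. generic_dim d l (tail Q e))"
      by (simp add: times_adjacency_eq)
    moreover have "sup 0 (int a - int b) = int a - int (min a b)" for a b
      by (auto simp: sup_max max_def min_def)
    ultimately show ?thesis
      by (simp only: sup_apply minus_apply zero_fun_apply generic_dim.simps)
  qed
  have "t l = (\<lambda>i. ?w l i - ?w (Suc l) i) \<and> \<d> - (\<Sum>i\<le>l. t i) = ?w (Suc l)" if "l \<le> L" for l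
    using that
  proof (induction l)
    case 0
    have "\<d> = ?w 0" by (simp add: \<d>_def)
    then have "t 0 = (\<lambda>i. ?w 0 i - ?w (Suc 0) i)"
      unfolding t_0 using layer[of 0] by (intro ext) (simp only:)
    then show ?case by (auto simp: \<d>_def fun_eq_iff)
  next
    case (Suc l)
    have IH: "\<d> - (\<Sum>i\<le>l. t i) = ?w (Suc l)"
      by (rule Suc.IH[OF Suc_leD[OF Suc.prems], THEN conjunct2])
    have t: "t (Suc l) = (\<lambda>i. ?w (Suc l) i - ?w (Suc (Suc l)) i)"
      unfolding t_Suc[OF Suc_le_lessD[OF Suc.prems]] IH using layer[of "Suc l"] by (intro ext) (simp only:)
    have "\<d> - (\<Sum>i\<le>Suc l. t i) = ?w (Suc l) - t (Suc l)"
      by (simp only: sum.atMost_Suc diff_diff_eq[symmetric] IH)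
    then show ?case using t by (auto simp: fun_eq_iff)
  qed
  then show ?thesis
    using \<open>l \<le> L\<close> generic_dim_antimono[of d l j] by (simp add: of_nat_diff)
qed

theorem corollary4p2:
  fixes Q :: "('v, 'e) pre_digraph"
    and d :: "'v \<Rightarrow> nat"
    and t :: "nat \<Rightarrow> 'v \<Rightarrow> int"
    and S :: "nat \<Rightarrow> (('v, 'e) path \<Rightarrow> 'k::alg_closed_field, 'm) module"
  defines "L \<equiv> max_path_length Q"
    and "\<Lambda> \<equiv> path_algebra Q :: (('v, 'e) path \<Rightarrow> 'k) ring"
    and "\<d> \<equiv> (\<lambda>i. int (d i))"
  assumes "fin_digraph Q"
    and "\<nexists>p. pre_digraph.cycle Q p"
    and "t 0 = sup 0 (\<d> - times_adjacency Q \<d>)"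
    and "\<And>l. l < L \<Longrightarrow>
           t (Suc l) = sup 0 ((\<d> - (\<Sum>i\<le>l. t i)) - times_adjacency Q (\<d> - (\<Sum>i\<le>l. t i)))"
    and "\<And>l. l \<le> L \<Longrightarrow> left_module \<Lambda> (S l)"
  shows "(\<exists>x \<in> Rep Q d. generic_radical_layering Q d
            (radical_layering \<Lambda> (rep_module Q d x)))
    \<and> (generic_radical_layering Q d S \<longleftrightarrow>
         (\<forall>l\<le>L. semisimple_module \<Lambda> (S l) \<and> finite_dimensional Q (S l) \<and>
            (\<forall>i\<in>verts Q. int (dimension_vector Q (S l) i) = t l i)))"
proof -
  interpret Q: acyclic_quiver Q
    using assms(4,5) by (simp add: acyclic_quiver_def acyclic_quiver_axioms_def)
  define n where "n l i = Q.generic_dim d l i - Q.generic_dim d (Suc l) i" for l i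
  have t: "t l i = int (n l i)" if "l \<le> L" "i \<in> verts Q" for l i
    unfolding n_def using assms(6,7) that unfolding \<d>_def by (rule Q.recursion_eq_generic_dim_diff)
  let ?layer = "\<lambda>x. radical_layering \<Lambda> (rep_module Q d x)"
  let ?E = "\<lambda>l. vertex_module Q (n l) :: (('v, 'e) path \<Rightarrow> 'k, 'v \<Rightarrow> 'k vec) module"
  obtain U :: "('e \<Rightarrow> 'k mat) set" and G where U: "openin (zariski Q d) U" "U \<noteq> {}" "U \<subseteq> Rep Q d"
    and all: "\<forall>x\<in>U. adapted_rep Q d x (Q.generic_dim d) (Suc L) (G x)"
    using Q.generic_adapted_rep[of d L, where 'k = 'k] by (elim exE conjE)
  note adapted = bspec[OF all]
  have U_layer: "module_iso \<Lambda> (?E l) (?layer x l)" if "x \<in> U" "l \<le> L" for x l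
    using adapted_rep.module_iso_radical_layering[OF adapted[OF that(1)], of l] that(2)
    unfolding n_def \<Lambda>_def by simp
  have sym: "module_iso \<Lambda> N (?E l)" if "module_iso \<Lambda> (?E l) N"
    for l and N :: "(('v, 'e) path \<Rightarrow> 'k, 'x) module"
    using that unfolding \<Lambda>_def by (rule Q.vertex_module_iso_sym)
  have generic_if: "generic_radical_layering Q d N" if "\<And>l. l \<le> L \<Longrightarrow> module_iso \<Lambda> (?E l) (N l)"
    for N :: "nat \<Rightarrow> (('v, 'e) path \<Rightarrow> 'k, 'x) module"
    unfolding generic_radical_layering_def
    using U(1) zariski_open_dense[OF U(1,2)] module_iso_trans[OF sym[OF U_layer] that]
    by (intro exI[of _ U]) (simp add: L_def \<Lambda>_def)
  have S_iff: "module_iso \<Lambda> (?E l) (S l) \<longleftrightarrow> semisimple_module \<Lambda> (S l) \<and> finite_dimensional Q (S l) \<and>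
      (\<forall>i\<in>verts Q. int (dimension_vector Q (S l) i) = t l i)" if l: "l \<le> L" for l
  proof -
    interpret S: path_algebra_module Q "S l"
      using assms(8)[OF l] unfolding path_algebra_module_def \<Lambda>_def by (intro conjI Q.acyclic_quiver_axioms)
    show ?thesis
      unfolding \<Lambda>_def S.module_iso_vertex_module_iff using t[OF l] by simp
  qed
  obtain x where x: "x \<in> U" using U(2) by blast
  have "generic_radical_layering Q d (?layer x)"
    by (rule generic_if[OF U_layer[OF x]])
  moreover have "generic_radical_layering Q d S \<longleftrightarrow> (\<forall>l\<le>L. module_iso \<Lambda> (?E l) (S l))"
  proof
    assume "generic_radical_layering Q d S"
    then obtain W where W: "openin (zariski Q d) W" "zariski Q d closure_of W = topspace (zariski Q d)"
      and W_layer: "\<forall>x\<in>W. \<forall>l\<le>L. module_iso \<Lambda> (?layer x l) (S l)"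
      unfolding generic_radical_layering_def L_def \<Lambda>_def by (elim exE conjE)
    \<comment> \<open>At a common point of \<open>W\<close> and \<open>U\<close>, both descriptions of the layers hold.\<close>
    have "W \<inter> U \<noteq> {}"
      using W(2) U(1,2) unfolding dense_intersects_open by blast
    then obtain y where "y \<in> W" "y \<in> U" by blast
    then show "\<forall>l\<le>L. module_iso \<Lambda> (?E l) (S l)"
      using W_layer module_iso_trans[OF U_layer] by blast
  qed (rule generic_if, simp)
  ultimately show ?thesis
    using S_iff x U(3) by blast
qed

end
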